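(* Let $(H,\mu_H,\Delta_H,\alpha_H,\sigma)$ be a coquasitriangular Hom-bialgebra satisfying $\sigma=\sigma\circ(\alpha_H\otimes\alpha_H)$. (i) Let $(M,\alpha_M)$ be a left $H$-comodule with coaction $m\mapsto m_{(-1)}\otimes m_{(0)}$. Define the linear map $H\otimes M\to M$, $h\otimes m\mapsto h\cdot m:=\sigma(m_{(-1)}\otimes\alpha_H(h))m_{(0)}$. Then $(M,\alpha_M)$ with these structures is a Yetter-Drinfeld module over $H$. (ii) Assume that $\alpha_H$ is bijective. Let $(M,\alpha_M)$ be as in (i) and let $(N,\alpha_N)$ be another left $H$-comodule with coaction $n\mapsto n_{(-1)}\otimes n_{(0)}$, regarded as a Yetter-Drinfeld module as in (i), via the map $H\otimes N\to N$, $h\otimes n\mapsto h\cdot n:=\sigma(n_{(-1)}\otimes\alpha_H(h))n_{(0)}$. Regard $(M\otimes N,\alpha_M\otimes\alpha_N)$ as a left $H$-comodule via $m\otimes n\mapsto m_{(-1)}n_{(-1)}\otimes(m_{(0)}\otimes n_{(0)})$, and then as a Yetter-Drinfeld module as in (i). Then this Yetter-Drinfeld module coincides with the Yetter-Drinfeld module $M\tilde\otimes N$, that is, $(M\otimes N,\alpha_M\otimes\alpha_N)$ with action $h\cdot(m\otimes n)=\alpha_H^{-2}(h_1)\cdot m\otimes\alpha_H^{-2}(h_2)\cdot n$ and coaction $m\otimes n\mapsto m_{(-1)}n_{(-1)}\otimes(m_{(0)}\otimes n_{(0)})$.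
   Context: Everything is over a field $k$, $\otimes=\otimes_k$; (co)algebras are not assumed (co)unital. Sweedler notation: $\Delta(h)=h_1\otimes h_2$; multiplications are written by juxtaposition. A Hom-bialgebra is $(H,\mu,\Delta,\alpha)$ with $\mu:H\otimes H\to H$, $\Delta:H\to H\otimes H$, $\alpha:H\to H$ linear such that for all $h,h',h''$: $\alpha(hh')=\alpha(h)\alpha(h')$; $\alpha(h)(h'h'')=(hh')\alpha(h'')$; $\Delta(h_1)\otimes\alpha(h_2)=\alpha(h_1)\otimes\Delta(h_2)$; $\Delta(hh')=h_1h'_1\otimes h_2h'_2$; $\Delta(\alpha(h))=\alpha(h_1)\otimes\alpha(h_2)$. It is coquasitriangular, with a linear map $\sigma:H\otimes H\to k$, if for all $x,y,z\in H$: $\sigma(xy\otimes\alpha(z))=\sigma(\alpha(x)\otimes z_1)\sigma(\alpha(y)\otimes z_2)$; $\sigma(\alpha(x)\otimes yz)=\sigma(x_1\otimes\alpha(z))\sigma(x_2\otimes\alpha(y))$; $y_1x_1\sigma(x_2\otimes y_2)=\sigma(x_1\otimes y_1)x_2y_2$. Let $(H,\mu_H,\Delta_H,\alpha_H)$ be a Hom-bialgebra, $M$ a linear space, $\alpha_M:M\to M$ linear. $(M,\alpha_M)$ is a left $H$-module if there is a linear map $H\otimes M\to M$, $h\otimes m\mapsto h\cdot m$, with $\alpha_M(h\cdot m)=\alpha_H(h)\cdot\alpha_M(m)$ and $\alpha_H(h)\cdot(h'\cdot m)=(hh')\cdot\alpha_M(m)$. It is a left $H$-comodule if there is a linear map $\lambda:M\to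 H\otimes M$, $\lambda(m)=m_{(-1)}\otimes m_{(0)}$, with $(\alpha_H\otimes\alpha_M)\circ\lambda=\lambda\circ\alpha_M$ and $(\Delta_H\otimes\alpha_M)\circ\lambda=(\alpha_H\otimes\lambda)\circ\lambda$. $(M,\alpha_M)$ is a (left-left) Yetter-Drinfeld module over $H$ if it is both a left $H$-module and a left $H$-comodule and, for all $h\in H$, $m\in M$, $$(h_1\cdot m)_{(-1)}\alpha_H^2(h_2)\otimes(h_1\cdot m)_{(0)}=\alpha_H^2(h_1)\alpha_H(m_{(-1)})\otimes\alpha_H(h_2)\cdot m_{(0)}.$$ *)

theory Defs
  imports "HOL-Algebra.Module" "HOL-Algebra.AbelCoset"
begin

section \<open>Linear maps and tensor products\<close>

text \<open>
  Only the additive group and the scalar multiplication of a \<^type>\<open>module\<close> record matter for a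
  vector space. The fields \<^const>\<open>mult\<close> and \<^const>\<open>one\<close> inherited from \<^type>\<open>ring\<close> are never
  used.
\<close>

definition linear_maps ::
  "('k, 'r) ring_scheme \<Rightarrow> ('k, 'a) module \<Rightarrow> ('k, 'b) module \<Rightarrow> ('a \<Rightarrow> 'b) set"
  where "linear_maps R A B =
    {f \<in> carrier A \<rightarrow> carrier B.
      (\<forall>x \<in> carrier A. \<forall>y \<in> carrier A. f (x \<oplus>\<^bsub>A\<^esub> y) = f x \<oplus>\<^bsub>B\<^esub> f y) \<and>
      (\<forall>c \<in> carrier R. \<forall>x \<in> carrier A. f (c \<odot>\<^bsub>A\<^esub> x) = c \<odot>\<^bsub>B\<^esub> f x)}"

definition scalar_module :: "('k, 'r) ring_scheme \<Rightarrow> ('k, 'k) module"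
  where "scalar_module R =
    \<lparr>carrier = carrier R, mult = mult R, one = one R, zero = zero R, add = add R,
      smult = mult R\<rparr>"

definition free_module :: "('k, 'r) ring_scheme \<Rightarrow> 'x set \<Rightarrow> ('k, 'x \<Rightarrow> 'k) module"
  where "free_module R X =
    \<lparr>carrier = {p. range p \<subseteq> carrier R \<and> finite {x. p x \<noteq> \<zero>\<^bsub>R\<^esub>} \<and> {x. p x \<noteq> \<zero>\<^bsub>R\<^esub>} \<subseteq> X},
      mult = undefined, one = undefined,
      zero = (\<lambda>x. \<zero>\<^bsub>R\<^esub>), add = (\<lambda>p q x. p x \<oplus>\<^bsub>R\<^esub> q x), smult = (\<lambda>c p x. c \<otimes>\<^bsub>R\<^esub> p x)\<rparr>"

definition free_gen :: "('k, 'r) ring_scheme \<Rightarrow> 'x \<Rightarrow> 'x \<Rightarrow> 'k"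
  where "free_gen R x = (\<lambda>y. if y = x then \<one>\<^bsub>R\<^esub> else \<zero>\<^bsub>R\<^esub>)"

definition quotient_module ::
  "('k, 'a) module \<Rightarrow> 'a set \<Rightarrow> ('k, 'a set) module"
  where "quotient_module M S =
    \<lparr>carrier = a_rcosets\<^bsub>M\<^esub> S, mult = undefined, one = undefined,
      zero = S, add = set_add M, smult = (\<lambda>c X. \<Union>x\<in>X. S +>\<^bsub>M\<^esub> (c \<odot>\<^bsub>M\<^esub> x))\<rparr>"

definition bilinear_relators ::
  "('k, 'r) ring_scheme \<Rightarrow> ('k, 'a) module \<Rightarrow> ('k, 'b) module \<Rightarrow> ('a \<times> 'b \<Rightarrow> 'k) set"
  where "bilinear_relators R A B =
    (let F = free_module R (carrier A \<times> carrier B); \<delta> = (\<lambda>a b. free_gen R (a, b)) in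
      {\<delta> (a \<oplus>\<^bsub>A\<^esub> a') b \<ominus>\<^bsub>F\<^esub> (\<delta> a b \<oplus>\<^bsub>F\<^esub> \<delta> a' b) | a a' b.
         a \<in> carrier A \<and> a' \<in> carrier A \<and> b \<in> carrier B} \<union>
      {\<delta> a (b \<oplus>\<^bsub>B\<^esub> b') \<ominus>\<^bsub>F\<^esub> (\<delta> a b \<oplus>\<^bsub>F\<^esub> \<delta> a b') | a b b'.
         a \<in> carrier A \<and> b \<in> carrier B \<and> b' \<in> carrier B} \<union>
      {\<delta> (c \<odot>\<^bsub>A\<^esub> a) b \<ominus>\<^bsub>F\<^esub> (c \<odot>\<^bsub>F\<^esub> \<delta> a b) | c a b.
         c \<in> carrier R \<and> a \<in> carrier A \<and> b \<in> carrier B} \<union>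
      {\<delta> a (c \<odot>\<^bsub>B\<^esub> b) \<ominus>\<^bsub>F\<^esub> (c \<odot>\<^bsub>F\<^esub> \<delta> a b) | c a b.
         c \<in> carrier R \<and> a \<in> carrier A \<and> b \<in> carrier B})"

definition tensor_relations ::
  "('k, 'r) ring_scheme \<Rightarrow> ('k, 'a) module \<Rightarrow> ('k, 'b) module \<Rightarrow> ('a \<times> 'b \<Rightarrow> 'k) set"
  where "tensor_relations R A B =
    \<Inter>{S. submodule S R (free_module R (carrier A \<times> carrier B)) \<and> bilinear_relators R A B \<subseteq> S}"

definition tensor ::
  "('k, 'r) ring_scheme \<Rightarrow> ('k, 'a) module \<Rightarrow> ('k, 'b) module \<Rightarrow> ('k, ('a \<times> 'b \<Rightarrow> 'k) set) module"
  (infixr \<open>\<boxtimes>\<index>\<close> 70)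
  where "A \<boxtimes>\<^bsub>R\<^esub> B =
    quotient_module (free_module R (carrier A \<times> carrier B)) (tensor_relations R A B)"

text \<open>The pure tensor \<open>a \<otimes> b\<close> in \<open>A \<otimes> B\<close>.\<close>

definition pure ::
  "('k, 'r) ring_scheme \<Rightarrow> ('k, 'a) module \<Rightarrow> ('k, 'b) module \<Rightarrow> 'a \<Rightarrow> 'b \<Rightarrow> ('a \<times> 'b \<Rightarrow> 'k) set"
  where "pure R A B a b =
    tensor_relations R A B +>\<^bsub>free_module R (carrier A \<times> carrier B)\<^esub> free_gen R (a, b)"

text \<open>
  The value at \<open>t \<in> A \<otimes> B\<close> of the linear map \<open>A \<otimes> B \<rightarrow> P\<close> induced by a bilinear map
  \<open>f\<close> from \<open>A \<times> B\<close> to \<open>P\<close>: if \<open>t = \<Sum>\<^sub>i c\<^sub>i (a\<^sub>i \<otimes> b\<^sub>i)\<close>, it is \<open>\<Sum>\<^sub>i c\<^sub>i f a\<^sub>i b\<^sub>i\<close>. For bilinear \<open>f\<close> the choice of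
  the representative is irrelevant. It renders Sweedler notation: with \<open>\<Delta>(h) = h\<^sub>1 \<otimes> h\<^sub>2\<close>, the
  expression \<open>f h\<^sub>1 h\<^sub>2\<close> is \<open>tensor_lift R P (\<Delta> h) (\<lambda>h\<^sub>1 h\<^sub>2. f h\<^sub>1 h\<^sub>2)\<close>.
\<close>

definition tensor_lift ::
  "('k, 'r) ring_scheme \<Rightarrow> ('k, 'p) module \<Rightarrow> ('a \<times> 'b \<Rightarrow> 'k) set \<Rightarrow> ('a \<Rightarrow> 'b \<Rightarrow> 'p) \<Rightarrow> 'p"
  where "tensor_lift R P t f =
    (let p = (SOME p. p \<in> t) in
      \<Oplus>\<^bsub>P\<^esub>x \<in> {x. p x \<noteq> \<zero>\<^bsub>R\<^esub>}. p x \<odot>\<^bsub>P\<^esub> f (fst x) (snd x))"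

text \<open>\<open>f \<otimes> g\<close> for linear maps \<open>f\<close> into \<open>C\<close> and \<open>g\<close> into \<open>D\<close>.\<close>

definition tensor_map ::
  "('k, 'r) ring_scheme \<Rightarrow> ('k, 'c) module \<Rightarrow> ('k, 'd) module \<Rightarrow> ('a \<Rightarrow> 'c) \<Rightarrow> ('b \<Rightarrow> 'd)
    \<Rightarrow> ('a \<times> 'b \<Rightarrow> 'k) set \<Rightarrow> ('c \<times> 'd \<Rightarrow> 'k) set"
  where "tensor_map R C D f g t = tensor_lift R (C \<boxtimes>\<^bsub>R\<^esub> D) t (\<lambda>a b. pure R C D (f a) (g b))"

text \<open>The identification \<open>(A \<otimes> B) \<otimes> C \<cong> A \<otimes> (B \<otimes> C)\<close>.\<close>

definition tensor_assoc ::
  "('k, 'r) ring_scheme \<Rightarrow> ('k, 'a) module \<Rightarrow> ('k, 'b) module \<Rightarrow> ('k, 'c) module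
    \<Rightarrow> (('a \<times> 'b \<Rightarrow> 'k) set \<times> 'c \<Rightarrow> 'k) set \<Rightarrow> ('a \<times> ('b \<times> 'c \<Rightarrow> 'k) set \<Rightarrow> 'k) set"
  where "tensor_assoc R A B C t =
    tensor_lift R (A \<boxtimes>\<^bsub>R\<^esub> B \<boxtimes>\<^bsub>R\<^esub> C) t (\<lambda>s c.
      tensor_lift R (A \<boxtimes>\<^bsub>R\<^esub> B \<boxtimes>\<^bsub>R\<^esub> C) s (\<lambda>a b. pure R A (B \<boxtimes>\<^bsub>R\<^esub> C) a (pure R B C b c)))"


section \<open>Hom-bialgebras\<close>

locale hom_bialgebra_data = field R + H: module R H
  for R (structure) and H :: "('k, 'h) module" +
  fixes \<mu> :: "('h \<times> 'h \<Rightarrow> 'k) set \<Rightarrow> 'h"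
    and \<Delta> :: "'h \<Rightarrow> ('h \<times> 'h \<Rightarrow> 'k) set"
    and \<alpha> :: "'h \<Rightarrow> 'h"
  assumes mu_linear: "\<mu> \<in> linear_maps R (H \<boxtimes> H) H"
    and delta_linear: "\<Delta> \<in> linear_maps R H (H \<boxtimes> H)"
    and alpha_linear: "\<alpha> \<in> linear_maps R H H"
begin

abbreviation Hmult (infixl \<open>\<cdot>\<close> 75)
  where "x \<cdot> y \<equiv> \<mu> (pure R H H x y)"

end

locale hom_bialgebra = hom_bialgebra_data +
  assumes alpha_mult: "\<lbrakk>h \<in> carrier H; h' \<in> carrier H\<rbrakk> \<Longrightarrow> \<alpha> (h \<cdot> h') = \<alpha> h \<cdot> \<alpha> h'"
    and hom_assoc: "\<lbrakk>h \<in> carrier H; h' \<in> carrier H; h'' \<in> carrier H\<rbrakk>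
      \<Longrightarrow> \<alpha> h \<cdot> (h' \<cdot> h'') = (h \<cdot> h') \<cdot> \<alpha> h''"
    and hom_coassoc: "h \<in> carrier H
      \<Longrightarrow> tensor_assoc R H H H (tensor_map R (H \<boxtimes> H) H \<Delta> \<alpha> (\<Delta> h))
          = tensor_map R H (H \<boxtimes> H) \<alpha> \<Delta> (\<Delta> h)"
    and delta_mult: "\<lbrakk>h \<in> carrier H; h' \<in> carrier H\<rbrakk>
      \<Longrightarrow> \<Delta> (h \<cdot> h') =
          tensor_lift R (H \<boxtimes> H) (\<Delta> h) (\<lambda>h\<^sub>1 h\<^sub>2.
            tensor_lift R (H \<boxtimes> H) (\<Delta> h') (\<lambda>h'\<^sub>1 h'\<^sub>2.
              pure R H H (h\<^sub>1 \<cdot> h'\<^sub>1) (h\<^sub>2 \<cdot> h'\<^sub>2)))"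
    and delta_alpha: "h \<in> carrier H \<Longrightarrow> \<Delta> (\<alpha> h) = tensor_map R H H \<alpha> \<alpha> (\<Delta> h)"

locale coquasitriangular_hom_bialgebra = hom_bialgebra R H \<mu> \<Delta> \<alpha>
  for R (structure) and H :: "('k, 'h) module" and \<mu> \<Delta> \<alpha> +
  fixes \<sigma> :: "('h \<times> 'h \<Rightarrow> 'k) set \<Rightarrow> 'k"
  assumes sigma_linear: "\<sigma> \<in> linear_maps R (H \<boxtimes> H) (scalar_module R)"
    and sigma_mult_left: "\<lbrakk>x \<in> carrier H; y \<in> carrier H; z \<in> carrier H\<rbrakk>
      \<Longrightarrow> \<sigma> (pure R H H (x \<cdot> y) (\<alpha> z)) =
          tensor_lift R (scalar_module R) (\<Delta> z) (\<lambda>z\<^sub>1 z\<^sub>2.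
            \<sigma> (pure R H H (\<alpha> x) z\<^sub>1) \<otimes> \<sigma> (pure R H H (\<alpha> y) z\<^sub>2))"
    and sigma_mult_right: "\<lbrakk>x \<in> carrier H; y \<in> carrier H; z \<in> carrier H\<rbrakk>
      \<Longrightarrow> \<sigma> (pure R H H (\<alpha> x) (y \<cdot> z)) =
          tensor_lift R (scalar_module R) (\<Delta> x) (\<lambda>x\<^sub>1 x\<^sub>2.
            \<sigma> (pure R H H x\<^sub>1 (\<alpha> z)) \<otimes> \<sigma> (pure R H H x\<^sub>2 (\<alpha> y)))"
    and sigma_commute: "\<lbrakk>x \<in> carrier H; y \<in> carrier H\<rbrakk>
      \<Longrightarrow> tensor_lift R H (\<Delta> x) (\<lambda>x\<^sub>1 x\<^sub>2. tensor_lift R H (\<Delta> y) (\<lambda>y\<^sub>1 y\<^sub>2.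
            \<sigma> (pure R H H x\<^sub>2 y\<^sub>2) \<odot>\<^bsub>H\<^esub> (y\<^sub>1 \<cdot> x\<^sub>1))) =
          tensor_lift R H (\<Delta> x) (\<lambda>x\<^sub>1 x\<^sub>2. tensor_lift R H (\<Delta> y) (\<lambda>y\<^sub>1 y\<^sub>2.
            \<sigma> (pure R H H x\<^sub>1 y\<^sub>1) \<odot>\<^bsub>H\<^esub> (x\<^sub>2 \<cdot> y\<^sub>2)))"


section \<open>Modules, comodules and Yetter-Drinfeld modules\<close>

locale hom_module = hom_bialgebra R H \<mu> \<Delta> \<alpha> + M: module R M
  for R (structure) and H :: "('k, 'h) module" and \<mu> \<Delta> \<alpha> and M :: "('k, 'm) module" +
  fixes \<alpha>\<^sub>M :: "'m \<Rightarrow> 'm" and act :: "('h \<times> 'm \<Rightarrow> 'k) set \<Rightarrow> 'm"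
  assumes alphaM_linear: "\<alpha>\<^sub>M \<in> linear_maps R M M"
    and act_linear: "act \<in> linear_maps R (H \<boxtimes> M) M"
    and alpha_act: "\<lbrakk>h \<in> carrier H; m \<in> carrier M\<rbrakk>
      \<Longrightarrow> \<alpha>\<^sub>M (act (pure R H M h m)) = act (pure R H M (\<alpha> h) (\<alpha>\<^sub>M m))"
    and act_act: "\<lbrakk>h \<in> carrier H; h' \<in> carrier H; m \<in> carrier M\<rbrakk>
      \<Longrightarrow> act (pure R H M (\<alpha> h) (act (pure R H M h' m))) = act (pure R H M (h \<cdot> h') (\<alpha>\<^sub>M m))"

locale hom_comodule = hom_bialgebra R H \<mu> \<Delta> \<alpha> + M: module R M
  for R (structure) and H :: "('k, 'h) module" and \<mu> \<Delta> \<alpha> and M :: "('k, 'm) module" +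
  fixes \<alpha>\<^sub>M :: "'m \<Rightarrow> 'm" and coact :: "'m \<Rightarrow> ('h \<times> 'm \<Rightarrow> 'k) set"
  assumes alphaM_linear: "\<alpha>\<^sub>M \<in> linear_maps R M M"
    and coact_linear: "coact \<in> linear_maps R M (H \<boxtimes> M)"
    and coact_alpha: "m \<in> carrier M \<Longrightarrow> tensor_map R H M \<alpha> \<alpha>\<^sub>M (coact m) = coact (\<alpha>\<^sub>M m)"
    and coact_coact: "m \<in> carrier M
      \<Longrightarrow> tensor_assoc R H H M (tensor_map R (H \<boxtimes> H) M \<Delta> \<alpha>\<^sub>M (coact m))
          = tensor_map R H (H \<boxtimes> M) \<alpha> coact (coact m)"

locale yetter_drinfeld =
  hom_module R H \<mu> \<Delta> \<alpha> M \<alpha>\<^sub>M act + hom_comodule R H \<mu> \<Delta> \<alpha> M \<alpha>\<^sub>M coact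
  for R (structure) and H :: "('k, 'h) module" and \<mu> \<Delta> \<alpha>
    and M :: "('k, 'm) module" and \<alpha>\<^sub>M act coact +
  assumes yd_compat: "\<lbrakk>h \<in> carrier H; m \<in> carrier M\<rbrakk>
      \<Longrightarrow> tensor_lift R (H \<boxtimes> M) (\<Delta> h) (\<lambda>h\<^sub>1 h\<^sub>2.
            tensor_lift R (H \<boxtimes> M) (coact (act (pure R H M h\<^sub>1 m))) (\<lambda>u v.
              pure R H M (u \<cdot> \<alpha> (\<alpha> h\<^sub>2)) v)) =
          tensor_lift R (H \<boxtimes> M) (\<Delta> h) (\<lambda>h\<^sub>1 h\<^sub>2.
            tensor_lift R (H \<boxtimes> M) (coact m) (\<lambda>u v.
              pure R H M (\<alpha> (\<alpha> h\<^sub>1) \<cdot> \<alpha> u) (act (pure R H M (\<alpha> h\<^sub>2) v))))"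

text \<open>\<open>h \<otimes> m \<mapsto> \<sigma>(m\<^sub>(\<^sub>-\<^sub>1\<^sub>) \<otimes> \<alpha>\<^sub>H(h)) m\<^sub>(\<^sub>0\<^sub>)\<close>\<close>

definition induced_action ::
  "('k, 'r) ring_scheme \<Rightarrow> ('k, 'h) module \<Rightarrow> ('h \<Rightarrow> 'h) \<Rightarrow> (('h \<times> 'h \<Rightarrow> 'k) set \<Rightarrow> 'k)
    \<Rightarrow> ('k, 'm) module \<Rightarrow> ('m \<Rightarrow> ('h \<times> 'm \<Rightarrow> 'k) set) \<Rightarrow> ('h \<times> 'm \<Rightarrow> 'k) set \<Rightarrow> 'm"
  where "induced_action R H \<alpha> \<sigma> M coact t =
    tensor_lift R M t (\<lambda>h m. tensor_lift R M (coact m) (\<lambda>u v.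
      \<sigma> (pure R H H u (\<alpha> h)) \<odot>\<^bsub>M\<^esub> v))"

text \<open>\<open>m \<otimes> n \<mapsto> m\<^sub>(\<^sub>-\<^sub>1\<^sub>) n\<^sub>(\<^sub>-\<^sub>1\<^sub>) \<otimes> (m\<^sub>(\<^sub>0\<^sub>) \<otimes> n\<^sub>(\<^sub>0\<^sub>))\<close>\<close>

definition tensor_coaction ::
  "('k, 'r) ring_scheme \<Rightarrow> ('k, 'h) module \<Rightarrow> (('h \<times> 'h \<Rightarrow> 'k) set \<Rightarrow> 'h)
    \<Rightarrow> ('k, 'm) module \<Rightarrow> ('m \<Rightarrow> ('h \<times> 'm \<Rightarrow> 'k) set)
    \<Rightarrow> ('k, 'n) module \<Rightarrow> ('n \<Rightarrow> ('h \<times> 'n \<Rightarrow> 'k) set)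
    \<Rightarrow> ('m \<times> 'n \<Rightarrow> 'k) set \<Rightarrow> ('h \<times> ('m \<times> 'n \<Rightarrow> 'k) set \<Rightarrow> 'k) set"
  where "tensor_coaction R H \<mu> M coactM N coactN t =
    tensor_lift R (H \<boxtimes>\<^bsub>R\<^esub> M \<boxtimes>\<^bsub>R\<^esub> N) t (\<lambda>m n.
      tensor_lift R (H \<boxtimes>\<^bsub>R\<^esub> M \<boxtimes>\<^bsub>R\<^esub> N) (coactM m) (\<lambda>u m\<^sub>0.
        tensor_lift R (H \<boxtimes>\<^bsub>R\<^esub> M \<boxtimes>\<^bsub>R\<^esub> N) (coactN n) (\<lambda>v n\<^sub>0.
          pure R H (M \<boxtimes>\<^bsub>R\<^esub> N) (\<mu> (pure R H H u v)) (pure R M N m\<^sub>0 n\<^sub>0))))"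

text \<open>\<open>h \<otimes> (m \<otimes> n) \<mapsto> \<alpha>\<^sub>H\<^sup>-\<^sup>2(h\<^sub>1)\<cdot>m \<otimes> \<alpha>\<^sub>H\<^sup>-\<^sup>2(h\<^sub>2)\<cdot>n\<close>\<close>

definition yd_tensor_action ::
  "('k, 'r) ring_scheme \<Rightarrow> ('k, 'h) module \<Rightarrow> ('h \<Rightarrow> ('h \<times> 'h \<Rightarrow> 'k) set) \<Rightarrow> ('h \<Rightarrow> 'h)
    \<Rightarrow> ('k, 'm) module \<Rightarrow> (('h \<times> 'm \<Rightarrow> 'k) set \<Rightarrow> 'm)
    \<Rightarrow> ('k, 'n) module \<Rightarrow> (('h \<times> 'n \<Rightarrow> 'k) set \<Rightarrow> 'n)
    \<Rightarrow> ('h \<times> ('m \<times> 'n \<Rightarrow> 'k) set \<Rightarrow> 'k) set \<Rightarrow> ('m \<times> 'n \<Rightarrow> 'k) set"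
  where "yd_tensor_action R H \<Delta> \<alpha> M actM N actN t =
    (let \<beta> = inv_into (carrier H) \<alpha> in
      tensor_lift R (M \<boxtimes>\<^bsub>R\<^esub> N) t (\<lambda>h s.
        tensor_lift R (M \<boxtimes>\<^bsub>R\<^esub> N) s (\<lambda>m n.
          tensor_lift R (M \<boxtimes>\<^bsub>R\<^esub> N) (\<Delta> h) (\<lambda>h\<^sub>1 h\<^sub>2.
            pure R M N (actM (pure R H M (\<beta> (\<beta> h\<^sub>1)) m)) (actN (pure R H N (\<beta> (\<beta> h\<^sub>2)) n))))))"

end

theory Submission
  imports Defs
begin

text \<open>
  Sweedler notation is handled by three facts about \<^const>\<open>tensor_lift\<close>: it is the linear map
  induced by a bilinear one, a linear map on a tensor product is determined by its values on pure
  tensors, and iterated lifts commute with linear maps and with each other.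

  For (i), the module axiom is \<open>\<sigma>(\<alpha>(x) \<otimes> yz) = \<sigma>(x\<^sub>1 \<otimes> \<alpha>(z)) \<sigma>(x\<^sub>2 \<otimes> \<alpha>(y))\<close> read through
  coassociativity of the coaction. In the Yetter-Drinfeld condition, coassociativity
  turns both sides into sums over \<open>\<Delta>(m\<^sub>(\<^sub>-\<^sub>1\<^sub>))\<close> and \<open>\<Delta>(\<alpha>\<^sup>2(h))\<close>, and these are exchanged by
  \<open>y\<^sub>1 x\<^sub>1 \<sigma>(x\<^sub>2 \<otimes> y\<^sub>2) = \<sigma>(x\<^sub>1 \<otimes> y\<^sub>1) x\<^sub>2 y\<^sub>2\<close> with \<open>x = m\<^sub>(\<^sub>-\<^sub>1\<^sub>)\<close> and \<open>y = \<alpha>\<^sup>2(h)\<close>. Invariance of \<open>\<sigma>\<close>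
  supplies the \<open>\<alpha>\<close> that coassociativity requires. For (ii), both actions send \<open>h \<otimes> (m \<otimes> n)\<close> to
  \<open>\<sigma>(\<alpha>(m\<^sub>(\<^sub>-\<^sub>1\<^sub>)) \<otimes> h\<^sub>1) \<sigma>(\<alpha>(n\<^sub>(\<^sub>-\<^sub>1\<^sub>)) \<otimes> h\<^sub>2) m\<^sub>(\<^sub>0\<^sub>) \<otimes> n\<^sub>(\<^sub>0\<^sub>)\<close>.
\<close>

section \<open>Linear and bilinear maps\<close>

text \<open>\<open>tensor_lift\<close> evaluates a representative picked by \<open>SOME\<close>, so
  even its linearity has to be earned. It rests on minimality of \<open>tensor_relations\<close>:
  the kernel of the linear extension of a bilinear map to the free module is a submodule containing
  all relators. On the other hand the choice depends on the tensor alone, so under a fixed tensor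
  every lift is the same finite linear combination, and Sweedler sums are rewritten and exchanged
  like finite sums. Trading a second coaction for a comultiplication moves a twist from the first
  leg to the last, so the computation keeps count of the \<alpha> on each factor. The exponent -2 in
  (ii) comes from this count: one inverse cancels the \<alpha> in the induced action, and invariance
  turns the other into the \<alpha> that the left multiplication axiom puts on the first argument of
  \<sigma>. For (ii), M \<otimes> N is shown to be a comodule, so that (i) applies to it. The two
  actions are compared on the carrier, where alone maps are constrained, and the Yetter-Drinfeld
  axioms are transferred along that agreement.\<close>

lemma linear_mapsI:
  assumes "\<And>x. x \<in> carrier A \<Longrightarrow> f x \<in> carrier B"
    and "\<And>x y. \<lbrakk>x \<in> carrier A; y \<in> carrier A\<rbrakk> \<Longrightarrow> f (x \<oplus>\<^bsub>A\<^esub> y) = f x \<oplus>\<^bsub>B\<^esub> f y"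
    and "\<And>c x. \<lbrakk>c \<in> carrier R; x \<in> carrier A\<rbrakk> \<Longrightarrow> f (c \<odot>\<^bsub>A\<^esub> x) = c \<odot>\<^bsub>B\<^esub> f x"
  shows "f \<in> linear_maps R A B"
  using assms by (simp add: linear_maps_def)

lemma linear_mapsD:
  assumes "f \<in> linear_maps R A B"
  shows linear_maps_closed: "x \<in> carrier A \<Longrightarrow> f x \<in> carrier B"
    and linear_maps_add:
      "\<lbrakk>x \<in> carrier A; y \<in> carrier A\<rbrakk> \<Longrightarrow> f (x \<oplus>\<^bsub>A\<^esub> y) = f x \<oplus>\<^bsub>B\<^esub> f y"
    and linear_maps_smult:
      "\<lbrakk>c \<in> carrier R; x \<in> carrier A\<rbrakk> \<Longrightarrow> f (c \<odot>\<^bsub>A\<^esub> x) = c \<odot>\<^bsub>B\<^esub> f x"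
  using assms by (auto simp: linear_maps_def)

lemma linear_maps_id: "(\<lambda>x. x) \<in> linear_maps R A A"
  by (simp add: linear_maps_def)

lemma linear_maps_compose:
  assumes "g \<in> linear_maps R B C" "f \<in> linear_maps R A B"
  shows "(\<lambda>x. g (f x)) \<in> linear_maps R A C"
  using assms by (auto simp: linear_maps_def Pi_def)

text \<open>\<open>linear_maps\<close> constrains values on the carrier only, and the carrier is
  closed under the operations. An action known only up to agreement there is therefore still linear,
  as the transfer between the two actions requires.\<close>

lemma linear_maps_cong:
  assumes "module R A" "f \<in> linear_maps R A B" "\<And>x. x \<in> carrier A \<Longrightarrow> g x = f x"
  shows "g \<in> linear_maps R A B"
proof -
  interpret A: module R A by fact
  show ?thesis using assms(2,3) by (simp add: linear_maps_def Pi_def)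
qed

text \<open>Separate linearity in each argument reduces every bilinearity goal to rules for
  \<open>linear_maps\<close> that follow the syntax of the expression.\<close>

definition bilinear_maps ::
  "('k, 'r) ring_scheme \<Rightarrow> ('k, 'a) module \<Rightarrow> ('k, 'b) module \<Rightarrow> ('k, 'p) module
    \<Rightarrow> ('a \<Rightarrow> 'b \<Rightarrow> 'p) set"
  where "bilinear_maps R A B P =
    {f. (\<forall>a \<in> carrier A. (\<lambda>b. f a b) \<in> linear_maps R B P) \<and>
        (\<forall>b \<in> carrier B. (\<lambda>a. f a b) \<in> linear_maps R A P)}"

lemma bilinear_mapsI:
  assumes "\<And>b. b \<in> carrier B \<Longrightarrow> (\<lambda>a. f a b) \<in> linear_maps R A P"
    and "\<And>a. a \<in> carrier A \<Longrightarrow> (\<lambda>b. f a b) \<in> linear_maps R B P"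
  shows "f \<in> bilinear_maps R A B P"
  using assms by (simp add: bilinear_maps_def)

lemma bilinear_mapsD:
  assumes "f \<in> bilinear_maps R A B P"
  shows "b \<in> carrier B \<Longrightarrow> (\<lambda>a. f a b) \<in> linear_maps R A P"
    and "a \<in> carrier A \<Longrightarrow> (\<lambda>b. f a b) \<in> linear_maps R B P"
  using assms by (simp_all add: bilinear_maps_def)

lemma bilinear_maps_closed:
  assumes "f \<in> bilinear_maps R A B P" "a \<in> carrier A" "b \<in> carrier B"
  shows "f a b \<in> carrier P"
  by (rule linear_maps_closed[OF bilinear_mapsD(2)[OF assms(1,2)] assms(3)])

lemma bilinear_maps_distrib:
  assumes "f \<in> bilinear_maps R A B P"
  shows "\<lbrakk>a \<in> carrier A; a' \<in> carrier A; b \<in> carrier B\<rbrakk> \<Longrightarrow> f (a \<oplus>\<^bsub>A\<^esub> a') b = f a b \<oplus>\<^bsub>P\<^esub> f a' b"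
    and "\<lbrakk>a \<in> carrier A; b \<in> carrier B; b' \<in> carrier B\<rbrakk> \<Longrightarrow> f a (b \<oplus>\<^bsub>B\<^esub> b') = f a b \<oplus>\<^bsub>P\<^esub> f a b'"
    and "\<lbrakk>c \<in> carrier R; a \<in> carrier A; b \<in> carrier B\<rbrakk> \<Longrightarrow> f (c \<odot>\<^bsub>A\<^esub> a) b = c \<odot>\<^bsub>P\<^esub> f a b"
    and "\<lbrakk>c \<in> carrier R; a \<in> carrier A; b \<in> carrier B\<rbrakk> \<Longrightarrow> f a (c \<odot>\<^bsub>B\<^esub> b) = c \<odot>\<^bsub>P\<^esub> f a b"
  using assms by (auto simp: bilinear_maps_def linear_maps_def)

lemma linear_maps_zero:
  assumes "module R A" "module R B" "f \<in> linear_maps R A B"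
  shows "f \<zero>\<^bsub>A\<^esub> = \<zero>\<^bsub>B\<^esub>"
proof -
  interpret A: module R A by fact
  interpret B: module R B by fact
  have "f \<zero>\<^bsub>A\<^esub> \<oplus>\<^bsub>B\<^esub> f \<zero>\<^bsub>A\<^esub> = f \<zero>\<^bsub>A\<^esub>"
    using linear_maps_add[OF assms(3), of "\<zero>\<^bsub>A\<^esub>" "\<zero>\<^bsub>A\<^esub>"] by simp
  then show ?thesis
    using linear_maps_closed[OF assms(3)] B.add.r_cancel_one by blast
qed

lemma linear_maps_diff:
  assumes "module R A" "module R B" "f \<in> linear_maps R A B" "x \<in> carrier A" "y \<in> carrier A"
  shows "f (x \<ominus>\<^bsub>A\<^esub> y) = f x \<ominus>\<^bsub>B\<^esub> f y"
proof -
  interpret A: module R A by fact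
  interpret B: module R B by fact
  note [simp] = linear_mapsD[OF assms(3)] assms(4,5)
  have "f (\<ominus>\<^bsub>A\<^esub> y) \<oplus>\<^bsub>B\<^esub> f y = \<zero>\<^bsub>B\<^esub>"
    using linear_maps_add[OF assms(3), of "\<ominus>\<^bsub>A\<^esub> y" y]
    by (simp add: A.l_neg linear_maps_zero[OF assms(1-3)])
  then have "f (\<ominus>\<^bsub>A\<^esub> y) = \<ominus>\<^bsub>B\<^esub> f y"
    by (intro B.minus_equality[symmetric]) simp_all
  then show ?thesis by (simp add: a_minus_def)
qed

lemma linear_maps_finsum:
  assumes "module R A" "module R B" "f \<in> linear_maps R A B" "finite I" "g \<in> I \<rightarrow> carrier A"
  shows "f (\<Oplus>\<^bsub>A\<^esub>i\<in>I. g i) = (\<Oplus>\<^bsub>B\<^esub>i\<in>I. f (g i))"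
proof -
  interpret A: module R A by fact
  interpret B: module R B by fact
  note [simp] = linear_mapsD[OF assms(3)]
  show ?thesis using assms(4,5)
    by (induction rule: finite_induct) (simp_all add: linear_maps_zero[OF assms(1-3)] Pi_def)
qed

section \<open>Free modules and quotients\<close>

lemma free_module_simps [simp]:
  "zero (free_module R X) = (\<lambda>x. \<zero>\<^bsub>R\<^esub>)"
  "add (free_module R X) = (\<lambda>p q x. p x \<oplus>\<^bsub>R\<^esub> q x)"
  "smult (free_module R X) = (\<lambda>c p x. c \<otimes>\<^bsub>R\<^esub> p x)"
  by (simp_all add: free_module_def)

lemma free_module_carrier:
  "p \<in> carrier (free_module R X) \<longleftrightarrow>
    (\<forall>x. p x \<in> carrier R) \<and> finite {x. p x \<noteq> \<zero>\<^bsub>R\<^esub>} \<and> {x. p x \<noteq> \<zero>\<^bsub>R\<^esub>} \<subseteq> X"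
  by (auto simp: free_module_def)

context cring
begin

lemma module_free_module: "module R (free_module R X)"
proof (intro moduleI abelian_groupI)
  let ?F = "free_module R X"
  show "cring R" by (rule is_cring)
  show "x \<oplus>\<^bsub>?F\<^esub> y \<in> carrier ?F" if "x \<in> carrier ?F" "y \<in> carrier ?F" for x y
  proof -
    have "{z. x z \<oplus> y z \<noteq> \<zero>} \<subseteq> {z. x z \<noteq> \<zero>} \<union> {z. y z \<noteq> \<zero>}" by auto
    with that show ?thesis
      by (auto simp: free_module_carrier intro: finite_subset)
  qed
  show "c \<odot>\<^bsub>?F\<^esub> x \<in> carrier ?F" if "c \<in> carrier R" "x \<in> carrier ?F" for c x
  proof -
    have "{z. c \<otimes> x z \<noteq> \<zero>} \<subseteq> {z. x z \<noteq> \<zero>}" using that by auto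
    with that show ?thesis
      by (auto simp: free_module_carrier intro: finite_subset)
  qed
  show "\<exists>y\<in>carrier ?F. y \<oplus>\<^bsub>?F\<^esub> x = \<zero>\<^bsub>?F\<^esub>" if "x \<in> carrier ?F" for x
  proof
    have "{z. \<ominus> x z \<noteq> \<zero>} \<subseteq> {z. x z \<noteq> \<zero>}" using that by auto
    with that show "(\<lambda>z. \<ominus> x z) \<in> carrier ?F"
      by (auto simp: free_module_carrier intro: finite_subset)
    show "(\<lambda>z. \<ominus> x z) \<oplus>\<^bsub>?F\<^esub> x = \<zero>\<^bsub>?F\<^esub>"
      using that by (auto simp: free_module_carrier l_neg)
  qed
qed (auto simp: free_module_carrier a_ac l_distr r_distr m_assoc)

lemma free_gen_closed: "x \<in> X \<Longrightarrow> free_gen R x \<in> carrier (free_module R X)"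
  by (auto simp: free_module_carrier free_gen_def)

text \<open>A finitely supported function is a linear combination of generators. The induction runs
  over a finite set that contains the support, so that deleting one coordinate leads back to the
  induction hypothesis.\<close>

lemma free_module_ext:
  assumes P: "module R P"
    and g: "g \<in> linear_maps R (free_module R X) P" and g': "g' \<in> linear_maps R (free_module R X) P"
    and eq: "\<And>x. x \<in> X \<Longrightarrow> g (free_gen R x) = g' (free_gen R x)"
    and p: "p \<in> carrier (free_module R X)"
  shows "g p = g' p"
proof -
  let ?F = "free_module R X"
  interpret F: module R ?F by (rule module_free_module)
  have "\<forall>p \<in> carrier ?F. {x. p x \<noteq> \<zero>} \<subseteq> S \<longrightarrow> g p = g' p" if "finite S" "S \<subseteq> X" for S
    using that
  proof (induction rule: finite_induct)
    case empty
    then show ?case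
    proof (intro ballI impI)
      fix p assume "p \<in> carrier ?F" "{x. p x \<noteq> \<zero>} \<subseteq> {}"
      then have "p = \<zero>\<^bsub>?F\<^esub>" by auto
      then show "g p = g' p"
        using linear_maps_zero[OF F.module_axioms P] g g' by metis
    qed
  next
    case (insert x S)
    show ?case
    proof (intro ballI impI)
      fix p assume p: "p \<in> carrier ?F" "{y. p y \<noteq> \<zero>} \<subseteq> insert x S"
      \<comment> \<open>\<open>?q\<close> deletes the coordinate \<open>x\<close>; adding
        \<open>p x\<close> times the generator at \<open>x\<close> restores \<open>p\<close>, also
        when \<open>p x\<close> is zero.\<close>
      let ?q = "p(x := \<zero>)"
      have sub: "{y. ?q y \<noteq> \<zero>} \<subseteq> {y. p y \<noteq> \<zero>}" "{y. ?q y \<noteq> \<zero>} \<subseteq> S"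
        using p(2) by auto
      have q: "?q \<in> carrier ?F"
        using p(1) finite_subset[OF sub(1)] sub(1) by (auto simp: free_module_carrier)
      have px: "p x \<in> carrier R" using p(1) by (simp add: free_module_carrier)
      have x: "x \<in> X" using insert.prems by simp
      note G = free_gen_closed[OF x]
      have split: "p = ?q \<oplus>\<^bsub>?F\<^esub> (p x \<odot>\<^bsub>?F\<^esub> free_gen R x)"
        using p(1) by (auto simp: free_module_carrier free_gen_def)
      have eval: "f p = f ?q \<oplus>\<^bsub>P\<^esub> p x \<odot>\<^bsub>P\<^esub> f (free_gen R x)" if "f \<in> linear_maps R ?F P" for f
        using split linear_maps_add[OF that q F.smult_closed[OF px G]]
          linear_maps_smult[OF that px G] by metis
      have "g ?q = g' ?q" using insert.IH insert.prems q sub(2) by simp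
      then show "g p = g' p" using eval[OF g] eval[OF g'] eq[OF x] by simp
    qed
  qed
  from this[of "{x. p x \<noteq> \<zero>}"] show ?thesis using p by (auto simp: free_module_carrier)
qed

text \<open>The linear extension of \<open>f\<close> from the generators. \<open>tensor_lift\<close>
  is this evaluation at a chosen representative, so properties of lifts are proved here before
  passing to the quotient.\<close>

definition free_eval :: "('a, 'p) module \<Rightarrow> ('x \<Rightarrow> 'a) \<Rightarrow> ('x \<Rightarrow> 'p) \<Rightarrow> 'p"
  where "free_eval P p f = (\<Oplus>\<^bsub>P\<^esub>x \<in> {x. p x \<noteq> \<zero>}. p x \<odot>\<^bsub>P\<^esub> f x)"

text \<open>The additional indices contribute zero. This puts evaluations with different supports
  over one index set.\<close>

lemma free_eval_superset:
  assumes "module R P" "p \<in> carrier (free_module R X)" "f \<in> X \<rightarrow> carrier P"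
    and "finite Y" "{x. p x \<noteq> \<zero>} \<subseteq> Y" "Y \<subseteq> X"
  shows "free_eval P p f = (\<Oplus>\<^bsub>P\<^esub>x \<in> Y. p x \<odot>\<^bsub>P\<^esub> f x)"
proof -
  interpret P: module R P by fact
  have "f x \<in> carrier P" if "x \<in> Y" for x using that assms(3,6) by auto
  then show ?thesis unfolding free_eval_def
    using assms(2,4,5)
    by (intro P.add.finprod_mono_neutral_cong_left) (auto simp: free_module_carrier)
qed

lemma free_eval_linear:
  assumes "module R P" "f \<in> X \<rightarrow> carrier P"
  shows "(\<lambda>p. free_eval P p f) \<in> linear_maps R (free_module R X) P"
proof -
  let ?F = "free_module R X"
  interpret P: module R P by fact
  interpret F: module R ?F by (rule module_free_module)
  have f: "f x \<in> carrier P" if "x \<in> X" for x using that assms(2) by auto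
  note sup = free_eval_superset[OF assms(1) _ assms(2)]
  show ?thesis
  proof (rule linear_mapsI)
    fix p assume "p \<in> carrier ?F"
    then show "free_eval P p f \<in> carrier P" unfolding free_eval_def
      using f by (intro P.finsum_closed) (auto simp: free_module_carrier)
  next
    fix p q assume pq: "p \<in> carrier ?F" "q \<in> carrier ?F"
    \<comment> \<open>Cancellation can make the support of the sum smaller than this union, so all
      three evaluations are expanded over the union.\<close>
    let ?Y = "{x. p x \<noteq> \<zero>} \<union> {x. q x \<noteq> \<zero>}"
    have Y: "finite ?Y" "?Y \<subseteq> X" using pq by (auto simp: free_module_carrier)
    have [simp]: "p x \<in> carrier R" "q x \<in> carrier R" for x
      using pq by (auto simp: free_module_carrier)
    have fY: "f x \<in> carrier P" if "x \<in> ?Y" for x using that Y(2) f by auto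
    have "free_eval P (p \<oplus>\<^bsub>?F\<^esub> q) f = (\<Oplus>\<^bsub>P\<^esub>x \<in> ?Y. (p \<oplus>\<^bsub>?F\<^esub> q) x \<odot>\<^bsub>P\<^esub> f x)"
      using pq by (intro sup[OF _ Y(1) _ Y(2)] F.a_closed) auto
    also have "\<dots> = (\<Oplus>\<^bsub>P\<^esub>x \<in> ?Y. p x \<odot>\<^bsub>P\<^esub> f x \<oplus>\<^bsub>P\<^esub> q x \<odot>\<^bsub>P\<^esub> f x)"
      using fY by (intro P.finsum_cong') (auto simp: P.smult_l_distr)
    also have "\<dots> = (\<Oplus>\<^bsub>P\<^esub>x \<in> ?Y. p x \<odot>\<^bsub>P\<^esub> f x) \<oplus>\<^bsub>P\<^esub> (\<Oplus>\<^bsub>P\<^esub>x \<in> ?Y. q x \<odot>\<^bsub>P\<^esub> f x)"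
      using fY by (intro P.finsum_addf) auto
    also have "\<dots> = free_eval P p f \<oplus>\<^bsub>P\<^esub> free_eval P q f"
      using sup[OF pq(1) Y(1) _ Y(2)] sup[OF pq(2) Y(1) _ Y(2)] by simp
    finally show "free_eval P (p \<oplus>\<^bsub>?F\<^esub> q) f = free_eval P p f \<oplus>\<^bsub>P\<^esub> free_eval P q f" .
  next
    fix c p assume cp: "c \<in> carrier R" "p \<in> carrier ?F"
    let ?Y = "{x. p x \<noteq> \<zero>}"
    have Y: "finite ?Y" "?Y \<subseteq> X" using cp by (auto simp: free_module_carrier)
    have [simp]: "p x \<in> carrier R" for x
      using cp by (auto simp: free_module_carrier)
    have fY: "f x \<in> carrier P" if "x \<in> ?Y" for x using that Y(2) f by auto
    have "free_eval P (c \<odot>\<^bsub>?F\<^esub> p) f = (\<Oplus>\<^bsub>P\<^esub>x \<in> ?Y. (c \<odot>\<^bsub>?F\<^esub> p) x \<odot>\<^bsub>P\<^esub> f x)"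
      using cp by (intro sup[OF _ Y(1) _ Y(2)] F.smult_closed) auto
    also have "\<dots> = (\<Oplus>\<^bsub>P\<^esub>x \<in> ?Y. c \<odot>\<^bsub>P\<^esub> (p x \<odot>\<^bsub>P\<^esub> f x))"
      using fY cp by (intro P.finsum_cong') (auto simp: P.smult_assoc1)
    also have "\<dots> = c \<odot>\<^bsub>P\<^esub> free_eval P p f" unfolding free_eval_def
      using fY cp Y by (intro P.finsum_smult_ldistr[symmetric]) auto
    finally show "free_eval P (c \<odot>\<^bsub>?F\<^esub> p) f = c \<odot>\<^bsub>P\<^esub> free_eval P p f" .
  qed
qed

lemma free_eval_gen:
  assumes "module R P" "f \<in> X \<rightarrow> carrier P" "x \<in> X"
  shows "free_eval P (free_gen R x) f = f x"
proof -
  interpret P: module R P by fact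
  have "free_eval P (free_gen R x) f = (\<Oplus>\<^bsub>P\<^esub>y \<in> {x}. free_gen R x y \<odot>\<^bsub>P\<^esub> f y)"
    using assms(3) by (intro free_eval_superset[OF assms(1) free_gen_closed assms(2)])
      (auto simp: free_gen_def)
  also have "\<dots> = f x"
    using funcset_mem[OF assms(2,3)] by (subst P.finsum_insert) (auto simp: free_gen_def)
  finally show ?thesis .
qed

end

section \<open>Submodules and quotient modules\<close>

lemma (in module) submodule_Inter:
  assumes "\<And>S. S \<in> C \<Longrightarrow> submodule S R M" "C \<noteq> {}"
  shows "submodule (\<Inter>C) R M"
proof (rule submoduleI)
  show "\<Inter>C \<subseteq> carrier M" using assms submoduleE(1) by blast
  show "\<zero>\<^bsub>M\<^esub> \<in> \<Inter>C"
    using subgroup.one_closed[OF submodule.axioms(1)[OF assms(1)]] by auto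
qed (use submoduleE[OF assms(1)] in auto)

text \<open>The kernel of the extension of a bilinear map will be one of the submodules whose
  intersection is \<open>tensor_relations\<close>.\<close>

lemma linear_maps_kernel:
  assumes "module R M" "module R P" "g \<in> linear_maps R M P"
  shows "submodule {p \<in> carrier M. g p = \<zero>\<^bsub>P\<^esub>} R M"
proof -
  interpret M: module R M by fact
  interpret P: module R P by fact
  note [simp] = linear_mapsD[OF assms(3)]
  show ?thesis
  proof (rule M.submoduleI)
    fix a assume a: "a \<in> {p \<in> carrier M. g p = \<zero>\<^bsub>P\<^esub>}"
    then have "g (\<ominus>\<^bsub>M\<^esub> a \<oplus>\<^bsub>M\<^esub> a) = g (\<ominus>\<^bsub>M\<^esub> a)"
      by (subst linear_maps_add[OF assms(3)]) auto
    with a show "\<ominus>\<^bsub>M\<^esub> a \<in> {p \<in> carrier M. g p = \<zero>\<^bsub>P\<^esub>}"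
      by (simp add: M.l_neg linear_maps_zero[OF assms])
  qed (auto simp: linear_maps_zero[OF assms])
qed

lemma (in module) submodule_abelian_subgroup:
  assumes "submodule S R M"
  shows "abelian_subgroup S M"
  using submodule.axioms(1)[OF assms] abelian_subgroupI3 additive_subgroup.intro
    abelian_group_axioms by blast

locale module_submodule = module R M
  for R (structure) and M :: "('k, 'm) module" (structure) and S +
  assumes S: "submodule S R M"
begin

sublocale S: abelian_subgroup S M by (rule submodule_abelian_subgroup[OF S])

lemma quotient_carrier: "carrier (quotient_module M S) = (\<lambda>x. S +>\<^bsub>M\<^esub> x) ` carrier M"
  by (auto simp: quotient_module_def A_RCOSETS_def')

lemma coset_add:
  assumes "x \<in> carrier M" "y \<in> carrier M"
  shows "S +>\<^bsub>M\<^esub> (x \<oplus>\<^bsub>M\<^esub> y) = (S +>\<^bsub>M\<^esub> x) \<oplus>\<^bsub>quotient_module M S\<^esub> (S +>\<^bsub>M\<^esub> y)"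
  using S.a_rcos_sum assms by (simp add: quotient_module_def)

lemma coset_eqI:
  assumes "x \<in> carrier M" "y \<in> carrier M" "x \<ominus>\<^bsub>M\<^esub> y \<in> S"
  shows "S +>\<^bsub>M\<^esub> x = S +>\<^bsub>M\<^esub> y"
proof -
  have "x \<in> S +>\<^bsub>M\<^esub> y"
    using assms S.a_rcos_module[of y x] by (simp add: a_minus_def)
  then show ?thesis
    using S.a_repr_independence'[of x y] assms by simp
qed

lemma coset_memE:
  assumes "x \<in> carrier M" "y \<in> S +>\<^bsub>M\<^esub> x"
  obtains s where "s \<in> S" "y = s \<oplus>\<^bsub>M\<^esub> x"
  using assms by (auto simp: a_r_coset_def')

text \<open>The scalar multiple of a coset is defined as a union over all its representatives. Two
  representatives differ by some \<open>s\<close> in \<open>S\<close>, their multiples by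
  \<open>c\<close> times \<open>s\<close>, which is again in \<open>S\<close>; the union therefore
  runs over a single coset.\<close>

lemma coset_smult:
  assumes "c \<in> carrier R" "x \<in> carrier M"
  shows "S +>\<^bsub>M\<^esub> (c \<odot>\<^bsub>M\<^esub> x) = c \<odot>\<^bsub>quotient_module M S\<^esub> (S +>\<^bsub>M\<^esub> x)"
proof -
  have "S +>\<^bsub>M\<^esub> (c \<odot>\<^bsub>M\<^esub> y) = S +>\<^bsub>M\<^esub> (c \<odot>\<^bsub>M\<^esub> x)" if "y \<in> S +>\<^bsub>M\<^esub> x" for y
  proof -
    obtain s where s: "s \<in> S" "y = s \<oplus>\<^bsub>M\<^esub> x" using coset_memE[OF assms(2) \<open>y \<in> _\<close>] .
    have sM: "s \<in> carrier M" using s(1) S.a_subset by auto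
    have cs: "c \<odot>\<^bsub>M\<^esub> s \<in> S" using submodule.smult_closed[OF S assms(1) s(1)] .
    have "c \<odot>\<^bsub>M\<^esub> y = c \<odot>\<^bsub>M\<^esub> s \<oplus>\<^bsub>M\<^esub> c \<odot>\<^bsub>M\<^esub> x"
      using s(2) sM assms by (simp add: smult_r_distr)
    then have "c \<odot>\<^bsub>M\<^esub> y \<in> S +>\<^bsub>M\<^esub> (c \<odot>\<^bsub>M\<^esub> x)"
      using cs by (auto simp: a_r_coset_def')
    then show ?thesis
      using S.a_repr_independence'[of "c \<odot>\<^bsub>M\<^esub> y" "c \<odot>\<^bsub>M\<^esub> x"] assms by simp
  qed
  moreover have "x \<in> S +>\<^bsub>M\<^esub> x" by (rule S.a_rcos_self[OF assms(2)])
  ultimately have "(\<Union>y\<in>S +>\<^bsub>M\<^esub> x. S +>\<^bsub>M\<^esub> (c \<odot>\<^bsub>M\<^esub> y)) = S +>\<^bsub>M\<^esub> (c \<odot>\<^bsub>M\<^esub> x)"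
    by blast
  then show ?thesis by (simp add: quotient_module_def)
qed

lemma coset_linear: "(\<lambda>x. S +>\<^bsub>M\<^esub> x) \<in> linear_maps R M (quotient_module M S)"
  by (rule linear_mapsI) (auto simp: quotient_carrier coset_add coset_smult)

lemma coset_zero: "S +>\<^bsub>M\<^esub> \<zero>\<^bsub>M\<^esub> = \<zero>\<^bsub>quotient_module M S\<^esub>"
  using a_coset_add_zero[OF S.a_subset] by (simp add: quotient_module_def)

lemma module_quotient: "module R (quotient_module M S)"
proof (intro moduleI abelian_groupI)
  let ?Q = "quotient_module M S"
  \<comment> \<open>Read from right to left, the coset laws push every operation down to
    representatives, where the laws of \<open>M\<close> apply.\<close>
  note [simp] = coset_add[symmetric] coset_smult[symmetric] coset_zero[symmetric]
  show "cring R" by (rule is_cring)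
  show "\<exists>y\<in>carrier ?Q. y \<oplus>\<^bsub>?Q\<^esub> x = \<zero>\<^bsub>?Q\<^esub>" if "x \<in> carrier ?Q" for x
  proof -
    obtain z where z: "z \<in> carrier M" "x = S +>\<^bsub>M\<^esub> z" using \<open>x \<in> _\<close> by (auto simp: quotient_carrier)
    show ?thesis
      using z by (intro bexI[of _ "S +>\<^bsub>M\<^esub> (\<ominus>\<^bsub>M\<^esub> z)"]) (auto simp: quotient_carrier M.l_neg)
  qed
qed (auto simp: quotient_carrier M.a_ac smult_l_distr smult_r_distr smult_assoc1
       coset_add[symmetric] coset_smult[symmetric] coset_zero[symmetric])

end

section \<open>Tensor products\<close>

context cring
begin

lemma tensor_lift_eq: "tensor_lift R P t f = free_eval P (SOME p. p \<in> t) (case_prod f)"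
  by (simp add: tensor_lift_def free_eval_def Let_def case_prod_beta)

lemma module_scalar_module: "module R (scalar_module R)"
  by (intro moduleI abelian_groupI)
    (auto simp: scalar_module_def is_cring a_ac l_distr r_distr m_assoc intro: l_neg)

abbreviation (input) tensor_free ::
  "('a, 'c) module \<Rightarrow> ('a, 'd) module \<Rightarrow> ('a, 'c \<times> 'd \<Rightarrow> 'a) module"
  where "tensor_free A B \<equiv> free_module R (carrier A \<times> carrier B)"

abbreviation (input) tensor_coset ::
  "('a, 'c) module \<Rightarrow> ('a, 'd) module \<Rightarrow> ('c \<times> 'd \<Rightarrow> 'a) \<Rightarrow> ('c \<times> 'd \<Rightarrow> 'a) set"
  where "tensor_coset A B p \<equiv> tensor_relations R A B +>\<^bsub>tensor_free A B\<^esub> p"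

context
  fixes A :: "('a, 'c) module" and B :: "('a, 'd) module"
  assumes A: "module R A" and B: "module R B"
begin

lemmas A_closed = abelian_monoid.a_closed[OF abelian_group.axioms(1)[OF module.axioms(2)[OF A]]]
  module.smult_closed[OF A]
lemmas B_closed = abelian_monoid.a_closed[OF abelian_group.axioms(1)[OF module.axioms(2)[OF B]]]
  module.smult_closed[OF B]
lemmas F_group = module.axioms(2)[OF module_free_module, where X1 = "carrier A \<times> carrier B"]
lemmas F_closed = abelian_monoid.a_closed[OF abelian_group.axioms(1)[OF F_group]]
  module.smult_closed[OF module_free_module] free_gen_closed
lemmas F_minus_closed = abelian_group.minus_closed[OF F_group]

lemma bilinear_relators_subset: "bilinear_relators R A B \<subseteq> carrier (tensor_free A B)"
  unfolding bilinear_relators_def Let_def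
  by (intro Un_least subsetI; elim CollectE exE conjE; hypsubst)
    ((intro F_minus_closed F_closed A_closed B_closed SigmaI; assumption)+)

text \<open>The free module itself is a submodule containing the relators, so the intersection is
  taken over a nonempty family.\<close>

lemma tensor_relations_submodule: "submodule (tensor_relations R A B) R (tensor_free A B)"
  unfolding tensor_relations_def
  using module.carrier_is_submodule[OF module_free_module] bilinear_relators_subset
  by (intro module.submodule_Inter[OF module_free_module]) blast+

lemma tensor_relations: "module_submodule R (tensor_free A B) (tensor_relations R A B)"
  by (intro module_submodule.intro module_submodule_axioms.intro module_free_module
      tensor_relations_submodule)

lemma module_tensor: "module R (A \<boxtimes> B)"
  unfolding tensor_def by (rule module_submodule.module_quotient[OF tensor_relations])

lemma tensor_carrier: "carrier (A \<boxtimes> B) = (\<lambda>p. tensor_coset A B p) ` carrier (tensor_free A B)"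
  unfolding tensor_def by (rule module_submodule.quotient_carrier[OF tensor_relations])

lemma tensor_coset_linear: "(\<lambda>p. tensor_coset A B p) \<in> linear_maps R (tensor_free A B) (A \<boxtimes> B)"
  unfolding tensor_def by (rule module_submodule.coset_linear[OF tensor_relations])

text \<open>Composed with the quotient map, both maps become linear on the free module, where they
  are compared on generators; the cosets of generators are the pure tensors.\<close>

lemma tensor_ext:
  assumes P: "module R P" and g: "g \<in> linear_maps R (A \<boxtimes> B) P" "g' \<in> linear_maps R (A \<boxtimes> B) P"
    and eq: "\<And>a b. \<lbrakk>a \<in> carrier A; b \<in> carrier B\<rbrakk> \<Longrightarrow> g (pure R A B a b) = g' (pure R A B a b)"
    and t: "t \<in> carrier (A \<boxtimes> B)"
  shows "g t = g' t"
proof -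
  obtain p where p: "p \<in> carrier (tensor_free A B)" "t = tensor_coset A B p"
    using t by (auto simp: tensor_carrier)
  show ?thesis unfolding p(2)
    using eq by (intro free_module_ext[OF P linear_maps_compose[OF g(1) tensor_coset_linear]
        linear_maps_compose[OF g(2) tensor_coset_linear] _ p(1)]) (auto simp: pure_def)
qed

lemma tensor_coset_eqI:
  assumes "x \<in> carrier (tensor_free A B)" "y \<in> carrier (tensor_free A B)"
      "x \<ominus>\<^bsub>tensor_free A B\<^esub> y \<in> bilinear_relators R A B"
  shows "tensor_coset A B x = tensor_coset A B y"
  by (rule module_submodule.coset_eqI[OF tensor_relations assms(1,2)])
    (use assms(3) in \<open>auto simp: tensor_relations_def\<close>)

text \<open>Each of the four families of relators is the difference whose vanishing in the quotient
  gives one of the four laws.\<close>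

lemma pure_bilinear: "pure R A B \<in> bilinear_maps R A B (A \<boxtimes> B)"
proof -
  note coset = linear_mapsD(2,3)[OF tensor_coset_linear, symmetric]
  note closed = F_closed A_closed B_closed SigmaI
  have 1: "tensor_coset A B (free_gen R (a \<oplus>\<^bsub>A\<^esub> a', b))
      = (tensor_coset A B (free_gen R (a, b))) \<oplus>\<^bsub>A \<boxtimes> B\<^esub> (tensor_coset A B (free_gen R (a', b)))"
    if "a \<in> carrier A" "a' \<in> carrier A" "b \<in> carrier B" for a a' b
    unfolding coset(1)[OF free_gen_closed[OF SigmaI[OF that(1,3)]]
        free_gen_closed[OF SigmaI[OF that(2,3)]]]
    by (intro tensor_coset_eqI closed that; unfold bilinear_relators_def Let_def; use that in blast)
  have 2: "tensor_coset A B (free_gen R (a, b \<oplus>\<^bsub>B\<^esub> b'))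
      = (tensor_coset A B (free_gen R (a, b))) \<oplus>\<^bsub>A \<boxtimes> B\<^esub> (tensor_coset A B (free_gen R (a, b')))"
    if "a \<in> carrier A" "b \<in> carrier B" "b' \<in> carrier B" for a b b'
    unfolding coset(1)[OF free_gen_closed[OF SigmaI[OF that(1,2)]]
        free_gen_closed[OF SigmaI[OF that(1,3)]]]
    by (intro tensor_coset_eqI closed that; unfold bilinear_relators_def Let_def; use that in blast)
  have 3: "tensor_coset A B (free_gen R (c \<odot>\<^bsub>A\<^esub> a, b)) = c \<odot>\<^bsub>A \<boxtimes> B\<^esub>
      (tensor_coset A B (free_gen R (a, b)))"
    if "c \<in> carrier R" "a \<in> carrier A" "b \<in> carrier B" for a b c
    unfolding coset(2)[OF that(1) free_gen_closed[OF SigmaI[OF that(2,3)]]]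
    by (intro tensor_coset_eqI closed that; unfold bilinear_relators_def Let_def; use that in blast)
  have 4: "tensor_coset A B (free_gen R (a, c \<odot>\<^bsub>B\<^esub> b)) = c \<odot>\<^bsub>A \<boxtimes> B\<^esub>
      (tensor_coset A B (free_gen R (a, b)))"
    if "c \<in> carrier R" "a \<in> carrier A" "b \<in> carrier B" for a b c
    unfolding coset(2)[OF that(1) free_gen_closed[OF SigmaI[OF that(2,3)]]]
    by (intro tensor_coset_eqI closed that; unfold bilinear_relators_def Let_def; use that in blast)
  show ?thesis
    unfolding pure_def
    by (intro bilinear_mapsI linear_mapsI 1 2 3 4 linear_maps_closed[OF tensor_coset_linear]
        free_gen_closed SigmaI)
qed

lemmas pure_closed = bilinear_maps_closed[OF pure_bilinear]
lemmas pure_linear_left = bilinear_mapsD(1)[OF pure_bilinear]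
lemmas pure_linear_right = bilinear_mapsD(2)[OF pure_bilinear]

context
  fixes P :: "('a, 'p) module" and f :: "'c \<Rightarrow> 'd \<Rightarrow> 'p"
  assumes P: "module R P" and f: "f \<in> bilinear_maps R A B P"
begin

lemma bilinear_maps_case_prod: "case_prod f \<in> carrier A \<times> carrier B \<rightarrow> carrier P"
  using bilinear_maps_closed[OF f] by auto

lemmas free_eval_bilinear_linear = free_eval_linear[OF P bilinear_maps_case_prod]

text \<open>The kernel of the extension is a submodule containing the relators, and
  \<open>tensor_relations\<close> lies in every such submodule.\<close>

lemma free_eval_relations:
  assumes r: "r \<in> tensor_relations R A B"
  shows "free_eval P r (case_prod f) = \<zero>\<^bsub>P\<^esub>"
proof -
  note lin = free_eval_bilinear_linear
  note gen = free_eval_gen[OF P bilinear_maps_case_prod]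
  let ?K = "{p \<in> carrier (tensor_free A B). free_eval P p (case_prod f) = \<zero>\<^bsub>P\<^esub>}"
  have K: "submodule ?K R (tensor_free A B)"
    by (rule linear_maps_kernel[OF module_free_module P lin])
  have mem: "p \<ominus>\<^bsub>tensor_free A B\<^esub> q \<in> ?K" if "p \<in> carrier (tensor_free A B)"
      "q \<in> carrier (tensor_free A B)"
      "free_eval P p (case_prod f) = free_eval P q (case_prod f)" for p q
    using linear_maps_diff[OF module_free_module P lin that(1,2)] that(3)
      F_minus_closed[OF that(1,2)] abelian_group.r_neg[OF module.axioms(2)[OF P]
          linear_maps_closed[OF lin that(2)]]
    by (simp add: a_minus_def)
  note closed = F_closed A_closed B_closed SigmaI
  note eval = linear_maps_add[OF lin] linear_maps_smult[OF lin] gen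
  \<comment> \<open>A relator is a difference of two elements with equal evaluation, by bilinearity
    of \<open>f\<close>. The operations of the free module stay folded so that linearity of
    \<open>free_eval\<close> can rewrite them.\<close>
  have "bilinear_relators R A B \<subseteq> ?K"
    unfolding bilinear_relators_def Let_def
    by (intro Un_least subsetI; elim CollectE exE conjE; hypsubst)
      (rule mem, (intro closed; assumption)+,
        simp add: eval closed bilinear_maps_distrib[OF f] del: free_module_simps)+
  with K have "tensor_relations R A B \<subseteq> ?K"
    unfolding tensor_relations_def by (intro Inter_lower CollectI conjI)
  from subsetD[OF this r] show ?thesis by blast
qed

text \<open>Independence of the representative: the chosen one differs from \<open>p\<close> by an
  element of \<open>tensor_relations\<close>, on which the evaluation vanishes.\<close>

lemma tensor_lift_coset:
  assumes p: "p \<in> carrier (tensor_free A B)"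
  shows "tensor_lift R P (tensor_coset A B p) f = free_eval P p (case_prod f)"
proof -
  let ?q = "SOME q. q \<in> tensor_coset A B p"
  note lin = free_eval_bilinear_linear
  note sub = module.submodule_abelian_subgroup[OF module_free_module tensor_relations_submodule]
  have "?q \<in> tensor_coset A B p"
    by (rule someI[of "\<lambda>q. q \<in> tensor_coset A B p", OF abelian_subgroup.a_rcos_self[OF sub p]])
  then obtain r where r: "r \<in> tensor_relations R A B" "?q = r \<oplus>\<^bsub>tensor_free A B\<^esub> p"
    by (rule module_submodule.coset_memE[OF tensor_relations p])
  have rF: "r \<in> carrier (tensor_free A B)"
    using r(1) module.submoduleE(1)[OF module_free_module tensor_relations_submodule]
      by (rule rev_subsetD)
  have "free_eval P ?q (case_prod f) = \<zero>\<^bsub>P\<^esub> \<oplus>\<^bsub>P\<^esub> free_eval P p (case_prod f)"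
    unfolding r(2) linear_maps_add[OF lin rF p] free_eval_relations[OF r(1)] ..
  with abelian_monoid.l_zero[OF abelian_group.axioms(1)[OF module.axioms(2)[OF P]]
      linear_maps_closed[OF lin p]]
  have "free_eval P ?q (case_prod f) = free_eval P p (case_prod f)"
    by (rule trans[rotated])
  then show ?thesis unfolding tensor_lift_eq .
qed

lemma tensor_lift_linear: "(\<lambda>t. tensor_lift R P t f) \<in> linear_maps R (A \<boxtimes> B) P"
proof (rule linear_mapsI)
  note lin = free_eval_bilinear_linear
  note coset = linear_mapsD(2,3)[OF tensor_coset_linear, symmetric]
  {
    fix x assume "x \<in> carrier (A \<boxtimes> B)"
    then obtain p where p: "p \<in> carrier (tensor_free A B)" "x = tensor_coset A B p"
        unfolding tensor_carrier by blast
    show "tensor_lift R P x f \<in> carrier P"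
      unfolding p(2) tensor_lift_coset[OF p(1)] by (rule linear_maps_closed[OF lin p(1)])
  next
    fix x y assume "x \<in> carrier (A \<boxtimes> B)" "y \<in> carrier (A \<boxtimes> B)"
    then obtain p q where p: "p \<in> carrier (tensor_free A B)" "x = tensor_coset A B p"
        and q: "q \<in> carrier (tensor_free A B)" "y = tensor_coset A B q"
      unfolding tensor_carrier by blast
    show "tensor_lift R P (x \<oplus>\<^bsub>A \<boxtimes> B\<^esub> y) f = tensor_lift R P x f \<oplus>\<^bsub>P\<^esub> tensor_lift R P y f"
      unfolding p(2) q(2) coset(1)[OF p(1) q(1)]
        tensor_lift_coset[OF p(1)] tensor_lift_coset[OF q(1)]
            tensor_lift_coset[OF F_closed(1)[OF p(1) q(1)]]
      by (rule linear_maps_add[OF lin p(1) q(1)])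
  next
    fix c x assume c: "c \<in> carrier R" and "x \<in> carrier (A \<boxtimes> B)"
    then obtain p where p: "p \<in> carrier (tensor_free A B)" "x = tensor_coset A B p"
        unfolding tensor_carrier by blast
    show "tensor_lift R P (c \<odot>\<^bsub>A \<boxtimes> B\<^esub> x) f = c \<odot>\<^bsub>P\<^esub> tensor_lift R P x f"
      unfolding p(2) coset(2)[OF c p(1)] tensor_lift_coset[OF p(1)]
          tensor_lift_coset[OF F_closed(2)[OF c p(1)]]
      by (rule linear_maps_smult[OF lin c p(1)])
  }
qed

lemma tensor_lift_pure:
  assumes "a \<in> carrier A" "b \<in> carrier B"
  shows "tensor_lift R P (pure R A B a b) f = f a b"
  unfolding pure_def tensor_lift_coset[OF free_gen_closed[OF SigmaI[OF assms]]]
    free_eval_gen[OF P bilinear_maps_case_prod SigmaI[OF assms]] by simp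

end

text \<open>No bilinearity is needed here: \<^const>\<open>tensor_lift\<close> evaluates a representative that does not
  depend on the map.\<close>

lemma tensor_lift_representative:
  assumes "t \<in> carrier (A \<boxtimes> B)"
  obtains I p where "finite I" "I \<subseteq> carrier A \<times> carrier B" "\<And>x. p x \<in> carrier R"
    "\<And>(P :: ('a, 'p) module) f.
      tensor_lift R P t f = (\<Oplus>\<^bsub>P\<^esub>x\<in>I. p x \<odot>\<^bsub>P\<^esub> f (fst x) (snd x))"
    "\<And>(P :: ('a, 'q) module) f.
      tensor_lift R P t f = (\<Oplus>\<^bsub>P\<^esub>x\<in>I. p x \<odot>\<^bsub>P\<^esub> f (fst x) (snd x))"
proof -
  note sub = module.submodule_abelian_subgroup[OF module_free_module tensor_relations_submodule]
  let ?q = "SOME q. q \<in> t"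
  obtain p where p: "p \<in> carrier (tensor_free A B)" "t = tensor_coset A B p"
    using assms unfolding tensor_carrier by blast
  have "?q \<in> t" unfolding p(2)
    by (rule someI[of "\<lambda>q. q \<in> _", OF abelian_subgroup.a_rcos_self[OF sub p(1)]])
  then have "?q \<in> carrier (tensor_free A B)"
    using p abelian_subgroup.a_elemrcos_carrier[OF sub] by blast
  then show ?thesis
    by (intro that[of "{x. ?q x \<noteq> \<zero>}" ?q]) (auto simp: free_module_carrier tensor_lift_def Let_def)
qed

end

end

section \<open>Sweedler calculus\<close>

text \<open>\<open>foldSetD\<close> applies the factor only to elements of \<open>A\<close>, so
  agreement on \<open>A\<close> transfers the fold itself. Free of membership conditions, this form
  lets \<open>tensor_lift_cong\<close> rewrite under a lift without first placing the values in a
  carrier.\<close>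

lemma finprod_cong_general:
  assumes "\<And>x. x \<in> A \<Longrightarrow> f x = g x"
  shows "finprod G f A = finprod G g A"
proof -
  have sub: "(A, y) \<in> foldSetD D (mult G \<circ> g) e"
    if "(A, y) \<in> foldSetD D (mult G \<circ> f) e" "\<And>x. x \<in> A \<Longrightarrow> f x = g x" for f g A y D e
    using that
  proof (induction rule: foldSetD.induct)
    case (insertI x A y)
    then have "(mult G \<circ> f) x y = (mult G \<circ> g) x y" by simp
    with insertI show ?case
      using foldSetD.insertI[of x A "mult G \<circ> g" y D e] by (metis insertCI)
  qed (rule foldSetD.emptyI)
  have "(A, y) \<in> foldSetD D (mult G \<circ> f) e \<longleftrightarrow> (A, y) \<in> foldSetD D (mult G \<circ> g) e" for y D e
    using sub[of A y D f e g] sub[of A y D g e f] assms by auto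
  then show ?thesis by (simp add: finprod_def foldD_def)
qed

lemma finsum_cong_general: "(\<And>x. x \<in> A \<Longrightarrow> f x = g x) \<Longrightarrow> finsum G f A = finsum G g A"
  unfolding finsum_def by (rule finprod_cong_general)

lemma (in abelian_monoid) finsum_swap:
  assumes "finite I" "finite J" "\<And>i j. \<lbrakk>i \<in> I; j \<in> J\<rbrakk> \<Longrightarrow> h i j \<in> carrier G"
  shows "(\<Oplus>i\<in>I. \<Oplus>j\<in>J. h i j) = (\<Oplus>j\<in>J. \<Oplus>i\<in>I. h i j)"
  using assms(1,3)
proof (induction rule: finite_induct)
  case empty
  then show ?case by (simp add: finsum_zero)
next
  case (insert x I)
  have "(\<Oplus>i\<in>insert x I. \<Oplus>j\<in>J. h i j) = (\<Oplus>j\<in>J. h x j) \<oplus> (\<Oplus>i\<in>I. \<Oplus>j\<in>J. h i j)"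
    using insert by (intro finsum_insert finsum_closed funcsetI) auto
  also have "\<dots> = (\<Oplus>j\<in>J. h x j) \<oplus> (\<Oplus>j\<in>J. \<Oplus>i\<in>I. h i j)"
    using insert by simp
  also have "\<dots> = (\<Oplus>j\<in>J. h x j \<oplus> (\<Oplus>i\<in>I. h i j))"
    using insert by (intro finsum_addf[symmetric] finsum_closed funcsetI) auto
  also have "\<dots> = (\<Oplus>j\<in>J. \<Oplus>i\<in>insert x I. h i j)"
    using insert by (intro finsum_cong' finsum_insert[symmetric] finsum_closed funcsetI) auto
  finally show ?case .
qed

context cring
begin

text \<open>Both lifts sum over the same representative. The rule supplies carrier membership of the
  Sweedler components while rewriting under the sum.\<close>

lemma tensor_lift_cong:
  fixes P :: "('a, 'p) module"
  assumes A: "module R A" and B: "module R B" and t: "t \<in> carrier (A \<boxtimes> B)"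
    and eq: "\<And>a b. \<lbrakk>a \<in> carrier A; b \<in> carrier B\<rbrakk> \<Longrightarrow> f a b = g a b"
  shows "tensor_lift R P t f = tensor_lift R P t g"
proof -
  obtain I p where I: "finite I" "I \<subseteq> carrier A \<times> carrier B" "\<And>x. p x \<in> carrier R"
    and lift: "\<And>(P :: ('a, 'p) module) f. tensor_lift R P t f = (\<Oplus>\<^bsub>P\<^esub>x\<in>I. p x \<odot>\<^bsub>P\<^esub> f (fst x) (snd x))"
    by (rule tensor_lift_representative[OF A B t]) blast
  show ?thesis unfolding lift
    using I(2) by (intro finsum_cong_general) (auto simp: eq)
qed

lemma tensor_lift_closed:
  fixes P :: "('a, 'p) module"
  assumes A: "module R A" and B: "module R B" and t: "t \<in> carrier (A \<boxtimes> B)" and P: "module R P"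
    and f: "\<And>a b. \<lbrakk>a \<in> carrier A; b \<in> carrier B\<rbrakk> \<Longrightarrow> f a b \<in> carrier P"
  shows "tensor_lift R P t f \<in> carrier P"
proof -
  obtain I p where I: "finite I" "I \<subseteq> carrier A \<times> carrier B" "\<And>x. p x \<in> carrier R"
    and lift: "\<And>(P :: ('a, 'p) module) f. tensor_lift R P t f = (\<Oplus>\<^bsub>P\<^esub>x\<in>I. p x \<odot>\<^bsub>P\<^esub> f (fst x) (snd x))"
    by (rule tensor_lift_representative[OF A B t]) blast
  interpret P: module R P by fact
  show ?thesis unfolding lift
    using I f by (intro P.finsum_closed funcsetI P.smult_closed) auto
qed

text \<open>A linear map passes through a fixed finite linear combination. The two sums live in
  modules with different element types, which is why \<open>tensor_lift_representative\<close> gives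
  its formula at two type instances.\<close>

lemma linear_maps_tensor_lift:
  fixes P :: "('a, 'p) module" and Q :: "('a, 'q) module"
  assumes A: "module R A" and B: "module R B" and t: "t \<in> carrier (A \<boxtimes> B)"
    and P: "module R P" and Q: "module R Q" and g: "g \<in> linear_maps R P Q"
    and f: "\<And>a b. \<lbrakk>a \<in> carrier A; b \<in> carrier B\<rbrakk> \<Longrightarrow> f a b \<in> carrier P"
  shows "g (tensor_lift R P t f) = tensor_lift R Q t (\<lambda>a b. g (f a b))"
proof -
  obtain I p where I: "finite I" "I \<subseteq> carrier A \<times> carrier B" "\<And>x. p x \<in> carrier R"
    and lift: "\<And>(P :: ('a, 'p) module) f. tensor_lift R P t f = (\<Oplus>\<^bsub>P\<^esub>x\<in>I. p x \<odot>\<^bsub>P\<^esub> f (fst x) (snd x))"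
      "\<And>(P :: ('a, 'q) module) f. tensor_lift R P t f = (\<Oplus>\<^bsub>P\<^esub>x\<in>I. p x \<odot>\<^bsub>P\<^esub> f (fst x) (snd x))"
    by (rule tensor_lift_representative[OF A B t]) blast
  interpret P: module R P by fact
  have fI: "f (fst x) (snd x) \<in> carrier P" if "x \<in> I" for x
    using that I(2) by (intro f) auto
  have "g (tensor_lift R P t f) = (\<Oplus>\<^bsub>Q\<^esub>x\<in>I. g (p x \<odot>\<^bsub>P\<^esub> f (fst x) (snd x)))"
    unfolding lift using I fI by (intro linear_maps_finsum[OF P Q g] funcsetI P.smult_closed) auto
  also have "\<dots> = tensor_lift R Q t (\<lambda>a b. g (f a b))"
    unfolding lift
    using I(3) fI by (intro finsum_cong_general linear_maps_smult[OF g])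
  finally show ?thesis .
qed

text \<open>The complement of \<open>tensor_lift_linear\<close>: here the tensor is fixed and the
  integrand varies linearly with a parameter. Together they give linearity in every variable of a
  nested Sweedler expression.\<close>

lemma tensor_lift_linear_param:
  fixes P :: "('a, 'p) module"
  assumes A: "module R A" and B: "module R B" and t: "t \<in> carrier (A \<boxtimes> B)" and P: "module R P"
    and f: "\<And>a b. \<lbrakk>a \<in> carrier A; b \<in> carrier B\<rbrakk> \<Longrightarrow> (\<lambda>x. f x a b) \<in> linear_maps R X P"
  shows "(\<lambda>x. tensor_lift R P t (f x)) \<in> linear_maps R X P"
proof -
  obtain I p where I: "finite I" "I \<subseteq> carrier A \<times> carrier B" "\<And>x. p x \<in> carrier R"
    and lift: "\<And>(P :: ('a, 'p) module) f. tensor_lift R P t f = (\<Oplus>\<^bsub>P\<^esub>x\<in>I. p x \<odot>\<^bsub>P\<^esub> f (fst x) (snd x))"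
    by (rule tensor_lift_representative[OF A B t]) blast
  interpret P: module R P by fact
  have fI: "(\<lambda>y. f y (fst x) (snd x)) \<in> linear_maps R X P" if "x \<in> I" for x
    using that I(2) by (intro f) auto
  have cl: "f y (fst x) (snd x) \<in> carrier P" if "x \<in> I" "y \<in> carrier X" for x y
    by (rule linear_maps_closed[OF fI[OF that(1)] that(2)])
  show ?thesis
  proof (rule linear_mapsI)
    fix y assume "y \<in> carrier X"
    then show "tensor_lift R P t (f y) \<in> carrier P"
      unfolding lift using I cl by (intro P.finsum_closed funcsetI P.smult_closed) auto
  next
    fix y z assume yz: "y \<in> carrier X" "z \<in> carrier X"
    have "(\<Oplus>\<^bsub>P\<^esub>x\<in>I. p x \<odot>\<^bsub>P\<^esub> f (y \<oplus>\<^bsub>X\<^esub> z) (fst x) (snd x))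
      = (\<Oplus>\<^bsub>P\<^esub>x\<in>I. p x \<odot>\<^bsub>P\<^esub> f y (fst x) (snd x) \<oplus>\<^bsub>P\<^esub> p x \<odot>\<^bsub>P\<^esub> f z (fst x) (snd x))"
      using I(3) cl yz linear_maps_add[OF fI yz]
      by (intro finsum_cong_general) (simp add: P.smult_r_distr)
    also have "\<dots> = (\<Oplus>\<^bsub>P\<^esub>x\<in>I. p x \<odot>\<^bsub>P\<^esub> f y (fst x) (snd x))
        \<oplus>\<^bsub>P\<^esub> (\<Oplus>\<^bsub>P\<^esub>x\<in>I. p x \<odot>\<^bsub>P\<^esub> f z (fst x) (snd x))"
      using I cl yz by (intro P.finsum_addf funcsetI P.smult_closed) auto
    finally show "tensor_lift R P t (f (y \<oplus>\<^bsub>X\<^esub> z)) = tensor_lift R P t (f y) \<oplus>\<^bsub>P\<^esub>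
        tensor_lift R P t (f z)"
      unfolding lift .
  next
    fix c y assume cy: "c \<in> carrier R" "y \<in> carrier X"
    have "(\<Oplus>\<^bsub>P\<^esub>x\<in>I. p x \<odot>\<^bsub>P\<^esub> f (c \<odot>\<^bsub>X\<^esub> y) (fst x) (snd x))
      = (\<Oplus>\<^bsub>P\<^esub>x\<in>I. c \<odot>\<^bsub>P\<^esub> (p x \<odot>\<^bsub>P\<^esub> f y (fst x) (snd x)))"
      using I(3) cl cy linear_maps_smult[OF fI cy]
      by (intro finsum_cong_general) (simp add: P.smult_assoc1[symmetric] m_comm)
    also have "\<dots> = c \<odot>\<^bsub>P\<^esub> (\<Oplus>\<^bsub>P\<^esub>x\<in>I. p x \<odot>\<^bsub>P\<^esub> f y (fst x) (snd x))"
      using I cl cy by (intro P.finsum_smult_ldistr[symmetric] funcsetI P.smult_closed) auto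
    finally show "tensor_lift R P t (f (c \<odot>\<^bsub>X\<^esub> y)) = c \<odot>\<^bsub>P\<^esub> tensor_lift R P t (f y)"
      unfolding lift .
  qed
qed

text \<open>Independent Sweedler sums become finite sums over two fixed representatives. Their
  exchange is the finite Fubini rule, and commutativity of \<open>R\<close> exchanges the
  coefficients.\<close>

lemma tensor_lift_swap:
  fixes P :: "('a, 'p) module"
  assumes A: "module R A" and B: "module R B" and t: "t \<in> carrier (A \<boxtimes> B)"
    and C: "module R C" and D: "module R D" and s: "s \<in> carrier (C \<boxtimes> D)" and P: "module R P"
    and f: "\<And>a b c d. \<lbrakk>a \<in> carrier A; b \<in> carrier B; c \<in> carrier C; d \<in> carrier D\<rbrakk>
      \<Longrightarrow> f a b c d \<in> carrier P"
  shows "tensor_lift R P t (\<lambda>a b. tensor_lift R P s (f a b)) =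
    tensor_lift R P s (\<lambda>c d. tensor_lift R P t (\<lambda>a b. f a b c d))"
proof -
  obtain I p where I: "finite I" "I \<subseteq> carrier A \<times> carrier B" "\<And>x. p x \<in> carrier R"
    and lift: "\<And>(P :: ('a, 'p) module) f. tensor_lift R P t f = (\<Oplus>\<^bsub>P\<^esub>x\<in>I. p x \<odot>\<^bsub>P\<^esub> f (fst x) (snd x))"
    by (rule tensor_lift_representative[OF A B t]) blast
  obtain J q where J: "finite J" "J \<subseteq> carrier C \<times> carrier D" "\<And>x. q x \<in> carrier R"
    and lift': "\<And>(P :: ('a, 'p) module) f. tensor_lift R P s f = (\<Oplus>\<^bsub>P\<^esub>x\<in>J. q x \<odot>\<^bsub>P\<^esub> f (fst x) (snd x))"
    by (rule tensor_lift_representative[OF C D s]) blast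
  interpret P: module R P by fact
  let ?f = "\<lambda>x y. f (fst x) (snd x) (fst y) (snd y)"
  have cl: "?f x y \<in> carrier P" if "x \<in> I" "y \<in> J" for x y
    using that I(2) J(2) by (intro f) auto
  have "(\<Oplus>\<^bsub>P\<^esub>x\<in>I. p x \<odot>\<^bsub>P\<^esub> (\<Oplus>\<^bsub>P\<^esub>y\<in>J. q y \<odot>\<^bsub>P\<^esub> ?f x y))
    = (\<Oplus>\<^bsub>P\<^esub>x\<in>I. \<Oplus>\<^bsub>P\<^esub>y\<in>J. p x \<odot>\<^bsub>P\<^esub> (q y \<odot>\<^bsub>P\<^esub> ?f x y))"
    using I J cl by (intro finsum_cong_general P.finsum_smult_ldistr funcsetI P.smult_closed) auto
  also have "\<dots> = (\<Oplus>\<^bsub>P\<^esub>y\<in>J. \<Oplus>\<^bsub>P\<^esub>x\<in>I. p x \<odot>\<^bsub>P\<^esub> (q y \<odot>\<^bsub>P\<^esub> ?f x y))"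
    using I J cl by (intro P.finsum_swap P.smult_closed) auto
  also have "\<dots> = (\<Oplus>\<^bsub>P\<^esub>y\<in>J. \<Oplus>\<^bsub>P\<^esub>x\<in>I. q y \<odot>\<^bsub>P\<^esub> (p x \<odot>\<^bsub>P\<^esub> ?f x y))"
    using I J cl by (intro finsum_cong_general) (simp add: P.smult_assoc1[symmetric] m_comm)
  also have "\<dots> = (\<Oplus>\<^bsub>P\<^esub>y\<in>J. q y \<odot>\<^bsub>P\<^esub> (\<Oplus>\<^bsub>P\<^esub>x\<in>I. p x \<odot>\<^bsub>P\<^esub> ?f x y))"
    using I J cl
    by (intro finsum_cong_general P.finsum_smult_ldistr[symmetric] funcsetI P.smult_closed) auto
  finally show ?thesis unfolding lift lift' .
qed

text \<open>Any element is the Sweedler sum of its own pure tensors. Inserting this expansion lets a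
  linear map be computed from its values on pure tensors, even inside a larger expression.\<close>

lemma tensor_lift_pure_id:
  assumes A: "module R A" and B: "module R B" and t: "t \<in> carrier (A \<boxtimes> B)"
  shows "tensor_lift R (A \<boxtimes> B) t (pure R A B) = t"
  by (rule tensor_ext[OF A B module_tensor[OF A B]
        tensor_lift_linear[OF A B module_tensor[OF A B] pure_bilinear[OF A B]] linear_maps_id _ t])
    (rule tensor_lift_pure[OF A B module_tensor[OF A B] pure_bilinear[OF A B]])

text \<open>\<open>tensor_assoc\<close> lifts over a tensor product inside a lift over a larger one;
  this makes the inner lift a legitimate integrand of the outer.\<close>

lemma tensor_lift_bilinear:
  assumes "module R A" "module R B" "module R P"
    and "\<And>x. x \<in> carrier D \<Longrightarrow> (\<lambda>a b. f a b x) \<in> bilinear_maps R A B P"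
    and "\<And>a b. \<lbrakk>a \<in> carrier A; b \<in> carrier B\<rbrakk> \<Longrightarrow> (\<lambda>x. f a b x) \<in> linear_maps R D P"
  shows "(\<lambda>s x. tensor_lift R P s (\<lambda>a b. f a b x)) \<in> bilinear_maps R (A \<boxtimes> B) D P"
  by (rule bilinear_mapsI; intro tensor_lift_linear tensor_lift_linear_param[OF assms(1,2)]
      assms; assumption)

section \<open>Tensor products of linear maps and the rebracketing of threefold tensors\<close>

context
  fixes A :: "('a, 'c) module" and B :: "('a, 'd) module"
    and C :: "('a, 'e) module" and D :: "('a, 'f) module" and f g
  assumes A: "module R A" and B: "module R B" and C: "module R C" and D: "module R D"
    and f: "f \<in> linear_maps R A C" and g: "g \<in> linear_maps R B D"
begin

lemma bilinear_maps_compose: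
  assumes F: "F \<in> bilinear_maps R C D P"
  shows "(\<lambda>a b. F (f a) (g b)) \<in> bilinear_maps R A B P"
  by (intro bilinear_mapsI linear_maps_compose[OF bilinear_mapsD(1)[OF F] f]
      linear_maps_compose[OF bilinear_mapsD(2)[OF F] g] linear_maps_closed[OF f]
          linear_maps_closed[OF g])

lemma tensor_map_linear: "tensor_map R C D f g \<in> linear_maps R (A \<boxtimes> B) (C \<boxtimes> D)"
  unfolding tensor_map_def
  by (intro tensor_lift_linear A B module_tensor C D bilinear_maps_compose pure_bilinear)

lemma tensor_map_pure:
  assumes "a \<in> carrier A" "b \<in> carrier B"
  shows "tensor_map R C D f g (pure R A B a b) = pure R C D (f a) (g b)"
  unfolding tensor_map_def
  by (intro tensor_lift_pure A B module_tensor C D bilinear_maps_compose pure_bilinear assms)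

text \<open>Change of variables in a Sweedler sum. It moves the twist from the argument of a
  comultiplication or coaction to the components.\<close>

lemma tensor_lift_tensor_map:
  assumes t: "t \<in> carrier (A \<boxtimes> B)" and P: "module R P" and F: "F \<in> bilinear_maps R C D P"
  shows "tensor_lift R P (tensor_map R C D f g t) F = tensor_lift R P t (\<lambda>a b. F (f a) (g b))"
  unfolding tensor_map_def
  by (subst linear_maps_tensor_lift[OF A B t module_tensor[OF C D] P
      tensor_lift_linear[OF C D P F]];
    intro tensor_lift_cong[OF A B t] tensor_lift_pure[OF C D P F] pure_closed[OF C D]
      linear_maps_closed[OF f] linear_maps_closed[OF g]; assumption)

end

lemma pure_pure_bilinear:
  assumes A: "module R A" and B: "module R B" and C: "module R C" and c: "c \<in> carrier C"
  shows "(\<lambda>a b. pure R A (B \<boxtimes> C) a (pure R B C b c)) \<in> bilinear_maps R A B (A \<boxtimes> B \<boxtimes> C)"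
  by (intro bilinear_mapsI pure_linear_left pure_closed A B C c module_tensor
      linear_maps_compose[OF pure_linear_right[OF A module_tensor[OF B C]]
          pure_linear_left[OF B C c]])

text \<open>(Co)associativity laws, stated through \<^const>\<open>tensor_assoc\<close>, are equalities of two maps into
  the threefold tensor product; by universality they may be tested on trilinear maps.\<close>

context
  fixes A :: "('a, 'c) module" and B :: "('a, 'd) module" and C :: "('a, 'e) module"
    and X :: "('a, 'x) module" and Y :: "('a, 'y) module" and \<delta> \<beta> \<gamma> \<rho> t
  assumes mods: "module R A" "module R B" "module R C" "module R X" "module R Y"
    and \<delta>: "\<delta> \<in> linear_maps R X (A \<boxtimes> B)" and \<gamma>: "\<gamma> \<in> linear_maps R Y C"
    and \<beta>: "\<beta> \<in> linear_maps R X A" and \<rho>: "\<rho> \<in> linear_maps R Y (B \<boxtimes> C)"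
    and t: "t \<in> carrier (X \<boxtimes> Y)"
begin

lemma tensor_assoc_left:
  "tensor_assoc R A B C (tensor_map R (A \<boxtimes> B) C \<delta> \<gamma> t) =
    tensor_lift R (A \<boxtimes> B \<boxtimes> C) t (\<lambda>x y. tensor_lift R (A \<boxtimes> B \<boxtimes> C) (\<delta> x) (\<lambda>a b.
      pure R A (B \<boxtimes> C) a (pure R B C b (\<gamma> y))))"
  unfolding tensor_assoc_def
  by (intro tensor_lift_tensor_map[OF mods(4,5) module_tensor[OF mods(1,2)] mods(3) \<delta> \<gamma> t]
      tensor_lift_bilinear mods module_tensor pure_pure_bilinear
      linear_maps_compose[OF pure_linear_right[OF mods(1) module_tensor[OF mods(2,3)]]
        pure_linear_right[OF mods(2,3)]])

lemma tensor_assoc_right: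
  "tensor_map R A (B \<boxtimes> C) \<beta> \<rho> t =
    tensor_lift R (A \<boxtimes> B \<boxtimes> C) t (\<lambda>x y. tensor_lift R (A \<boxtimes> B \<boxtimes> C) (\<rho> y) (\<lambda>b c.
      pure R A (B \<boxtimes> C) (\<beta> x) (pure R B C b c)))"
  unfolding tensor_map_def
proof (rule tensor_lift_cong[OF mods(4,5) t])
  fix x y assume x: "x \<in> carrier X" and y: "y \<in> carrier Y"
  note \<rho>y = linear_maps_closed[OF \<rho> y] and \<beta>x = linear_maps_closed[OF \<beta> x]
  have "pure R A (B \<boxtimes> C) (\<beta> x) (\<rho> y) =
    pure R A (B \<boxtimes> C) (\<beta> x) (tensor_lift R (B \<boxtimes> C) (\<rho> y) (pure R B C))"
    by (simp add: tensor_lift_pure_id[OF mods(2,3) \<rho>y])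
  also have "\<dots> = tensor_lift R (A \<boxtimes> B \<boxtimes> C) (\<rho> y) (\<lambda>b c.
      pure R A (B \<boxtimes> C) (\<beta> x) (pure R B C b c))"
    by (intro linear_maps_tensor_lift[OF mods(2,3) \<rho>y module_tensor[OF mods(2,3)]] mods \<beta>x
        module_tensor
        pure_linear_right pure_closed)
  finally show "pure R A (B \<boxtimes> C) (\<beta> x) (\<rho> y) = tensor_lift R (A \<boxtimes> B \<boxtimes> C) (\<rho> y) (\<lambda>b c.
      pure R A (B \<boxtimes> C) (\<beta> x) (pure R B C b c))" .
qed

lemma tensor_assoc_trilinear:
  assumes eq: "tensor_assoc R A B C (tensor_map R (A \<boxtimes> B) C \<delta> \<gamma> t) = tensor_map R A (B \<boxtimes> C) \<beta> \<rho> t"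
    and P: "module R P"
    and F: "\<And>b c. \<lbrakk>b \<in> carrier B; c \<in> carrier C\<rbrakk> \<Longrightarrow> (\<lambda>a. F a b c) \<in> linear_maps R A P"
      "\<And>a c. \<lbrakk>a \<in> carrier A; c \<in> carrier C\<rbrakk> \<Longrightarrow> (\<lambda>b. F a b c) \<in> linear_maps R B P"
      "\<And>a b. \<lbrakk>a \<in> carrier A; b \<in> carrier B\<rbrakk> \<Longrightarrow> (\<lambda>c. F a b c) \<in> linear_maps R C P"
  shows "tensor_lift R P t (\<lambda>x y. tensor_lift R P (\<delta> x) (\<lambda>a b. F a b (\<gamma> y))) =
    tensor_lift R P t (\<lambda>x y. tensor_lift R P (\<rho> y) (\<lambda>b c. F (\<beta> x) b c))"
proof -
  \<comment> \<open>Linearises \<open>F\<close> on B \<otimes> C. Lifting \<open>?G\<close> once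
    more gives the linear map on A \<otimes> (B \<otimes> C) that takes the threefold pure tensor to
    \<open>F a b c\<close>; it is applied to both sides of \<open>eq\<close>.\<close>
  let ?G = "\<lambda>a s. tensor_lift R P s (F a)"
  let ?Q = "A \<boxtimes> B \<boxtimes> C"
  have bil: "F a \<in> bilinear_maps R B C P" if "a \<in> carrier A" for a
    using F that by (intro bilinear_mapsI)
  have G: "?G \<in> bilinear_maps R A (B \<boxtimes> C) P"
    by (rule bilinear_mapsI; intro tensor_lift_linear_param[OF mods(2,3)] tensor_lift_linear mods
        P bil F; assumption)
  have Gp: "tensor_lift R P (pure R A (B \<boxtimes> C) a (pure R B C b c)) ?G = F a b c"
    if "a \<in> carrier A" "b \<in> carrier B" "c \<in> carrier C" for a b c
    by (simp add: tensor_lift_pure[OF mods(1) module_tensor[OF mods(2,3)] P G that(1)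
        pure_closed[OF mods(2,3) that(2,3)]] tensor_lift_pure[OF mods(2,3) P
            bil[OF that(1)] that(2,3)])
  note lin = tensor_lift_linear[OF mods(1) module_tensor[OF mods(2,3)] P G]
  note Q = module_tensor[OF mods(1) module_tensor[OF mods(2,3)]]
  note closed = linear_maps_closed[OF \<delta>] linear_maps_closed[OF \<gamma>] linear_maps_closed[OF \<rho>]
    linear_maps_closed[OF \<beta>]
  have "tensor_lift R P (tensor_lift R ?Q t (\<lambda>x y. tensor_lift R ?Q (\<delta> x) (\<lambda>a b.
      pure R A (B \<boxtimes> C) a (pure R B C b (\<gamma> y))))) ?G =
    tensor_lift R P t (\<lambda>x y. tensor_lift R P (\<delta> x) (\<lambda>a b. F a b (\<gamma> y)))"
  proof (subst linear_maps_tensor_lift[OF mods(4,5) t Q P lin])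
    fix x y assume "x \<in> carrier X" "y \<in> carrier Y"
    then show "tensor_lift R ?Q (\<delta> x) (\<lambda>a b. pure R A (B \<boxtimes> C) a (pure R B C b (\<gamma> y))) \<in> carrier ?Q"
      by (intro tensor_lift_closed[OF mods(1,2)] closed Q pure_closed mods module_tensor)
  next
    show "tensor_lift R P t (\<lambda>x y. tensor_lift R P (tensor_lift R ?Q (\<delta> x) (\<lambda>a b.
        pure R A (B \<boxtimes> C) a (pure R B C b (\<gamma> y)))) ?G) =
      tensor_lift R P t (\<lambda>x y. tensor_lift R P (\<delta> x) (\<lambda>a b. F a b (\<gamma> y)))"
    proof (rule tensor_lift_cong[OF mods(4,5) t])
      fix x y assume xy: "x \<in> carrier X" "y \<in> carrier Y"
      show "tensor_lift R P (tensor_lift R ?Q (\<delta> x) (\<lambda>a b.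
          pure R A (B \<boxtimes> C) a (pure R B C b (\<gamma> y)))) ?G = tensor_lift R P (\<delta> x) (\<lambda>a b. F a b (\<gamma> y))"
        by (subst linear_maps_tensor_lift[OF mods(1,2) closed(1)[OF xy(1)] Q P lin];
          intro pure_closed mods module_tensor closed xy
            tensor_lift_cong[OF mods(1,2) closed(1)[OF xy(1)]] Gp; assumption)
    qed
  qed
  moreover have "tensor_lift R P (tensor_lift R ?Q t (\<lambda>x y. tensor_lift R ?Q (\<rho> y) (\<lambda>b c.
      pure R A (B \<boxtimes> C) (\<beta> x) (pure R B C b c)))) ?G =
    tensor_lift R P t (\<lambda>x y. tensor_lift R P (\<rho> y) (\<lambda>b c. F (\<beta> x) b c))"
  proof (subst linear_maps_tensor_lift[OF mods(4,5) t Q P lin])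
    fix x y assume "x \<in> carrier X" "y \<in> carrier Y"
    then show "tensor_lift R ?Q (\<rho> y) (\<lambda>b c. pure R A (B \<boxtimes> C) (\<beta> x) (pure R B C b c)) \<in> carrier ?Q"
      by (intro tensor_lift_closed[OF mods(2,3)] closed Q pure_closed mods module_tensor)
  next
    show "tensor_lift R P t (\<lambda>x y. tensor_lift R P (tensor_lift R ?Q (\<rho> y) (\<lambda>b c.
        pure R A (B \<boxtimes> C) (\<beta> x) (pure R B C b c))) ?G) =
      tensor_lift R P t (\<lambda>x y. tensor_lift R P (\<rho> y) (\<lambda>b c. F (\<beta> x) b c))"
    proof (rule tensor_lift_cong[OF mods(4,5) t])
      fix x y assume xy: "x \<in> carrier X" "y \<in> carrier Y"
      show "tensor_lift R P (tensor_lift R ?Q (\<rho> y) (\<lambda>b c.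
          pure R A (B \<boxtimes> C) (\<beta> x) (pure R B C b c))) ?G = tensor_lift R P (\<rho> y) (\<lambda>b c. F (\<beta> x) b c)"
        by (subst linear_maps_tensor_lift[OF mods(2,3) closed(3)[OF xy(2)] Q P lin];
          intro pure_closed mods module_tensor closed xy
            tensor_lift_cong[OF mods(2,3) closed(3)[OF xy(2)]] Gp; assumption)
    qed
  qed
  ultimately show ?thesis using eq unfolding tensor_assoc_left tensor_assoc_right by simp
qed

end

end

section \<open>Comodules over a coquasitriangular Hom-bialgebra\<close>

context cring
begin

lemma linear_maps_smult_left:
  assumes "module R P" "s \<in> linear_maps R X (scalar_module R)" "v \<in> carrier P"
  shows "(\<lambda>x. s x \<odot>\<^bsub>P\<^esub> v) \<in> linear_maps R X P"
proof -
  interpret P: module R P by fact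
  note [simp] = linear_mapsD[OF assms(2), unfolded scalar_module_def, simplified] assms(3)
  show ?thesis
    by (rule linear_mapsI) (simp_all add: P.smult_l_distr P.smult_assoc1 scalar_module_def)
qed

lemma linear_maps_smult_right:
  assumes "module R P" "f \<in> linear_maps R X P" "c \<in> carrier R"
  shows "(\<lambda>x. c \<odot>\<^bsub>P\<^esub> f x) \<in> linear_maps R X P"
proof -
  interpret P: module R P by fact
  note [simp] = linear_mapsD[OF assms(2)] assms(3)
  show ?thesis
    by (rule linear_mapsI) (simp_all add: P.smult_r_distr P.smult_assoc1[symmetric] m_comm)
qed

lemma smult_tensor_lift:
  assumes "module R A" "module R B" "t \<in> carrier (A \<boxtimes> B)" "module R P" "c \<in> carrier R"
    and "\<And>a b. \<lbrakk>a \<in> carrier A; b \<in> carrier B\<rbrakk> \<Longrightarrow> f a b \<in> carrier P"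
  shows "c \<odot>\<^bsub>P\<^esub> tensor_lift R P t f = tensor_lift R P t (\<lambda>a b. c \<odot>\<^bsub>P\<^esub> f a b)"
  by (rule linear_maps_tensor_lift[OF assms(1-4) assms(4)
        linear_maps_smult_right[OF assms(4) linear_maps_id assms(5)] assms(6)])

end

section \<open>Sweedler rules for the comultiplication\<close>

context hom_bialgebra
begin

lemma H_module: "module R H" by (rule H.module_axioms)

lemmas HH_module = module_tensor[OF H_module H_module]

lemma mult_closed: "\<lbrakk>x \<in> carrier H; y \<in> carrier H\<rbrakk> \<Longrightarrow> x \<cdot> y \<in> carrier H"
  by (intro linear_maps_closed[OF mu_linear] pure_closed H_module)

lemmas alpha_closed = linear_maps_closed[OF alpha_linear]
lemmas delta_closed = linear_maps_closed[OF delta_linear]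
lemmas linear_alpha = linear_maps_compose[OF alpha_linear]

lemma linear_mult_left:
  "\<lbrakk>f \<in> linear_maps R X H; y \<in> carrier H\<rbrakk> \<Longrightarrow> (\<lambda>x. f x \<cdot> y) \<in> linear_maps R X H"
  by (rule linear_maps_compose[OF linear_maps_compose[OF mu_linear
      pure_linear_left[OF H_module H_module]]])

lemma linear_mult_right:
  "\<lbrakk>f \<in> linear_maps R X H; y \<in> carrier H\<rbrakk> \<Longrightarrow> (\<lambda>x. y \<cdot> f x) \<in> linear_maps R X H"
  by (rule linear_maps_compose[OF linear_maps_compose[OF mu_linear
      pure_linear_right[OF H_module H_module]]])

lemma linear_pure_left:
  "\<lbrakk>f \<in> linear_maps R X A; b \<in> carrier B; module R A; module R B\<rbrakk>
    \<Longrightarrow> (\<lambda>x. pure R A B (f x) b) \<in> linear_maps R X (A \<boxtimes> B)"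
  by (rule linear_maps_compose[OF pure_linear_left])

lemma linear_pure_right:
  "\<lbrakk>f \<in> linear_maps R X B; a \<in> carrier A; module R A; module R B\<rbrakk>
    \<Longrightarrow> (\<lambda>x. pure R A B a (f x)) \<in> linear_maps R X (A \<boxtimes> B)"
  by (rule linear_maps_compose[OF pure_linear_right])

lemma linear_lift_delta:
  "\<lbrakk>f \<in> linear_maps R X H; module R P; F \<in> bilinear_maps R H H P\<rbrakk>
    \<Longrightarrow> (\<lambda>x. tensor_lift R P (\<Delta> (f x)) F) \<in> linear_maps R X P"
  by (rule linear_maps_compose[OF linear_maps_compose[OF tensor_lift_linear[OF H_module H_module]
      delta_linear]])

lemmas lift_delta_cong = tensor_lift_cong[OF H_module H_module delta_closed]
lemmas lift_delta_closed = tensor_lift_closed[OF H_module H_module delta_closed]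
lemmas linear_lift_delta_param = tensor_lift_linear_param[OF H_module H_module delta_closed]

lemma lift_delta_alpha:
  assumes "h \<in> carrier H" "module R P" "F \<in> bilinear_maps R H H P"
  shows "tensor_lift R P (\<Delta> (\<alpha> h)) F = tensor_lift R P (\<Delta> h) (\<lambda>a b. F (\<alpha> a) (\<alpha> b))"
  unfolding delta_alpha[OF assms(1)]
  by (rule tensor_lift_tensor_map[OF H_module H_module H_module H_module alpha_linear alpha_linear
        delta_closed[OF assms(1)] assms(2,3)])

text \<open>Membership of a Sweedler expression in its carrier and its linearity in each variable
  both follow its syntax. This collection and \<open>linear_rules\<close> decompose such goals, and
  are extended below by rules for \<sigma>, for a comodule and for a pair of comodules.\<close>

lemmas closed_rules = H_module module_tensor module_scalar_module mult_closed alpha_closed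
  delta_closed pure_closed lift_delta_closed

lemmas linear_rules = bilinear_mapsI linear_maps_id linear_alpha linear_mult_left linear_mult_right
  linear_pure_left linear_pure_right linear_lift_delta linear_lift_delta_param
  linear_maps_smult_left linear_maps_smult_right

lemma lift_delta_mult:
  assumes h: "h \<in> carrier H" and h': "h' \<in> carrier H" and P: "module R P"
    and F: "F \<in> bilinear_maps R H H P"
  shows "tensor_lift R P (\<Delta> (h \<cdot> h')) F =
    tensor_lift R P (\<Delta> h) (\<lambda>a b. tensor_lift R P (\<Delta> h') (\<lambda>a' b'. F (a \<cdot> a') (b \<cdot> b')))"
  unfolding delta_mult[OF h h']
proof (subst linear_maps_tensor_lift[OF H_module H_module delta_closed[OF h] HH_module P
      tensor_lift_linear[OF H_module H_module P F]])
  show "tensor_lift R P (\<Delta> h) (\<lambda>a b. tensor_lift R P (tensor_lift R (H \<boxtimes> H) (\<Delta> h') (\<lambda>a' b'.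
      pure R H H (a \<cdot> a') (b \<cdot> b'))) F) =
    tensor_lift R P (\<Delta> h) (\<lambda>a b. tensor_lift R P (\<Delta> h') (\<lambda>a' b'. F (a \<cdot> a') (b \<cdot> b')))"
  proof (rule lift_delta_cong[OF h])
    fix a b assume ab: "a \<in> carrier H" "b \<in> carrier H"
    show "tensor_lift R P (tensor_lift R (H \<boxtimes> H) (\<Delta> h') (\<lambda>a' b'. pure R H H (a \<cdot> a') (b \<cdot> b'))) F
      = tensor_lift R P (\<Delta> h') (\<lambda>a' b'. F (a \<cdot> a') (b \<cdot> b'))"
      by (subst linear_maps_tensor_lift[OF H_module H_module delta_closed[OF h'] HH_module P
            tensor_lift_linear[OF H_module H_module P F]];
          intro lift_delta_cong[OF h'] tensor_lift_pure[OF H_module H_module P F] closed_rules ab;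
          assumption)
  qed
next
  show "tensor_lift R (H \<boxtimes> H) (\<Delta> h') (\<lambda>a' b'. pure R H H (a \<cdot> a') (b \<cdot> b')) \<in> carrier (H \<boxtimes> H)"
    if "a \<in> carrier H" "b \<in> carrier H" for a b
    by (intro closed_rules h' that)
qed

end

section \<open>The invariant form \<sigma>\<close>

locale invariant_coquasitriangular = coquasitriangular_hom_bialgebra R H \<mu> \<Delta> \<alpha> \<sigma>
  for R (structure) and H :: "('k, 'h) module" and \<mu> \<Delta> \<alpha> \<sigma> +
  assumes sigma_invariant: "t \<in> carrier (H \<boxtimes> H) \<Longrightarrow> \<sigma> t = \<sigma> (tensor_map R H H \<alpha> \<alpha> t)"
begin

abbreviation sg :: "'h \<Rightarrow> 'h \<Rightarrow> 'k"
  where "sg x y \<equiv> \<sigma> (pure R H H x y)"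

lemma sg_alpha: "\<lbrakk>x \<in> carrier H; y \<in> carrier H\<rbrakk> \<Longrightarrow> sg (\<alpha> x) (\<alpha> y) = sg x y"
  by (simp add: sigma_invariant pure_closed H_module
      tensor_map_pure[OF H_module H_module H_module H_module alpha_linear alpha_linear])

lemma sg_closed_scalar:
  "\<lbrakk>x \<in> carrier H; y \<in> carrier H\<rbrakk> \<Longrightarrow> sg x y \<in> carrier (scalar_module R)"
  by (intro linear_maps_closed[OF sigma_linear] pure_closed H_module)

lemma sg_closed: "\<lbrakk>x \<in> carrier H; y \<in> carrier H\<rbrakk> \<Longrightarrow> sg x y \<in> carrier R"
  using sg_closed_scalar by (simp add: scalar_module_def)

lemma linear_sg_left:
  "\<lbrakk>f \<in> linear_maps R X H; y \<in> carrier H\<rbrakk> \<Longrightarrow> (\<lambda>x. sg (f x) y) \<in> linear_maps R X (scalar_module R)"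
  by (rule linear_maps_compose[OF linear_maps_compose[OF sigma_linear
      pure_linear_left[OF H_module H_module]]])

lemma linear_sg_right:
  "\<lbrakk>f \<in> linear_maps R X H; y \<in> carrier H\<rbrakk> \<Longrightarrow> (\<lambda>x. sg y (f x)) \<in> linear_maps R X (scalar_module R)"
  by (rule linear_maps_compose[OF linear_maps_compose[OF sigma_linear
      pure_linear_right[OF H_module H_module]]])

lemmas sg_closed_rules = closed_rules sg_closed
lemmas sg_linear_rules = linear_rules linear_sg_left linear_sg_right

text \<open>Scaling \<open>v\<close> is linear from the scalars to \<open>P\<close> and carries the
  scalar Sweedler sum of the axiom into \<open>P\<close>. The product of the two scalars is split
  into nested multiples, the shape in which the actions produce them.\<close>

lemma sg_mult_left_smult:
  assumes x: "x \<in> carrier H" and y: "y \<in> carrier H" and z: "z \<in> carrier H"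
    and P: "module R P" and v: "v \<in> carrier P"
  shows "sg (x \<cdot> y) (\<alpha> z) \<odot>\<^bsub>P\<^esub> v =
    tensor_lift R P (\<Delta> z) (\<lambda>z\<^sub>1 z\<^sub>2. sg (\<alpha> x) z\<^sub>1 \<odot>\<^bsub>P\<^esub> (sg (\<alpha> y) z\<^sub>2 \<odot>\<^bsub>P\<^esub> v))"
proof -
  interpret P: module R P by fact
  have "sg (x \<cdot> y) (\<alpha> z) \<odot>\<^bsub>P\<^esub> v =
    tensor_lift R P (\<Delta> z) (\<lambda>z\<^sub>1 z\<^sub>2. (sg (\<alpha> x) z\<^sub>1 \<otimes> sg (\<alpha> y) z\<^sub>2) \<odot>\<^bsub>P\<^esub> v)"
    unfolding sigma_mult_left[OF x y z]
    by (rule linear_maps_tensor_lift[OF H_module H_module delta_closed[OF z] module_scalar_module P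
          linear_maps_smult_left[OF P linear_maps_id v]])
      (simp add: scalar_module_def sg_closed alpha_closed x y)
  also have "\<dots> = tensor_lift R P (\<Delta> z) (\<lambda>z\<^sub>1 z\<^sub>2. sg (\<alpha> x) z\<^sub>1 \<odot>\<^bsub>P\<^esub> (sg (\<alpha> y) z\<^sub>2 \<odot>\<^bsub>P\<^esub> v))"
    by (rule lift_delta_cong[OF z], rule P.smult_assoc1) (intro sg_closed_rules x y v; assumption)+
  finally show ?thesis .
qed

lemma sg_mult_right_smult:
  assumes x: "x \<in> carrier H" and y: "y \<in> carrier H" and z: "z \<in> carrier H"
    and P: "module R P" and v: "v \<in> carrier P"
  shows "sg (\<alpha> x) (y \<cdot> z) \<odot>\<^bsub>P\<^esub> v =
    tensor_lift R P (\<Delta> x) (\<lambda>x\<^sub>1 x\<^sub>2. sg x\<^sub>1 (\<alpha> z) \<odot>\<^bsub>P\<^esub> (sg x\<^sub>2 (\<alpha> y) \<odot>\<^bsub>P\<^esub> v))"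
proof -
  interpret P: module R P by fact
  have "sg (\<alpha> x) (y \<cdot> z) \<odot>\<^bsub>P\<^esub> v =
    tensor_lift R P (\<Delta> x) (\<lambda>x\<^sub>1 x\<^sub>2. (sg x\<^sub>1 (\<alpha> z) \<otimes> sg x\<^sub>2 (\<alpha> y)) \<odot>\<^bsub>P\<^esub> v)"
    unfolding sigma_mult_right[OF x y z]
    by (rule linear_maps_tensor_lift[OF H_module H_module delta_closed[OF x] module_scalar_module P
          linear_maps_smult_left[OF P linear_maps_id v]])
      (simp add: scalar_module_def sg_closed alpha_closed y z)
  also have "\<dots> = tensor_lift R P (\<Delta> x) (\<lambda>x\<^sub>1 x\<^sub>2. sg x\<^sub>1 (\<alpha> z) \<odot>\<^bsub>P\<^esub> (sg x\<^sub>2 (\<alpha> y) \<odot>\<^bsub>P\<^esub> v))"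
    by (rule lift_delta_cong[OF x], rule P.smult_assoc1) (intro sg_closed_rules y z v; assumption)+
  finally show ?thesis .
qed

text \<open>The exchange axiom takes values in \<open>H\<close>; the Yetter-Drinfeld condition needs
  it in H \<otimes> M. There \<open>g\<close> will be the map that tensors with a fixed vector of
  \<open>M\<close>.\<close>

lemma sg_commute_linear:
  assumes x: "x \<in> carrier H" and y: "y \<in> carrier H" and P: "module R P"
    and g: "g \<in> linear_maps R H P"
  shows "tensor_lift R P (\<Delta> x) (\<lambda>x\<^sub>1 x\<^sub>2. tensor_lift R P (\<Delta> y) (\<lambda>y\<^sub>1 y\<^sub>2.
      sg x\<^sub>2 y\<^sub>2 \<odot>\<^bsub>P\<^esub> g (y\<^sub>1 \<cdot> x\<^sub>1))) =
    tensor_lift R P (\<Delta> x) (\<lambda>x\<^sub>1 x\<^sub>2. tensor_lift R P (\<Delta> y) (\<lambda>y\<^sub>1 y\<^sub>2.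
      sg x\<^sub>1 y\<^sub>1 \<odot>\<^bsub>P\<^esub> g (x\<^sub>2 \<cdot> y\<^sub>2)))"
proof -
  \<comment> \<open>Stated for arbitrary scalars \<open>c\<close> and vectors \<open>k\<close> so
    that one argument serves both sides of the axiom.\<close>
  have *: "g (tensor_lift R H (\<Delta> x) (\<lambda>x\<^sub>1 x\<^sub>2. tensor_lift R H (\<Delta> y) (\<lambda>y\<^sub>1 y\<^sub>2.
      c x\<^sub>1 x\<^sub>2 y\<^sub>1 y\<^sub>2 \<odot>\<^bsub>H\<^esub> k x\<^sub>1 x\<^sub>2 y\<^sub>1 y\<^sub>2))) =
    tensor_lift R P (\<Delta> x) (\<lambda>x\<^sub>1 x\<^sub>2. tensor_lift R P (\<Delta> y) (\<lambda>y\<^sub>1 y\<^sub>2.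
      c x\<^sub>1 x\<^sub>2 y\<^sub>1 y\<^sub>2 \<odot>\<^bsub>P\<^esub> g (k x\<^sub>1 x\<^sub>2 y\<^sub>1 y\<^sub>2)))"
    if c: "\<And>x\<^sub>1 x\<^sub>2 y\<^sub>1 y\<^sub>2. \<lbrakk>x\<^sub>1 \<in> carrier H; x\<^sub>2 \<in> carrier H; y\<^sub>1 \<in> carrier H; y\<^sub>2 \<in> carrier H\<rbrakk>
        \<Longrightarrow> c x\<^sub>1 x\<^sub>2 y\<^sub>1 y\<^sub>2 \<in> carrier R"
      and k: "\<And>x\<^sub>1 x\<^sub>2 y\<^sub>1 y\<^sub>2. \<lbrakk>x\<^sub>1 \<in> carrier H; x\<^sub>2 \<in> carrier H; y\<^sub>1 \<in> carrier H; y\<^sub>2 \<in> carrier H\<rbrakk>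
        \<Longrightarrow> k x\<^sub>1 x\<^sub>2 y\<^sub>1 y\<^sub>2 \<in> carrier H" for c k
    apply (subst linear_maps_tensor_lift[OF H_module H_module delta_closed[OF x] H_module P g])
     apply (intro lift_delta_closed y H_module H.smult_closed c k; assumption)
    apply (rule lift_delta_cong[OF x])
    apply (subst linear_maps_tensor_lift[OF H_module H_module delta_closed[OF y] H_module P g])
     apply (intro H.smult_closed c k; assumption)
    apply (rule lift_delta_cong[OF y])
    apply (intro linear_maps_smult[OF g] c k; assumption)
    done
  have "g (tensor_lift R H (\<Delta> x) (\<lambda>x\<^sub>1 x\<^sub>2. tensor_lift R H (\<Delta> y) (\<lambda>y\<^sub>1 y\<^sub>2.
      sg x\<^sub>2 y\<^sub>2 \<odot>\<^bsub>H\<^esub> (y\<^sub>1 \<cdot> x\<^sub>1)))) = g (tensor_lift R H (\<Delta> x) (\<lambda>x\<^sub>1 x\<^sub>2. tensor_lift R H (\<Delta> y) (\<lambda>y\<^sub>1 y\<^sub>2.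
      sg x\<^sub>1 y\<^sub>1 \<odot>\<^bsub>H\<^esub> (x\<^sub>2 \<cdot> y\<^sub>2))))"
    using sigma_commute[OF x y] by (rule arg_cong)
  then show ?thesis
    by (subst (asm) (1 2) *) (intro sg_closed_rules; assumption)+
qed

end

section \<open>The induced action of a single comodule\<close>

locale invariant_comodule =
  invariant_coquasitriangular R H \<mu> \<Delta> \<alpha> \<sigma> + hom_comodule R H \<mu> \<Delta> \<alpha> M \<alpha>\<^sub>M \<rho>
  for R (structure) and H :: "('k, 'h) module" and \<mu> \<Delta> \<alpha> \<sigma>
    and M :: "('k, 'm) module" and \<alpha>\<^sub>M \<rho>
begin

lemma M_module: "module R M" by (rule M.module_axioms)

lemmas coact_closed = linear_maps_closed[OF coact_linear]
lemmas alphaM_closed = linear_maps_closed[OF alphaM_linear]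
lemmas linear_alphaM = linear_maps_compose[OF alphaM_linear]

lemmas lift_coact_cong = tensor_lift_cong[OF H_module M_module coact_closed]
lemmas lift_coact_closed = tensor_lift_closed[OF H_module M_module coact_closed]
lemmas linear_lift_coact_param = tensor_lift_linear_param[OF H_module M_module coact_closed]
lemmas linear_maps_lift_coact = linear_maps_tensor_lift[OF H_module M_module coact_closed]
lemmas smult_lift_coact = smult_tensor_lift[OF H_module M_module coact_closed]

lemma linear_lift_coact:
  "\<lbrakk>f \<in> linear_maps R X M; module R P; F \<in> bilinear_maps R H M P\<rbrakk>
    \<Longrightarrow> (\<lambda>x. tensor_lift R P (\<rho> (f x)) F) \<in> linear_maps R X P"
  by (rule linear_maps_compose[OF linear_maps_compose[OF tensor_lift_linear[OF H_module M_module]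
      coact_linear]])

lemmas comodule_closed_rules =
  sg_closed_rules M_module alphaM_closed coact_closed lift_coact_closed M.smult_closed

lemmas comodule_linear_rules =
  sg_linear_rules linear_alphaM linear_lift_coact linear_lift_coact_param

lemma lift_coact_alpha:
  assumes "m \<in> carrier M" "module R P" "F \<in> bilinear_maps R H M P"
  shows "tensor_lift R P (\<rho> (\<alpha>\<^sub>M m)) F = tensor_lift R P (\<rho> m) (\<lambda>u v. F (\<alpha> u) (\<alpha>\<^sub>M v))"
  unfolding coact_alpha[OF assms(1), symmetric]
  by (rule tensor_lift_tensor_map[OF H_module M_module H_module M_module alpha_linear alphaM_linear
        coact_closed[OF assms(1)] assms(2,3)])

text \<open>Coassociativity of the coaction tested on a trilinear \<open>F\<close>. Replacing the
  second coaction by \<Delta> moves the twist from the first leg to the last, where it becomes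
  \<open>\<alpha>\<^sub>M\<close>.\<close>

lemma lift_coact_coact:
  assumes "m \<in> carrier M" "module R P"
    and "\<And>b c. \<lbrakk>b \<in> carrier H; c \<in> carrier M\<rbrakk> \<Longrightarrow> (\<lambda>a. F a b c) \<in> linear_maps R H P"
      "\<And>a c. \<lbrakk>a \<in> carrier H; c \<in> carrier M\<rbrakk> \<Longrightarrow> (\<lambda>b. F a b c) \<in> linear_maps R H P"
      "\<And>a b. \<lbrakk>a \<in> carrier H; b \<in> carrier H\<rbrakk> \<Longrightarrow> (\<lambda>c. F a b c) \<in> linear_maps R M P"
  shows "tensor_lift R P (\<rho> m) (\<lambda>u v. tensor_lift R P (\<rho> v) (\<lambda>b c. F (\<alpha> u) b c)) =
    tensor_lift R P (\<rho> m) (\<lambda>u v. tensor_lift R P (\<Delta> u) (\<lambda>a b. F a b (\<alpha>\<^sub>M v)))"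
  by (rule tensor_assoc_trilinear[OF H_module H_module M_module H_module M_module delta_linear
        alphaM_linear alpha_linear coact_linear coact_closed[OF assms(1)] coact_coact[OF assms(1)]
        assms(2-5), symmetric])

abbreviation iact :: "('h \<times> 'm \<Rightarrow> 'k) set \<Rightarrow> 'm"
  where "iact \<equiv> induced_action R H \<alpha> \<sigma> M \<rho>"

lemma induced_action_bilinear:
  "(\<lambda>h m. tensor_lift R M (\<rho> m) (\<lambda>u v. sg u (\<alpha> h) \<odot>\<^bsub>M\<^esub> v)) \<in> bilinear_maps R H M M"
  by (rule comodule_linear_rules comodule_closed_rules | assumption)+

lemma induced_action_linear: "iact \<in> linear_maps R (H \<boxtimes> M) M"
  unfolding induced_action_def
  by (rule tensor_lift_linear[OF H_module M_module M_module induced_action_bilinear])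

lemma induced_action_pure:
  "\<lbrakk>h \<in> carrier H; m \<in> carrier M\<rbrakk>
    \<Longrightarrow> iact (pure R H M h m) = tensor_lift R M (\<rho> m) (\<lambda>u v. sg u (\<alpha> h) \<odot>\<^bsub>M\<^esub> v)"
  unfolding induced_action_def
  by (rule tensor_lift_pure[OF H_module M_module M_module induced_action_bilinear])

text \<open>Anything linear can be evaluated at h \<cdot> m by scaling its values at the component
  of m in \<open>M\<close>. It is used with \<open>g\<close> a second action, the twist of
  \<open>M\<close>, a lift along the coaction, and tensoring with a fixed vector.\<close>

lemma linear_maps_induced_action:
  assumes h: "h \<in> carrier H" and m: "m \<in> carrier M" and P: "module R P"
      and g: "g \<in> linear_maps R M P"
  shows "g (iact (pure R H M h m)) = tensor_lift R P (\<rho> m) (\<lambda>u v. sg u (\<alpha> h) \<odot>\<^bsub>P\<^esub> g v)"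
  unfolding induced_action_pure[OF h m]
  apply (subst linear_maps_lift_coact[OF m M_module P g])
   apply (rule comodule_closed_rules h | assumption)+
  apply (rule lift_coact_cong[OF m])
  apply (rule linear_maps_smult[OF g])
   apply (rule comodule_closed_rules h | assumption)+
  done

text \<open>The coaction commutes with the twists, so both arguments of \<sigma> acquire an
  \<alpha>, and invariance removes the pair.\<close>

lemma induced_action_alpha:
  assumes h: "h \<in> carrier H" and m: "m \<in> carrier M"
  shows "\<alpha>\<^sub>M (iact (pure R H M h m)) = iact (pure R H M (\<alpha> h) (\<alpha>\<^sub>M m))"
proof -
  have "iact (pure R H M (\<alpha> h) (\<alpha>\<^sub>M m)) =
    tensor_lift R M (\<rho> m) (\<lambda>u v. sg (\<alpha> u) (\<alpha> (\<alpha> h)) \<odot>\<^bsub>M\<^esub> \<alpha>\<^sub>M v)"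
    unfolding induced_action_pure[OF alpha_closed[OF h] alphaM_closed[OF m]]
    by (rule lift_coact_alpha[OF m M_module])
      (rule comodule_linear_rules comodule_closed_rules h | assumption)+
  also have "\<dots> = tensor_lift R M (\<rho> m) (\<lambda>u v. sg u (\<alpha> h) \<odot>\<^bsub>M\<^esub> \<alpha>\<^sub>M v)"
    by (rule lift_coact_cong[OF m]) (simp add: sg_alpha alpha_closed h)
  finally show ?thesis
    by (simp only: linear_maps_induced_action[OF h m M_module alphaM_linear])
qed

text \<open>Acting twice with the coaction is the situation of coassociativity, once \<open>\<sigma>\<close>-invariance
  has supplied the missing \<open>\<alpha>\<close>.\<close>

lemma lift_coact_sg_coact:
  assumes m: "m \<in> carrier M" and h: "h \<in> carrier H" and P: "module R P"
    and F: "\<And>u. u \<in> carrier H \<Longrightarrow> (\<lambda>v. F u v) \<in> linear_maps R M P"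
      "\<And>v. v \<in> carrier M \<Longrightarrow> (\<lambda>u. F u v) \<in> linear_maps R H P"
  shows "tensor_lift R P (\<rho> m) (\<lambda>u v. sg u h \<odot>\<^bsub>P\<^esub> tensor_lift R P (\<rho> v) F) =
    tensor_lift R P (\<rho> m) (\<lambda>u v. tensor_lift R P (\<Delta> u) (\<lambda>a b. sg a (\<alpha> h) \<odot>\<^bsub>P\<^esub> F b (\<alpha>\<^sub>M v)))"
proof -
  interpret P: module R P by (rule P)
  note Fc = linear_maps_closed[OF F(1)]
  have "tensor_lift R P (\<rho> m) (\<lambda>u v. sg u h \<odot>\<^bsub>P\<^esub> tensor_lift R P (\<rho> v) F) =
    tensor_lift R P (\<rho> m) (\<lambda>u v. tensor_lift R P (\<rho> v) (\<lambda>b c. sg (\<alpha> u) (\<alpha> h) \<odot>\<^bsub>P\<^esub> F b c))"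
    apply (rule lift_coact_cong[OF m])
    apply (subst sg_alpha, assumption, rule h)
    apply (rule smult_lift_coact[OF _ P])
      apply (rule comodule_closed_rules h Fc | assumption)+
    done
  also have "\<dots> = tensor_lift R P (\<rho> m) (\<lambda>u v. tensor_lift R P (\<Delta> u) (\<lambda>a b.
      sg a (\<alpha> h) \<odot>\<^bsub>P\<^esub> F b (\<alpha>\<^sub>M v)))"
    by (rule lift_coact_coact[OF m P])
      (rule comodule_linear_rules comodule_closed_rules F Fc P h | assumption)+
  finally show ?thesis .
qed

lemma induced_action_act:
  assumes h: "h \<in> carrier H" and h': "h' \<in> carrier H" and m: "m \<in> carrier M"
  shows "iact (pure R H M (\<alpha> h) (iact (pure R H M h' m))) = iact (pure R H M (h \<cdot> h') (\<alpha>\<^sub>M m))"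
proof -
  have lin: "(\<lambda>m. iact (pure R H M (\<alpha> h) m)) \<in> linear_maps R M M"
    by (rule linear_maps_compose[OF induced_action_linear pure_linear_right])
      (rule comodule_closed_rules h)+
  have "iact (pure R H M (\<alpha> h) (iact (pure R H M h' m))) =
    tensor_lift R M (\<rho> m) (\<lambda>u v. sg u (\<alpha> h') \<odot>\<^bsub>M\<^esub> iact (pure R H M (\<alpha> h) v))"
    by (rule linear_maps_induced_action[OF h' m M_module lin])
  also have "\<dots> = tensor_lift R M (\<rho> m) (\<lambda>u v. sg u (\<alpha> h') \<odot>\<^bsub>M\<^esub>
      tensor_lift R M (\<rho> v) (\<lambda>b c. sg b (\<alpha> (\<alpha> h)) \<odot>\<^bsub>M\<^esub> c))"
    by (rule lift_coact_cong[OF m]) (simp only: induced_action_pure alpha_closed h)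
  also have "\<dots> = tensor_lift R M (\<rho> m) (\<lambda>u v. tensor_lift R M (\<Delta> u) (\<lambda>a b.
      sg a (\<alpha> (\<alpha> h')) \<odot>\<^bsub>M\<^esub> (sg b (\<alpha> (\<alpha> h)) \<odot>\<^bsub>M\<^esub> \<alpha>\<^sub>M v)))"
    by (rule lift_coact_sg_coact[OF m _ M_module])
      (rule comodule_linear_rules comodule_closed_rules h h' | assumption)+
  \<comment> \<open>The right multiplication axiom with \<open>\<alpha> h\<close> and
    \<open>\<alpha> h'\<close> as its two factors. It pairs the second factor with the first
    component; this reversal matches the inner action by \<open>h'\<close>, whose \<sigma> sits on
    the first leg.\<close>
  also have "\<dots> = tensor_lift R M (\<rho> m) (\<lambda>u v. sg (\<alpha> u) (\<alpha> (h \<cdot> h')) \<odot>\<^bsub>M\<^esub> \<alpha>\<^sub>M v)"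
    apply (rule lift_coact_cong[OF m])
    apply (subst alpha_mult[OF h h'])
    apply (rule sg_mult_right_smult[symmetric])
        apply (rule comodule_closed_rules h h' | assumption)+
    done
  also have "\<dots> = iact (pure R H M (h \<cdot> h') (\<alpha>\<^sub>M m))"
    unfolding induced_action_pure[OF mult_closed[OF h h'] alphaM_closed[OF m]]
    by (rule lift_coact_alpha[OF m M_module, symmetric])
      (rule comodule_linear_rules comodule_closed_rules h h' | assumption)+
  finally show ?thesis .
qed

lemma lift_delta_coact_swap:
  assumes h: "h \<in> carrier H" and m: "m \<in> carrier M" and P: "module R P"
    and f: "\<And>a b u v. \<lbrakk>a \<in> carrier H; b \<in> carrier H; u \<in> carrier H; v \<in> carrier M\<rbrakk>
      \<Longrightarrow> f a b u v \<in> carrier P"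
  shows "tensor_lift R P (\<Delta> h) (\<lambda>a b. tensor_lift R P (\<rho> m) (f a b)) =
    tensor_lift R P (\<rho> m) (\<lambda>u v. tensor_lift R P (\<Delta> h) (\<lambda>a b. f a b u v))"
  by (rule tensor_lift_swap[OF H_module H_module delta_closed[OF h] H_module M_module
        coact_closed[OF m] P f])

lemma lift_delta_delta_swap:
  assumes h: "h \<in> carrier H" and x: "x \<in> carrier H" and P: "module R P"
    and f: "\<And>a b u v. \<lbrakk>a \<in> carrier H; b \<in> carrier H; u \<in> carrier H; v \<in> carrier H\<rbrakk>
      \<Longrightarrow> f a b u v \<in> carrier P"
  shows "tensor_lift R P (\<Delta> h) (\<lambda>a b. tensor_lift R P (\<Delta> x) (f a b)) =
    tensor_lift R P (\<Delta> x) (\<lambda>u v. tensor_lift R P (\<Delta> h) (\<lambda>a b. f a b u v))"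
  by (rule tensor_lift_swap[OF H_module H_module delta_closed[OF h] H_module H_module
        delta_closed[OF x] P f])

text \<open>A normal form for both sides of the Yetter-Drinfeld condition. The sum over
  \<open>\<Delta> h\<close> becomes innermost, and the two twists on each of its components are
  absorbed into \<open>\<Delta> (\<alpha> (\<alpha> h))\<close>, so that
  \<open>sg_commute_linear\<close> can be applied.\<close>

lemma lift_delta_coact_delta:
  assumes h: "h \<in> carrier H" and m: "m \<in> carrier M" and P: "module R P"
    and F: "\<And>a b v. \<lbrakk>a \<in> carrier H; b \<in> carrier H; v \<in> carrier M\<rbrakk>
      \<Longrightarrow> (\<lambda>x y. F x y a b v) \<in> bilinear_maps R H H P"
  shows "tensor_lift R P (\<Delta> h) (\<lambda>h\<^sub>1 h\<^sub>2. tensor_lift R P (\<rho> m) (\<lambda>u v.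
      tensor_lift R P (\<Delta> u) (\<lambda>a b. F (\<alpha> (\<alpha> h\<^sub>1)) (\<alpha> (\<alpha> h\<^sub>2)) a b (\<alpha>\<^sub>M v)))) =
    tensor_lift R P (\<rho> m) (\<lambda>u v. tensor_lift R P (\<Delta> u) (\<lambda>a b.
      tensor_lift R P (\<Delta> (\<alpha> (\<alpha> h))) (\<lambda>x y. F x y a b (\<alpha>\<^sub>M v))))"
proof -
  note Fc = bilinear_maps_closed[OF F]
  note bil = bilinear_maps_compose[OF H_module H_module H_module H_module alpha_linear
      alpha_linear F]
  have "tensor_lift R P (\<Delta> h) (\<lambda>h\<^sub>1 h\<^sub>2. tensor_lift R P (\<rho> m) (\<lambda>u v.
      tensor_lift R P (\<Delta> u) (\<lambda>a b. F (\<alpha> (\<alpha> h\<^sub>1)) (\<alpha> (\<alpha> h\<^sub>2)) a b (\<alpha>\<^sub>M v)))) =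
    tensor_lift R P (\<rho> m) (\<lambda>u v. tensor_lift R P (\<Delta> h) (\<lambda>h\<^sub>1 h\<^sub>2.
      tensor_lift R P (\<Delta> u) (\<lambda>a b. F (\<alpha> (\<alpha> h\<^sub>1)) (\<alpha> (\<alpha> h\<^sub>2)) a b (\<alpha>\<^sub>M v))))"
    by (rule lift_delta_coact_swap[OF h m P]) (rule comodule_closed_rules Fc P | assumption)+
  also have "\<dots> = tensor_lift R P (\<rho> m) (\<lambda>u v. tensor_lift R P (\<Delta> u) (\<lambda>a b.
      tensor_lift R P (\<Delta> (\<alpha> (\<alpha> h))) (\<lambda>x y. F x y a b (\<alpha>\<^sub>M v))))"
    apply (rule lift_coact_cong[OF m])
    apply (subst lift_delta_delta_swap[OF h _ P], assumption)
     apply (rule comodule_closed_rules Fc P | assumption)+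
    apply (rule lift_delta_cong, assumption)
    apply (subst lift_delta_alpha[OF alpha_closed[OF h] P F], (rule alphaM_closed | assumption)+)
    apply (rule lift_delta_alpha[OF h P bil, symmetric], (rule alphaM_closed | assumption)+)
    done
  finally show ?thesis .
qed

lemma induced_action_yetter_drinfeld:
  assumes h: "h \<in> carrier H" and m: "m \<in> carrier M"
  shows "tensor_lift R (H \<boxtimes> M) (\<Delta> h) (\<lambda>h\<^sub>1 h\<^sub>2.
      tensor_lift R (H \<boxtimes> M) (\<rho> (iact (pure R H M h\<^sub>1 m))) (\<lambda>u v. pure R H M (u \<cdot> \<alpha> (\<alpha> h\<^sub>2)) v)) =
    tensor_lift R (H \<boxtimes> M) (\<Delta> h) (\<lambda>h\<^sub>1 h\<^sub>2.
      tensor_lift R (H \<boxtimes> M) (\<rho> m) (\<lambda>u v.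
        pure R H M (\<alpha> (\<alpha> h\<^sub>1) \<cdot> \<alpha> u) (iact (pure R H M (\<alpha> h\<^sub>2) v))))" (is "?L = ?R")
proof -
  let ?P = "H \<boxtimes> M"
  note P = module_tensor[OF H_module M_module]
  note closed = comodule_closed_rules P module.smult_closed[OF P]
  \<comment> \<open>Coassociativity raises the twist on \<open>h\<^sub>1\<close> from one \<alpha>
    to two, which \<open>h\<^sub>2\<close> carries already. Equal twists on both components are what
    the normal form requires.\<close>
  have "?L = tensor_lift R ?P (\<Delta> h) (\<lambda>h\<^sub>1 h\<^sub>2. tensor_lift R ?P (\<rho> m) (\<lambda>u v.
      tensor_lift R ?P (\<Delta> u) (\<lambda>a b. sg a (\<alpha> (\<alpha> h\<^sub>1)) \<odot>\<^bsub>?P\<^esub> pure R H M (b \<cdot> \<alpha> (\<alpha> h\<^sub>2)) (\<alpha>\<^sub>M v))))"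
  proof (rule lift_delta_cong[OF h])
    fix h\<^sub>1 h\<^sub>2 assume h12: "h\<^sub>1 \<in> carrier H" "h\<^sub>2 \<in> carrier H"
    have lin: "(\<lambda>m. tensor_lift R ?P (\<rho> m) (\<lambda>u v. pure R H M (u \<cdot> \<alpha> (\<alpha> h\<^sub>2)) v)) \<in>
        linear_maps R M ?P"
      by (rule comodule_linear_rules closed h12 | assumption)+
    have "tensor_lift R ?P (\<rho> (iact (pure R H M h\<^sub>1 m))) (\<lambda>u v. pure R H M (u \<cdot> \<alpha> (\<alpha> h\<^sub>2)) v) =
      tensor_lift R ?P (\<rho> m) (\<lambda>u v. sg u (\<alpha> h\<^sub>1) \<odot>\<^bsub>?P\<^esub>
        tensor_lift R ?P (\<rho> v) (\<lambda>u v. pure R H M (u \<cdot> \<alpha> (\<alpha> h\<^sub>2)) v))"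
      by (rule linear_maps_induced_action[OF h12(1) m P lin])
    also have "\<dots> = tensor_lift R ?P (\<rho> m) (\<lambda>u v. tensor_lift R ?P (\<Delta> u) (\<lambda>a b.
        sg a (\<alpha> (\<alpha> h\<^sub>1)) \<odot>\<^bsub>?P\<^esub> pure R H M (b \<cdot> \<alpha> (\<alpha> h\<^sub>2)) (\<alpha>\<^sub>M v)))"
      by (rule lift_coact_sg_coact[OF m _ P]) (rule comodule_linear_rules closed h12 | assumption)+
    finally show "tensor_lift R ?P (\<rho> (iact (pure R H M h\<^sub>1 m)))
        (\<lambda>u v. pure R H M (u \<cdot> \<alpha> (\<alpha> h\<^sub>2)) v) =
      tensor_lift R ?P (\<rho> m) (\<lambda>u v. tensor_lift R ?P (\<Delta> u) (\<lambda>a b.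
        sg a (\<alpha> (\<alpha> h\<^sub>1)) \<odot>\<^bsub>?P\<^esub> pure R H M (b \<cdot> \<alpha> (\<alpha> h\<^sub>2)) (\<alpha>\<^sub>M v)))" .
  qed
  also have "\<dots> = tensor_lift R ?P (\<rho> m) (\<lambda>u v. tensor_lift R ?P (\<Delta> u) (\<lambda>a b.
      tensor_lift R ?P (\<Delta> (\<alpha> (\<alpha> h))) (\<lambda>x y. sg a x \<odot>\<^bsub>?P\<^esub> pure R H M (b \<cdot> y) (\<alpha>\<^sub>M v))))"
    by (rule lift_delta_coact_delta[OF h m P]) (rule comodule_linear_rules closed | assumption)+
  \<comment> \<open>The exchange axiom, read from right to left, with \<open>g\<close> tensoring by
    \<open>\<alpha>\<^sub>M v\<close>.\<close>
  also have "\<dots> = tensor_lift R ?P (\<rho> m) (\<lambda>u v. tensor_lift R ?P (\<Delta> u) (\<lambda>a b.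
      tensor_lift R ?P (\<Delta> (\<alpha> (\<alpha> h))) (\<lambda>x y. sg b y \<odot>\<^bsub>?P\<^esub> pure R H M (x \<cdot> a) (\<alpha>\<^sub>M v))))"
    by (rule lift_coact_cong[OF m], rule sg_commute_linear[symmetric])
      (rule pure_linear_left closed h | assumption)+
  also have "\<dots> = tensor_lift R ?P (\<Delta> h) (\<lambda>h\<^sub>1 h\<^sub>2. tensor_lift R ?P (\<rho> m) (\<lambda>u v.
      tensor_lift R ?P (\<Delta> u) (\<lambda>a b. sg b (\<alpha> (\<alpha> h\<^sub>2)) \<odot>\<^bsub>?P\<^esub> pure R H M (\<alpha> (\<alpha> h\<^sub>1) \<cdot> a) (\<alpha>\<^sub>M v))))"
    by (rule lift_delta_coact_delta[OF h m P, symmetric])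
        (rule comodule_linear_rules closed | assumption)+
  also have "\<dots> = ?R"
  proof (rule lift_delta_cong[OF h])
    fix h\<^sub>1 h\<^sub>2 assume h12: "h\<^sub>1 \<in> carrier H" "h\<^sub>2 \<in> carrier H"
    \<comment> \<open>On this side the Yetter-Drinfeld condition itself provides the
      \<open>\<alpha> u\<close> that coassociativity consumes.\<close>
    have "tensor_lift R ?P (\<rho> m) (\<lambda>u v. pure R H M (\<alpha> (\<alpha> h\<^sub>1) \<cdot> \<alpha> u) (iact (pure R H M (\<alpha> h\<^sub>2) v))) =
      tensor_lift R ?P (\<rho> m) (\<lambda>u v. tensor_lift R ?P (\<rho> v) (\<lambda>b c.
        sg b (\<alpha> (\<alpha> h\<^sub>2)) \<odot>\<^bsub>?P\<^esub> pure R H M (\<alpha> (\<alpha> h\<^sub>1) \<cdot> \<alpha> u) c))"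
      apply (rule lift_coact_cong[OF m])
      apply (rule linear_maps_induced_action[OF _ _ P pure_linear_right])
          apply (rule closed h12 | assumption)+
      done
    also have "\<dots> = tensor_lift R ?P (\<rho> m) (\<lambda>u v. tensor_lift R ?P (\<Delta> u) (\<lambda>a b.
        sg b (\<alpha> (\<alpha> h\<^sub>2)) \<odot>\<^bsub>?P\<^esub> pure R H M (\<alpha> (\<alpha> h\<^sub>1) \<cdot> a) (\<alpha>\<^sub>M v)))"
      by (rule lift_coact_coact[OF m P]) (rule comodule_linear_rules closed h12 | assumption)+
    finally show "tensor_lift R ?P (\<rho> m) (\<lambda>u v. tensor_lift R ?P (\<Delta> u) (\<lambda>a b.
        sg b (\<alpha> (\<alpha> h\<^sub>2)) \<odot>\<^bsub>?P\<^esub> pure R H M (\<alpha> (\<alpha> h\<^sub>1) \<cdot> a) (\<alpha>\<^sub>M v))) =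
      tensor_lift R ?P (\<rho> m) (\<lambda>u v. pure R H M (\<alpha> (\<alpha> h\<^sub>1) \<cdot> \<alpha> u) (iact (pure R H M (\<alpha> h\<^sub>2) v)))" ..
  qed
  finally show ?thesis .
qed

lemma yetter_drinfeld_induced_action: "yetter_drinfeld R H \<mu> \<Delta> \<alpha> M \<alpha>\<^sub>M iact \<rho>"
  by (intro yetter_drinfeld.intro hom_module.intro hom_module_axioms.intro
      yetter_drinfeld_axioms.intro hom_bialgebra_axioms M_module hom_comodule_axioms
      alphaM_linear induced_action_linear induced_action_alpha induced_action_act
      induced_action_yetter_drinfeld)

end

section \<open>The tensor product of two comodules\<close>

locale invariant_comodule_pair =
  invariant_coquasitriangular R H \<mu> \<Delta> \<alpha> \<sigma> +
  M: invariant_comodule R H \<mu> \<Delta> \<alpha> \<sigma> M \<alpha>\<^sub>M \<rho>\<^sub>M + N: invariant_comodule R H \<mu> \<Delta> \<alpha> \<sigma> N \<alpha>\<^sub>N \<rho>\<^sub>N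
  for R (structure) and H :: "('k, 'h) module" and \<mu> \<Delta> \<alpha> \<sigma>
    and M :: "('k, 'm) module" and \<alpha>\<^sub>M \<rho>\<^sub>M and N :: "('k, 'n) module" and \<alpha>\<^sub>N \<rho>\<^sub>N
begin

abbreviation \<alpha>\<^sub>M\<^sub>N where "\<alpha>\<^sub>M\<^sub>N \<equiv> tensor_map R M N \<alpha>\<^sub>M \<alpha>\<^sub>N"
abbreviation \<rho>\<^sub>M\<^sub>N where "\<rho>\<^sub>M\<^sub>N \<equiv> tensor_coaction R H \<mu> M \<rho>\<^sub>M N \<rho>\<^sub>N"

lemmas MN_module = module_tensor[OF M.M_module N.M_module]
lemmas HMN_module = module_tensor[OF H_module MN_module]
lemmas pair_closed_rules = M.comodule_closed_rules N.comodule_closed_rules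
lemmas pair_linear_rules = M.comodule_linear_rules N.comodule_linear_rules

lemmas alphaMN_linear = tensor_map_linear[OF M.M_module N.M_module M.M_module N.M_module
  M.alphaM_linear N.alphaM_linear]
lemmas alphaMN_pure = tensor_map_pure[OF M.M_module N.M_module M.M_module N.M_module
  M.alphaM_linear N.alphaM_linear]

lemma lift_coact_coact_swap:
  assumes m: "m \<in> carrier M" and n: "n \<in> carrier N" and P: "module R P"
    and f: "\<And>a b u v. \<lbrakk>a \<in> carrier H; b \<in> carrier M; u \<in> carrier H; v \<in> carrier N\<rbrakk>
      \<Longrightarrow> f a b u v \<in> carrier P"
  shows "tensor_lift R P (\<rho>\<^sub>M m) (\<lambda>a b. tensor_lift R P (\<rho>\<^sub>N n) (f a b)) =
    tensor_lift R P (\<rho>\<^sub>N n) (\<lambda>u v. tensor_lift R P (\<rho>\<^sub>M m) (\<lambda>a b. f a b u v))"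
  by (rule tensor_lift_swap[OF H_module M.M_module M.coact_closed[OF m] H_module N.M_module
        N.coact_closed[OF n] P f])

lemma tensor_coaction_bilinear:
  "(\<lambda>m n. tensor_lift R (H \<boxtimes> M \<boxtimes> N) (\<rho>\<^sub>M m) (\<lambda>u m\<^sub>0. tensor_lift R (H \<boxtimes> M \<boxtimes> N) (\<rho>\<^sub>N n) (\<lambda>v n\<^sub>0.
      pure R H (M \<boxtimes> N) (u \<cdot> v) (pure R M N m\<^sub>0 n\<^sub>0)))) \<in> bilinear_maps R M N (H \<boxtimes> M \<boxtimes> N)"
  by (rule pair_linear_rules pair_closed_rules | assumption)+

lemma tensor_coaction_linear: "\<rho>\<^sub>M\<^sub>N \<in> linear_maps R (M \<boxtimes> N) (H \<boxtimes> M \<boxtimes> N)"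
  unfolding tensor_coaction_def
  by (rule tensor_lift_linear[OF M.M_module N.M_module HMN_module tensor_coaction_bilinear])

lemma tensor_coaction_pure:
  "\<lbrakk>m \<in> carrier M; n \<in> carrier N\<rbrakk> \<Longrightarrow> \<rho>\<^sub>M\<^sub>N (pure R M N m n) =
    tensor_lift R (H \<boxtimes> M \<boxtimes> N) (\<rho>\<^sub>M m) (\<lambda>u m\<^sub>0. tensor_lift R (H \<boxtimes> M \<boxtimes> N) (\<rho>\<^sub>N n) (\<lambda>v n\<^sub>0.
      pure R H (M \<boxtimes> N) (u \<cdot> v) (pure R M N m\<^sub>0 n\<^sub>0)))"
  unfolding tensor_coaction_def
  by (rule tensor_lift_pure[OF M.M_module N.M_module HMN_module tensor_coaction_bilinear])

text \<open>The working rule for the coaction of M \<otimes> N: on a pure tensor, one sum over H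
  \<otimes> (M \<otimes> N) becomes two sums along the separate coactions, which can be exchanged
  and rewritten one at a time.\<close>

lemma lift_tensor_coaction_pure:
  assumes m: "m \<in> carrier M" and n: "n \<in> carrier N" and P: "module R P"
    and F: "F \<in> bilinear_maps R H (M \<boxtimes> N) P"
  shows "tensor_lift R P (\<rho>\<^sub>M\<^sub>N (pure R M N m n)) F =
    tensor_lift R P (\<rho>\<^sub>M m) (\<lambda>u m\<^sub>0. tensor_lift R P (\<rho>\<^sub>N n) (\<lambda>v n\<^sub>0. F (u \<cdot> v) (pure R M N m\<^sub>0 n\<^sub>0)))"
proof -
  note lin = tensor_lift_linear[OF H_module MN_module P F]
  show ?thesis
    unfolding tensor_coaction_pure[OF m n]
    apply (subst M.linear_maps_lift_coact[OF m HMN_module P lin])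
     apply (rule pair_closed_rules m n | assumption)+
    apply (rule M.lift_coact_cong[OF m])
    apply (subst N.linear_maps_lift_coact[OF n HMN_module P lin])
     apply (rule pair_closed_rules | assumption)+
    apply (rule N.lift_coact_cong[OF n])
    apply (rule tensor_lift_pure[OF H_module MN_module P F])
     apply (rule pair_closed_rules | assumption)+
    done
qed

text \<open>On pure tensors \<alpha> splits over the product in \<open>H\<close>; each coaction then
  absorbs the twists on its own components, first that of \<open>N\<close> and then that of
  \<open>M\<close>.\<close>

lemma tensor_coaction_alpha:
  assumes t: "t \<in> carrier (M \<boxtimes> N)"
  shows "tensor_map R H (M \<boxtimes> N) \<alpha> \<alpha>\<^sub>M\<^sub>N (\<rho>\<^sub>M\<^sub>N t) = \<rho>\<^sub>M\<^sub>N (\<alpha>\<^sub>M\<^sub>N t)"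
proof (rule tensor_ext[OF M.M_module N.M_module HMN_module _ _ _ t])
  let ?P = "H \<boxtimes> M \<boxtimes> N"
  show "(\<lambda>t. tensor_map R H (M \<boxtimes> N) \<alpha> \<alpha>\<^sub>M\<^sub>N (\<rho>\<^sub>M\<^sub>N t)) \<in> linear_maps R (M \<boxtimes> N) ?P"
    by (rule linear_maps_compose[OF tensor_map_linear[OF H_module MN_module H_module MN_module
            alpha_linear alphaMN_linear] tensor_coaction_linear])
  show "(\<lambda>t. \<rho>\<^sub>M\<^sub>N (\<alpha>\<^sub>M\<^sub>N t)) \<in> linear_maps R (M \<boxtimes> N) ?P"
    by (rule linear_maps_compose[OF tensor_coaction_linear alphaMN_linear])
  fix m n assume m: "m \<in> carrier M" and n: "n \<in> carrier N"
  have "tensor_map R H (M \<boxtimes> N) \<alpha> \<alpha>\<^sub>M\<^sub>N (\<rho>\<^sub>M\<^sub>N (pure R M N m n)) =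
    tensor_lift R ?P (\<rho>\<^sub>M m) (\<lambda>u m\<^sub>0. tensor_lift R ?P (\<rho>\<^sub>N n) (\<lambda>v n\<^sub>0.
      pure R H (M \<boxtimes> N) (\<alpha> (u \<cdot> v)) (\<alpha>\<^sub>M\<^sub>N (pure R M N m\<^sub>0 n\<^sub>0))))"
    unfolding tensor_map_def[of R H]
    by (rule lift_tensor_coaction_pure[OF m n HMN_module
          bilinear_maps_compose[OF H_module MN_module H_module MN_module alpha_linear alphaMN_linear
            pure_bilinear[OF H_module MN_module]]])
  also have "\<dots> = tensor_lift R ?P (\<rho>\<^sub>M m) (\<lambda>u m\<^sub>0. tensor_lift R ?P (\<rho>\<^sub>N n) (\<lambda>v n\<^sub>0.
      pure R H (M \<boxtimes> N) (\<alpha> u \<cdot> \<alpha> v) (pure R M N (\<alpha>\<^sub>M m\<^sub>0) (\<alpha>\<^sub>N n\<^sub>0))))"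
    by (rule M.lift_coact_cong[OF m], rule N.lift_coact_cong[OF n])
        (simp only: alpha_mult alphaMN_pure)
  also have "\<dots> = tensor_lift R ?P (\<rho>\<^sub>M m) (\<lambda>u m\<^sub>0. tensor_lift R ?P (\<rho>\<^sub>N (\<alpha>\<^sub>N n)) (\<lambda>v n\<^sub>0.
      pure R H (M \<boxtimes> N) (\<alpha> u \<cdot> v) (pure R M N (\<alpha>\<^sub>M m\<^sub>0) n\<^sub>0)))"
    by (rule M.lift_coact_cong[OF m], rule N.lift_coact_alpha[OF n HMN_module, symmetric])
      (rule pair_linear_rules pair_closed_rules | assumption)+
  also have "\<dots> = tensor_lift R ?P (\<rho>\<^sub>M (\<alpha>\<^sub>M m)) (\<lambda>u m\<^sub>0. tensor_lift R ?P (\<rho>\<^sub>N (\<alpha>\<^sub>N n)) (\<lambda>v n\<^sub>0.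
      pure R H (M \<boxtimes> N) (u \<cdot> v) (pure R M N m\<^sub>0 n\<^sub>0)))"
    by (rule M.lift_coact_alpha[OF m HMN_module, symmetric])
      (rule pair_linear_rules pair_closed_rules n | assumption)+
  also have "\<dots> = \<rho>\<^sub>M\<^sub>N (\<alpha>\<^sub>M\<^sub>N (pure R M N m n))"
    by (simp only: alphaMN_pure[OF m n] tensor_coaction_pure[OF M.alphaM_closed[OF m]
        N.alphaM_closed[OF n]])
  finally show "tensor_map R H (M \<boxtimes> N) \<alpha> \<alpha>\<^sub>M\<^sub>N (\<rho>\<^sub>M\<^sub>N (pure R M N m n)) = \<rho>\<^sub>M\<^sub>N (\<alpha>\<^sub>M\<^sub>N (pure R M N m n))" .
qed

text \<open>Coassociativity of the coaction of M \<otimes> N with its last leg split into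
  \<open>M\<close> and \<open>N\<close>. Multiplicativity of \<Delta> separates the two factors,
  their coassociativity laws are applied in turn, and multiplicativity of \<alpha> joins them again.
  The exchanges of sums bring each \<Delta> next to the coaction that it belongs to.\<close>

lemma tensor_coaction_trilinear:
  assumes m: "m \<in> carrier M" and n: "n \<in> carrier N" and P: "module R P"
    and F: "\<And>b c d. \<lbrakk>b \<in> carrier H; c \<in> carrier M; d \<in> carrier N\<rbrakk> \<Longrightarrow> (\<lambda>a. F a b c d) \<in>
        linear_maps R H P"
      "\<And>a c d. \<lbrakk>a \<in> carrier H; c \<in> carrier M; d \<in> carrier N\<rbrakk> \<Longrightarrow> (\<lambda>b. F a b c d) \<in> linear_maps R H P"
      "\<And>a b d. \<lbrakk>a \<in> carrier H; b \<in> carrier H; d \<in> carrier N\<rbrakk> \<Longrightarrow> (\<lambda>c. F a b c d) \<in> linear_maps R M P"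
      "\<And>a b c. \<lbrakk>a \<in> carrier H; b \<in> carrier H; c \<in> carrier M\<rbrakk> \<Longrightarrow> (\<lambda>d. F a b c d) \<in> linear_maps R N P"
  shows "tensor_lift R P (\<rho>\<^sub>M m) (\<lambda>u m\<^sub>0. tensor_lift R P (\<rho>\<^sub>N n) (\<lambda>v n\<^sub>0.
      tensor_lift R P (\<Delta> (u \<cdot> v)) (\<lambda>a b. F a b (\<alpha>\<^sub>M m\<^sub>0) (\<alpha>\<^sub>N n\<^sub>0)))) =
    tensor_lift R P (\<rho>\<^sub>M m) (\<lambda>u m\<^sub>0. tensor_lift R P (\<rho>\<^sub>N n) (\<lambda>v n\<^sub>0.
      tensor_lift R P (\<rho>\<^sub>M m\<^sub>0) (\<lambda>u' m\<^sub>0'. tensor_lift R P (\<rho>\<^sub>N n\<^sub>0) (\<lambda>v' n\<^sub>0'.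
        F (\<alpha> (u \<cdot> v)) (u' \<cdot> v') m\<^sub>0' n\<^sub>0'))))"
proof -
  note Fc = linear_maps_closed[OF F(1)]
  note FF = linear_maps_compose[OF F(1)] linear_maps_compose[OF F(2)] linear_maps_compose[OF F(3)]
    linear_maps_compose[OF F(4)]
  note rules = FF pair_linear_rules pair_closed_rules Fc P m n
  have "tensor_lift R P (\<rho>\<^sub>M m) (\<lambda>u m\<^sub>0. tensor_lift R P (\<rho>\<^sub>N n) (\<lambda>v n\<^sub>0.
      tensor_lift R P (\<Delta> (u \<cdot> v)) (\<lambda>a b. F a b (\<alpha>\<^sub>M m\<^sub>0) (\<alpha>\<^sub>N n\<^sub>0)))) =
    tensor_lift R P (\<rho>\<^sub>M m) (\<lambda>u m\<^sub>0. tensor_lift R P (\<rho>\<^sub>N n) (\<lambda>v n\<^sub>0.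
      tensor_lift R P (\<Delta> u) (\<lambda>u\<^sub>1 u\<^sub>2. tensor_lift R P (\<Delta> v) (\<lambda>v\<^sub>1 v\<^sub>2.
        F (u\<^sub>1 \<cdot> v\<^sub>1) (u\<^sub>2 \<cdot> v\<^sub>2) (\<alpha>\<^sub>M m\<^sub>0) (\<alpha>\<^sub>N n\<^sub>0)))))"
    by (rule M.lift_coact_cong[OF m], rule N.lift_coact_cong[OF n], rule lift_delta_mult[OF _ _ P])
      (rule bilinear_mapsI F pair_closed_rules | assumption)+
  also have "\<dots> = tensor_lift R P (\<rho>\<^sub>M m) (\<lambda>u m\<^sub>0. tensor_lift R P (\<Delta> u) (\<lambda>u\<^sub>1 u\<^sub>2.
      tensor_lift R P (\<rho>\<^sub>N n) (\<lambda>v n\<^sub>0. tensor_lift R P (\<Delta> v) (\<lambda>v\<^sub>1 v\<^sub>2.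
        F (u\<^sub>1 \<cdot> v\<^sub>1) (u\<^sub>2 \<cdot> v\<^sub>2) (\<alpha>\<^sub>M m\<^sub>0) (\<alpha>\<^sub>N n\<^sub>0)))))"
    by (rule M.lift_coact_cong[OF m], rule N.lift_delta_coact_swap[OF _ n P, symmetric])
      (rule pair_closed_rules Fc P | assumption)+
  \<comment> \<open>Coassociativity of \<open>M\<close>, with the entire sum over \<open>N\<close>
    as part of the trilinear form; afterwards the same is done for \<open>N\<close> with the
    components of \<open>M\<close> held fixed.\<close>
  also have "\<dots> = tensor_lift R P (\<rho>\<^sub>M m) (\<lambda>u m\<^sub>0. tensor_lift R P (\<rho>\<^sub>M m\<^sub>0) (\<lambda>u' m\<^sub>0'.
      tensor_lift R P (\<rho>\<^sub>N n) (\<lambda>v n\<^sub>0. tensor_lift R P (\<Delta> v) (\<lambda>v\<^sub>1 v\<^sub>2.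
        F (\<alpha> u \<cdot> v\<^sub>1) (u' \<cdot> v\<^sub>2) m\<^sub>0' (\<alpha>\<^sub>N n\<^sub>0)))))"
    by (rule M.lift_coact_coact[OF m P, symmetric])
      (rule N.linear_lift_coact_param n P linear_lift_delta_param FF(1)[OF _ _ _ linear_mult_left]
        FF(2)[OF _ _ _ linear_mult_left] F(3) linear_maps_id pair_closed_rules | assumption)+
  also have "\<dots> = tensor_lift R P (\<rho>\<^sub>M m) (\<lambda>u m\<^sub>0. tensor_lift R P (\<rho>\<^sub>M m\<^sub>0) (\<lambda>u' m\<^sub>0'.
      tensor_lift R P (\<rho>\<^sub>N n) (\<lambda>v n\<^sub>0. tensor_lift R P (\<rho>\<^sub>N n\<^sub>0) (\<lambda>v' n\<^sub>0'.
        F (\<alpha> u \<cdot> \<alpha> v) (u' \<cdot> v') m\<^sub>0' n\<^sub>0'))))"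
    by (rule M.lift_coact_cong[OF m], rule M.lift_coact_cong, assumption,
        rule N.lift_coact_coact[OF n P, symmetric])
      (rule FF(1)[OF _ _ _ linear_mult_right] FF(2)[OF _ _ _ linear_mult_right] F(4)
        linear_maps_id pair_closed_rules | assumption)+
  also have "\<dots> = tensor_lift R P (\<rho>\<^sub>M m) (\<lambda>u m\<^sub>0. tensor_lift R P (\<rho>\<^sub>N n) (\<lambda>v n\<^sub>0.
      tensor_lift R P (\<rho>\<^sub>M m\<^sub>0) (\<lambda>u' m\<^sub>0'. tensor_lift R P (\<rho>\<^sub>N n\<^sub>0) (\<lambda>v' n\<^sub>0'.
        F (\<alpha> u \<cdot> \<alpha> v) (u' \<cdot> v') m\<^sub>0' n\<^sub>0'))))"
    by (rule M.lift_coact_cong[OF m], rule lift_coact_coact_swap[OF _ n P])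
      (rule pair_closed_rules Fc P | assumption)+
  also have "\<dots> = tensor_lift R P (\<rho>\<^sub>M m) (\<lambda>u m\<^sub>0. tensor_lift R P (\<rho>\<^sub>N n) (\<lambda>v n\<^sub>0.
      tensor_lift R P (\<rho>\<^sub>M m\<^sub>0) (\<lambda>u' m\<^sub>0'. tensor_lift R P (\<rho>\<^sub>N n\<^sub>0) (\<lambda>v' n\<^sub>0'.
        F (\<alpha> (u \<cdot> v)) (u' \<cdot> v') m\<^sub>0' n\<^sub>0'))))"
    by (rule M.lift_coact_cong[OF m], rule N.lift_coact_cong[OF n]) (simp only: alpha_mult)
  finally show ?thesis .
qed

text \<open>\<open>tensor_assoc_left\<close> and \<open>tensor_assoc_right\<close> expand both sides
  into lifts over the coaction of \<open>t\<close>, linear in \<open>t\<close>. They are compared on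
  pure tensors, where \<open>tensor_coaction_trilinear\<close> applies with the nested pure tensor
  as its form.\<close>

lemma tensor_coaction_coassoc:
  assumes t: "t \<in> carrier (M \<boxtimes> N)"
  shows "tensor_assoc R H H (M \<boxtimes> N) (tensor_map R (H \<boxtimes> H) (M \<boxtimes> N) \<Delta> \<alpha>\<^sub>M\<^sub>N (\<rho>\<^sub>M\<^sub>N t)) =
    tensor_map R H (H \<boxtimes> M \<boxtimes> N) \<alpha> \<rho>\<^sub>M\<^sub>N (\<rho>\<^sub>M\<^sub>N t)"
proof -
  let ?Q = "H \<boxtimes> H \<boxtimes> M \<boxtimes> N"
  let ?p = "\<lambda>a b s. pure R H (H \<boxtimes> M \<boxtimes> N) a (pure R H (M \<boxtimes> N) b s)"
  note Q = module_tensor[OF H_module HMN_module]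
  note \<rho>t = linear_maps_closed[OF tensor_coaction_linear]
  note \<rho>_lin = linear_maps_compose[OF tensor_lift_linear[OF H_module MN_module Q]
      tensor_coaction_linear]
  note \<alpha>_lin = linear_maps_compose[OF alphaMN_linear]
  note rules = pair_linear_rules pair_closed_rules \<alpha>_lin linear_maps_closed[OF alphaMN_linear]
  note assoc_prems = H_module H_module MN_module H_module MN_module delta_linear alphaMN_linear
    alpha_linear tensor_coaction_linear \<rho>t[OF t]
  have left: "(\<lambda>x y. tensor_lift R ?Q (\<Delta> x) (\<lambda>a b. ?p a b (\<alpha>\<^sub>M\<^sub>N y))) \<in> bilinear_maps R H (M \<boxtimes> N) ?Q"
    by (rule rules | assumption)+
  have right: "(\<lambda>x y. tensor_lift R ?Q (\<rho>\<^sub>M\<^sub>N y) (\<lambda>b c. ?p (\<alpha> x) b c)) \<in> bilinear_maps R H (M \<boxtimes> N) ?Q"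
    by (rule bilinear_mapsI, rule tensor_lift_linear_param[OF H_module MN_module \<rho>t],
        assumption, rule Q)
      (rule \<rho>_lin rules | assumption)+
  have "tensor_lift R ?Q (\<rho>\<^sub>M\<^sub>N t) (\<lambda>x y. tensor_lift R ?Q (\<Delta> x) (\<lambda>a b. ?p a b (\<alpha>\<^sub>M\<^sub>N y))) =
    tensor_lift R ?Q (\<rho>\<^sub>M\<^sub>N t) (\<lambda>x y. tensor_lift R ?Q (\<rho>\<^sub>M\<^sub>N y) (\<lambda>b c. ?p (\<alpha> x) b c))"
  proof (rule tensor_ext[OF M.M_module N.M_module Q \<rho>_lin[OF left] \<rho>_lin[OF right] _ t])
    fix m n assume m: "m \<in> carrier M" and n: "n \<in> carrier N"
    have "tensor_lift R ?Q (\<rho>\<^sub>M\<^sub>N (pure R M N m n))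
        (\<lambda>x y. tensor_lift R ?Q (\<Delta> x) (\<lambda>a b. ?p a b (\<alpha>\<^sub>M\<^sub>N y))) =
      tensor_lift R ?Q (\<rho>\<^sub>M m) (\<lambda>u m\<^sub>0. tensor_lift R ?Q (\<rho>\<^sub>N n) (\<lambda>v n\<^sub>0.
        tensor_lift R ?Q (\<Delta> (u \<cdot> v)) (\<lambda>a b. ?p a b (\<alpha>\<^sub>M\<^sub>N (pure R M N m\<^sub>0 n\<^sub>0)))))"
      by (rule lift_tensor_coaction_pure[OF m n Q left])
    also have "\<dots> = tensor_lift R ?Q (\<rho>\<^sub>M m) (\<lambda>u m\<^sub>0. tensor_lift R ?Q (\<rho>\<^sub>N n) (\<lambda>v n\<^sub>0.
        tensor_lift R ?Q (\<Delta> (u \<cdot> v)) (\<lambda>a b. ?p a b (pure R M N (\<alpha>\<^sub>M m\<^sub>0) (\<alpha>\<^sub>N n\<^sub>0)))))"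
      by (rule M.lift_coact_cong[OF m], rule N.lift_coact_cong[OF n]) (simp only: alphaMN_pure)
    also have "\<dots> = tensor_lift R ?Q (\<rho>\<^sub>M m) (\<lambda>u m\<^sub>0. tensor_lift R ?Q (\<rho>\<^sub>N n) (\<lambda>v n\<^sub>0.
        tensor_lift R ?Q (\<rho>\<^sub>M m\<^sub>0) (\<lambda>u' m\<^sub>0'. tensor_lift R ?Q (\<rho>\<^sub>N n\<^sub>0) (\<lambda>v' n\<^sub>0'.
          ?p (\<alpha> (u \<cdot> v)) (u' \<cdot> v') (pure R M N m\<^sub>0' n\<^sub>0')))))"
      by (rule tensor_coaction_trilinear[OF m n Q])
        (rule pair_linear_rules pair_closed_rules | assumption)+
    also have "\<dots> = tensor_lift R ?Q (\<rho>\<^sub>M m) (\<lambda>u m\<^sub>0. tensor_lift R ?Q (\<rho>\<^sub>N n) (\<lambda>v n\<^sub>0.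
        tensor_lift R ?Q (\<rho>\<^sub>M\<^sub>N (pure R M N m\<^sub>0 n\<^sub>0)) (\<lambda>b c. ?p (\<alpha> (u \<cdot> v)) b c)))"
      by (rule M.lift_coact_cong[OF m], rule N.lift_coact_cong[OF n],
          rule lift_tensor_coaction_pure[OF _ _ Q, symmetric])
        (rule pair_linear_rules pair_closed_rules | assumption)+
    also have "\<dots> = tensor_lift R ?Q (\<rho>\<^sub>M\<^sub>N (pure R M N m n))
        (\<lambda>x y. tensor_lift R ?Q (\<rho>\<^sub>M\<^sub>N y) (\<lambda>b c. ?p (\<alpha> x) b c))"
      by (rule lift_tensor_coaction_pure[OF m n Q right, symmetric])
    finally show "tensor_lift R ?Q (\<rho>\<^sub>M\<^sub>N (pure R M N m n))
        (\<lambda>x y. tensor_lift R ?Q (\<Delta> x) (\<lambda>a b. ?p a b (\<alpha>\<^sub>M\<^sub>N y))) =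
      tensor_lift R ?Q (\<rho>\<^sub>M\<^sub>N (pure R M N m n))
        (\<lambda>x y. tensor_lift R ?Q (\<rho>\<^sub>M\<^sub>N y) (\<lambda>b c. ?p (\<alpha> x) b c))" .
  qed
  then show ?thesis
    using tensor_assoc_left[OF assoc_prems] tensor_assoc_right[OF assoc_prems] by (simp only:)
qed

lemma hom_comodule_tensor: "hom_comodule R H \<mu> \<Delta> \<alpha> (M \<boxtimes> N) \<alpha>\<^sub>M\<^sub>N \<rho>\<^sub>M\<^sub>N"
  by (intro hom_comodule.intro hom_comodule_axioms.intro hom_bialgebra_axioms MN_module
      alphaMN_linear
      tensor_coaction_linear tensor_coaction_alpha tensor_coaction_coassoc)

text \<open>With M \<otimes> N as the comodule, all of (i) becomes available for it, including the
  Yetter-Drinfeld condition of its induced action.\<close>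

sublocale MN: invariant_comodule R H \<mu> \<Delta> \<alpha> \<sigma> "M \<boxtimes> N" \<alpha>\<^sub>M\<^sub>N \<rho>\<^sub>M\<^sub>N
  by (intro invariant_comodule.intro invariant_coquasitriangular_axioms hom_comodule_tensor)

section \<open>Comparison of the two actions on M \<otimes> N\<close>

lemma tensor_induced_action_pure:
  assumes h: "h \<in> carrier H" and m: "m \<in> carrier M" and n: "n \<in> carrier N"
  shows "MN.iact (pure R H (M \<boxtimes> N) h (pure R M N m n)) =
    tensor_lift R (M \<boxtimes> N) (\<Delta> h) (\<lambda>h\<^sub>1 h\<^sub>2.
      tensor_lift R (M \<boxtimes> N) (\<rho>\<^sub>M m) (\<lambda>u m\<^sub>0. tensor_lift R (M \<boxtimes> N) (\<rho>\<^sub>N n) (\<lambda>v n\<^sub>0.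
        sg (\<alpha> u) h\<^sub>1 \<odot>\<^bsub>M \<boxtimes> N\<^esub> (sg (\<alpha> v) h\<^sub>2 \<odot>\<^bsub>M \<boxtimes> N\<^esub> pure R M N m\<^sub>0 n\<^sub>0))))"
proof -
  let ?P = "M \<boxtimes> N"
  note P = MN_module
  note closed = pair_closed_rules module.smult_closed[OF P]
  have "MN.iact (pure R H ?P h (pure R M N m n)) =
    tensor_lift R ?P (\<rho>\<^sub>M\<^sub>N (pure R M N m n)) (\<lambda>u v. sg u (\<alpha> h) \<odot>\<^bsub>?P\<^esub> v)"
    by (rule MN.induced_action_pure) (rule closed h m n)+
  also have "\<dots> = tensor_lift R ?P (\<rho>\<^sub>M m) (\<lambda>u m\<^sub>0. tensor_lift R ?P (\<rho>\<^sub>N n) (\<lambda>v n\<^sub>0.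
      sg (u \<cdot> v) (\<alpha> h) \<odot>\<^bsub>?P\<^esub> pure R M N m\<^sub>0 n\<^sub>0))"
    by (rule lift_tensor_coaction_pure[OF m n P]) (rule pair_linear_rules closed h | assumption)+
  \<comment> \<open>The \<alpha> on \<open>h\<close> in the induced action is the twist that the
    left multiplication axiom asks for, so \<sigma> opens into a sum over \<open>\<Delta> h\<close>.
    The next steps move that sum outermost, where the tensor product action has it.\<close>
  also have "\<dots> = tensor_lift R ?P (\<rho>\<^sub>M m) (\<lambda>u m\<^sub>0. tensor_lift R ?P (\<rho>\<^sub>N n) (\<lambda>v n\<^sub>0.
      tensor_lift R ?P (\<Delta> h) (\<lambda>h\<^sub>1 h\<^sub>2.
        sg (\<alpha> u) h\<^sub>1 \<odot>\<^bsub>?P\<^esub> (sg (\<alpha> v) h\<^sub>2 \<odot>\<^bsub>?P\<^esub> pure R M N m\<^sub>0 n\<^sub>0))))"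
    by (rule M.lift_coact_cong[OF m], rule N.lift_coact_cong[OF n], rule sg_mult_left_smult)
      (rule closed h | assumption)+
  also have "\<dots> = tensor_lift R ?P (\<rho>\<^sub>M m) (\<lambda>u m\<^sub>0. tensor_lift R ?P (\<Delta> h) (\<lambda>h\<^sub>1 h\<^sub>2.
      tensor_lift R ?P (\<rho>\<^sub>N n) (\<lambda>v n\<^sub>0.
        sg (\<alpha> u) h\<^sub>1 \<odot>\<^bsub>?P\<^esub> (sg (\<alpha> v) h\<^sub>2 \<odot>\<^bsub>?P\<^esub> pure R M N m\<^sub>0 n\<^sub>0))))"
    by (rule M.lift_coact_cong[OF m], rule N.lift_delta_coact_swap[OF h n P, symmetric])
      (rule closed h | assumption)+
  also have "\<dots> = tensor_lift R ?P (\<Delta> h) (\<lambda>h\<^sub>1 h\<^sub>2. tensor_lift R ?P (\<rho>\<^sub>M m) (\<lambda>u m\<^sub>0.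
      tensor_lift R ?P (\<rho>\<^sub>N n) (\<lambda>v n\<^sub>0.
        sg (\<alpha> u) h\<^sub>1 \<odot>\<^bsub>?P\<^esub> (sg (\<alpha> v) h\<^sub>2 \<odot>\<^bsub>?P\<^esub> pure R M N m\<^sub>0 n\<^sub>0))))"
    by (rule M.lift_delta_coact_swap[OF h m P, symmetric]) (rule closed n h | assumption)+
  finally show ?thesis .
qed

lemma pure_induced_actions:
  assumes h: "h\<^sub>1 \<in> carrier H" "h\<^sub>2 \<in> carrier H" and m: "m \<in> carrier M" and n: "n \<in> carrier N"
  shows "pure R M N (M.iact (pure R H M h\<^sub>1 m)) (N.iact (pure R H N h\<^sub>2 n)) =
    tensor_lift R (M \<boxtimes> N) (\<rho>\<^sub>M m) (\<lambda>u m\<^sub>0. tensor_lift R (M \<boxtimes> N) (\<rho>\<^sub>N n) (\<lambda>v n\<^sub>0.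
      sg u (\<alpha> h\<^sub>1) \<odot>\<^bsub>M \<boxtimes> N\<^esub> (sg v (\<alpha> h\<^sub>2) \<odot>\<^bsub>M \<boxtimes> N\<^esub> pure R M N m\<^sub>0 n\<^sub>0)))"
proof -
  let ?P = "M \<boxtimes> N"
  note P = MN_module
  note closed = pair_closed_rules module.smult_closed[OF P]
  have Nact: "N.iact (pure R H N h\<^sub>2 n) \<in> carrier N"
    by (rule linear_maps_closed[OF N.induced_action_linear]) (rule closed h n)+
  have "pure R M N (M.iact (pure R H M h\<^sub>1 m)) (N.iact (pure R H N h\<^sub>2 n)) =
    tensor_lift R ?P (\<rho>\<^sub>M m) (\<lambda>u m\<^sub>0. sg u (\<alpha> h\<^sub>1) \<odot>\<^bsub>?P\<^esub> pure R M N m\<^sub>0 (N.iact (pure R H N h\<^sub>2 n)))"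
    by (rule M.linear_maps_induced_action[OF h(1) m P
        pure_linear_left[OF M.M_module N.M_module Nact]])
  also have "\<dots> = tensor_lift R ?P (\<rho>\<^sub>M m) (\<lambda>u m\<^sub>0. tensor_lift R ?P (\<rho>\<^sub>N n) (\<lambda>v n\<^sub>0.
      sg u (\<alpha> h\<^sub>1) \<odot>\<^bsub>?P\<^esub> (sg v (\<alpha> h\<^sub>2) \<odot>\<^bsub>?P\<^esub> pure R M N m\<^sub>0 n\<^sub>0)))"
    apply (rule M.lift_coact_cong[OF m])
    apply (subst N.linear_maps_induced_action[OF h(2) n P
        pure_linear_right[OF M.M_module N.M_module]],
        assumption)
    apply (rule N.smult_lift_coact[OF n P])
     apply (rule closed h | assumption)+
    done
  finally show ?thesis .
qed

context
  assumes bij: "bij_betw \<alpha> (carrier H) (carrier H)"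
begin

lemma alpha_inverse:
  assumes "x \<in> carrier H"
  shows "inv_into (carrier H) \<alpha> x \<in> carrier H" "\<alpha> (inv_into (carrier H) \<alpha> x) = x"
  using bij_betw_apply[OF bij_betw_inv_into[OF bij] assms] bij_betw_inv_into_right[OF bij assms]
  by simp_all

lemma tensor_action_pure:
  assumes h: "h \<in> carrier H" and m: "m \<in> carrier M" and n: "n \<in> carrier N"
  defines "\<beta> \<equiv> inv_into (carrier H) \<alpha>"
  shows "tensor_lift R (M \<boxtimes> N) (\<Delta> h) (\<lambda>h\<^sub>1 h\<^sub>2.
      pure R M N (M.iact (pure R H M (\<beta> (\<beta> h\<^sub>1)) m)) (N.iact (pure R H N (\<beta> (\<beta> h\<^sub>2)) n))) =
    MN.iact (pure R H (M \<boxtimes> N) h (pure R M N m n))"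
  unfolding tensor_induced_action_pure[OF h m n]
proof (rule lift_delta_cong[OF h])
  fix h\<^sub>1 h\<^sub>2 assume h12: "h\<^sub>1 \<in> carrier H" "h\<^sub>2 \<in> carrier H"
  have \<beta>: "\<beta> x \<in> carrier H" "\<alpha> (\<beta> x) = x" if "x \<in> carrier H" for x
    using alpha_inverse[OF that] by (simp_all add: \<beta>_def)
  \<comment> \<open>The outer \<alpha> cancels one inverse; invariance then applies \<alpha> to both
    arguments, which cancels the other inverse and leaves an \<alpha> on \<open>u\<close>.\<close>
  have sg: "sg u (\<alpha> (\<beta> (\<beta> x))) = sg (\<alpha> u) x" if "u \<in> carrier H" "x \<in> carrier H" for u x
    using sg_alpha[OF that(1) \<beta>(1)[OF that(2)]] \<beta> that by simp
  show "pure R M N (M.iact (pure R H M (\<beta> (\<beta> h\<^sub>1)) m)) (N.iact (pure R H N (\<beta> (\<beta> h\<^sub>2)) n)) =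
    tensor_lift R (M \<boxtimes> N) (\<rho>\<^sub>M m) (\<lambda>u m\<^sub>0. tensor_lift R (M \<boxtimes> N) (\<rho>\<^sub>N n) (\<lambda>v n\<^sub>0.
      sg (\<alpha> u) h\<^sub>1 \<odot>\<^bsub>M \<boxtimes> N\<^esub> (sg (\<alpha> v) h\<^sub>2 \<odot>\<^bsub>M \<boxtimes> N\<^esub> pure R M N m\<^sub>0 n\<^sub>0)))"
    unfolding pure_induced_actions[OF \<beta>(1)[OF \<beta>(1)[OF h12(1)]] \<beta>(1)[OF \<beta>(1)[OF h12(2)]] m n]
    by (rule M.lift_coact_cong[OF m], rule N.lift_coact_cong[OF n]) (simp only: sg h12)
qed

text \<open>The tensor product action agrees with the induced action on every \<open>h \<otimes> (m \<otimes> n)\<close>, which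
  rewrites its defining iterated lift into that of the linear map \<^term>\<open>MN.iact\<close>; so neither
  linearity of \<open>\<alpha>\<^sup>-\<^sup>1\<close> nor multilinearity of the tensor product action has to be checked.\<close>

lemma yd_tensor_action_eq:
  assumes t: "t \<in> carrier (H \<boxtimes> M \<boxtimes> N)"
  shows "yd_tensor_action R H \<Delta> \<alpha> M M.iact N N.iact t = MN.iact t"
proof -
  note lin = MN.induced_action_linear
  have "yd_tensor_action R H \<Delta> \<alpha> M M.iact N N.iact t =
    tensor_lift R (M \<boxtimes> N) t (\<lambda>h s. MN.iact (pure R H (M \<boxtimes> N) h s))"
    unfolding yd_tensor_action_def Let_def
  proof (rule tensor_lift_cong[OF H_module MN_module t])
    fix h s assume h: "h \<in> carrier H" and s: "s \<in> carrier (M \<boxtimes> N)"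
    have "MN.iact (pure R H (M \<boxtimes> N) h s) =
      MN.iact (pure R H (M \<boxtimes> N) h (tensor_lift R (M \<boxtimes> N) s (pure R M N)))"
      by (simp only: tensor_lift_pure_id[OF M.M_module N.M_module s])
    also have "\<dots> = tensor_lift R (M \<boxtimes> N) s (\<lambda>m n. MN.iact (pure R H (M \<boxtimes> N) h (pure R M N m n)))"
      by (rule linear_maps_tensor_lift[OF M.M_module N.M_module s MN_module MN_module
            linear_maps_compose[OF lin pure_linear_right[OF H_module MN_module h]]
            pure_closed[OF M.M_module N.M_module]])
    also have "\<dots> = tensor_lift R (M \<boxtimes> N) s (\<lambda>m n. tensor_lift R (M \<boxtimes> N) (\<Delta> h) (\<lambda>h\<^sub>1 h\<^sub>2.
        pure R M N
          (M.iact (pure R H M (inv_into (carrier H) \<alpha> (inv_into (carrier H) \<alpha> h\<^sub>1)) m))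
          (N.iact (pure R H N (inv_into (carrier H) \<alpha> (inv_into (carrier H) \<alpha> h\<^sub>2)) n))))"
      by (rule tensor_lift_cong[OF M.M_module N.M_module s],
          rule tensor_action_pure[OF h, symmetric])
    finally show "tensor_lift R (M \<boxtimes> N) s (\<lambda>m n. tensor_lift R (M \<boxtimes> N) (\<Delta> h) (\<lambda>h\<^sub>1 h\<^sub>2.
        pure R M N
          (M.iact (pure R H M (inv_into (carrier H) \<alpha> (inv_into (carrier H) \<alpha> h\<^sub>1)) m))
          (N.iact (pure R H N (inv_into (carrier H) \<alpha> (inv_into (carrier H) \<alpha> h\<^sub>2)) n)))) =
      MN.iact (pure R H (M \<boxtimes> N) h s)" ..
  qed
  also have "\<dots> = MN.iact (tensor_lift R (H \<boxtimes> M \<boxtimes> N) t (pure R H (M \<boxtimes> N)))"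
    by (rule linear_maps_tensor_lift[OF H_module MN_module t HMN_module MN_module lin
          pure_closed[OF H_module MN_module], symmetric])
  also have "\<dots> = MN.iact t"
    by (simp only: tensor_lift_pure_id[OF H_module MN_module t])
  finally show ?thesis .
qed

end

end

text \<open>The two actions are known to agree on the carrier of the tensor product, not as
  functions. That suffices because the axioms evaluate an action only at pure tensors of carrier
  elements, apart from linearity, which is likewise a condition on the carrier.\<close>

lemma yetter_drinfeld_cong_action:
  fixes R (structure)
  assumes "yetter_drinfeld R H \<mu> \<Delta> \<alpha> M \<alpha>\<^sub>M act \<rho>"
    and eq: "\<And>t. t \<in> carrier (H \<boxtimes> M) \<Longrightarrow> act' t = act t"
  shows "yetter_drinfeld R H \<mu> \<Delta> \<alpha> M \<alpha>\<^sub>M act' \<rho>"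
proof -
  interpret yetter_drinfeld R H \<mu> \<Delta> \<alpha> M \<alpha>\<^sub>M act \<rho> by fact
  note M = M.module_axioms
  note pc = pure_closed[OF H_module M]
  have act_closed: "act (pure R H M h m) \<in> carrier M" if "h \<in> carrier H" "m \<in> carrier M" for h m
    by (rule linear_maps_closed[OF act_linear pc[OF that]])
  have eqp: "act' (pure R H M h m) = act (pure R H M h m)" if "h \<in> carrier H"
      "m \<in> carrier M" for h m
    by (rule eq[OF pc[OF that]])
  show ?thesis
  proof (intro yetter_drinfeld.intro hom_module.intro hom_module_axioms.intro
      yetter_drinfeld_axioms.intro hom_bialgebra_axioms M hom_comodule_axioms alphaM_linear)
    show "act' \<in> linear_maps R (H \<boxtimes> M) M"
      by (rule linear_maps_cong[OF module_tensor[OF H_module M] act_linear eq])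
  next
    fix h m assume "h \<in> carrier H" "m \<in> carrier M"
    then show "\<alpha>\<^sub>M (act' (pure R H M h m)) = act' (pure R H M (\<alpha> h) (\<alpha>\<^sub>M m))"
      by (simp only: eqp alpha_act alpha_closed linear_maps_closed[OF alphaM_linear])
  next
    fix h h' m assume "h \<in> carrier H" "h' \<in> carrier H" "m \<in> carrier M"
    then show "act' (pure R H M (\<alpha> h) (act' (pure R H M h' m))) = act' (pure R H M (h \<cdot> h') (\<alpha>\<^sub>M m))"
      by (simp only: eqp act_act alpha_closed linear_maps_closed[OF alphaM_linear] act_closed
          mult_closed)
  next
    fix h m assume h: "h \<in> carrier H" and m: "m \<in> carrier M"
    have "tensor_lift R (H \<boxtimes> M) (\<Delta> h) (\<lambda>h\<^sub>1 h\<^sub>2.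
        tensor_lift R (H \<boxtimes> M) (\<rho> (act' (pure R H M h\<^sub>1 m))) (\<lambda>u v. pure R H M (u \<cdot> \<alpha> (\<alpha> h\<^sub>2)) v)) =
      tensor_lift R (H \<boxtimes> M) (\<Delta> h) (\<lambda>h\<^sub>1 h\<^sub>2.
        tensor_lift R (H \<boxtimes> M) (\<rho> (act (pure R H M h\<^sub>1 m))) (\<lambda>u v. pure R H M (u \<cdot> \<alpha> (\<alpha> h\<^sub>2)) v))"
      by (rule lift_delta_cong[OF h]) (simp only: eqp m)
    also have "\<dots> = tensor_lift R (H \<boxtimes> M) (\<Delta> h) (\<lambda>h\<^sub>1 h\<^sub>2. tensor_lift R (H \<boxtimes> M) (\<rho> m) (\<lambda>u v.
        pure R H M (\<alpha> (\<alpha> h\<^sub>1) \<cdot> \<alpha> u) (act (pure R H M (\<alpha> h\<^sub>2) v))))"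
      by (rule yd_compat[OF h m])
    also have "\<dots> = tensor_lift R (H \<boxtimes> M) (\<Delta> h) (\<lambda>h\<^sub>1 h\<^sub>2. tensor_lift R (H \<boxtimes> M) (\<rho> m) (\<lambda>u v.
        pure R H M (\<alpha> (\<alpha> h\<^sub>1) \<cdot> \<alpha> u) (act' (pure R H M (\<alpha> h\<^sub>2) v))))"
      by (rule lift_delta_cong[OF h],
          rule tensor_lift_cong[OF H_module M linear_maps_closed[OF coact_linear m]])
        (simp only: eqp alpha_closed)
    finally show "tensor_lift R (H \<boxtimes> M) (\<Delta> h) (\<lambda>h\<^sub>1 h\<^sub>2.
        tensor_lift R (H \<boxtimes> M) (\<rho> (act' (pure R H M h\<^sub>1 m))) (\<lambda>u v. pure R H M (u \<cdot> \<alpha> (\<alpha> h\<^sub>2)) v)) =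
      tensor_lift R (H \<boxtimes> M) (\<Delta> h) (\<lambda>h\<^sub>1 h\<^sub>2. tensor_lift R (H \<boxtimes> M) (\<rho> m) (\<lambda>u v.
        pure R H M (\<alpha> (\<alpha> h\<^sub>1) \<cdot> \<alpha> u) (act' (pure R H M (\<alpha> h\<^sub>2) v))))" .
  qed
qed

theorem proposition4p2:
  fixes R :: "('k, 'r) ring_scheme"
    and H :: "('k, 'h) module" and M :: "('k, 'm) module" and N :: "('k, 'n) module"
  assumes H: "coquasitriangular_hom_bialgebra R H \<mu> \<Delta> \<alpha>\<^sub>H \<sigma>"
    and \<sigma>: "\<forall>t \<in> carrier (H \<boxtimes>\<^bsub>R\<^esub> H). \<sigma> t = \<sigma> (tensor_map R H H \<alpha>\<^sub>H \<alpha>\<^sub>H t)"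
    and M: "hom_comodule R H \<mu> \<Delta> \<alpha>\<^sub>H M \<alpha>\<^sub>M \<rho>\<^sub>M"
  shows "yetter_drinfeld R H \<mu> \<Delta> \<alpha>\<^sub>H M \<alpha>\<^sub>M (induced_action R H \<alpha>\<^sub>H \<sigma> M \<rho>\<^sub>M) \<rho>\<^sub>M
    \<and> (bij_betw \<alpha>\<^sub>H (carrier H) (carrier H) \<and> hom_comodule R H \<mu> \<Delta> \<alpha>\<^sub>H N \<alpha>\<^sub>N \<rho>\<^sub>N \<longrightarrow>
        (let MN = M \<boxtimes>\<^bsub>R\<^esub> N;
             \<alpha>\<^sub>M\<^sub>N = tensor_map R M N \<alpha>\<^sub>M \<alpha>\<^sub>N;
             \<rho>\<^sub>M\<^sub>N = tensor_coaction R H \<mu> M \<rho>\<^sub>M N \<rho>\<^sub>N;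
             act = induced_action R H \<alpha>\<^sub>H \<sigma> MN \<rho>\<^sub>M\<^sub>N;
             act' = yd_tensor_action R H \<Delta> \<alpha>\<^sub>H
                      M (induced_action R H \<alpha>\<^sub>H \<sigma> M \<rho>\<^sub>M) N (induced_action R H \<alpha>\<^sub>H \<sigma> N \<rho>\<^sub>N)
         in hom_comodule R H \<mu> \<Delta> \<alpha>\<^sub>H MN \<alpha>\<^sub>M\<^sub>N \<rho>\<^sub>M\<^sub>N
          \<and> yetter_drinfeld R H \<mu> \<Delta> \<alpha>\<^sub>H MN \<alpha>\<^sub>M\<^sub>N act \<rho>\<^sub>M\<^sub>N
          \<and> yetter_drinfeld R H \<mu> \<Delta> \<alpha>\<^sub>H MN \<alpha>\<^sub>M\<^sub>N act' \<rho>\<^sub>M\<^sub>N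
          \<and> (\<forall>t \<in> carrier (H \<boxtimes>\<^bsub>R\<^esub> MN). act t = act' t)))"
proof -
  have inv: "invariant_coquasitriangular R H \<mu> \<Delta> \<alpha>\<^sub>H \<sigma>"
    using \<sigma> by (intro invariant_coquasitriangular.intro H
        invariant_coquasitriangular_axioms.intro) blast
  interpret M: invariant_comodule R H \<mu> \<Delta> \<alpha>\<^sub>H \<sigma> M \<alpha>\<^sub>M \<rho>\<^sub>M
    by (intro invariant_comodule.intro inv M)
  show ?thesis
    unfolding Let_def
  proof (intro conjI impI; (elim conjE)?)
    show "yetter_drinfeld R H \<mu> \<Delta> \<alpha>\<^sub>H M \<alpha>\<^sub>M (induced_action R H \<alpha>\<^sub>H \<sigma> M \<rho>\<^sub>M) \<rho>\<^sub>M"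
      by (rule M.yetter_drinfeld_induced_action)
  next
    assume bij: "bij_betw \<alpha>\<^sub>H (carrier H) (carrier H)"
      and N: "hom_comodule R H \<mu> \<Delta> \<alpha>\<^sub>H N \<alpha>\<^sub>N \<rho>\<^sub>N"
    interpret N: invariant_comodule R H \<mu> \<Delta> \<alpha>\<^sub>H \<sigma> N \<alpha>\<^sub>N \<rho>\<^sub>N
      by (intro invariant_comodule.intro inv N)
    interpret pair: invariant_comodule_pair R H \<mu> \<Delta> \<alpha>\<^sub>H \<sigma> M \<alpha>\<^sub>M \<rho>\<^sub>M N \<alpha>\<^sub>N \<rho>\<^sub>N
      by (intro invariant_comodule_pair.intro inv M.invariant_comodule_axioms
          N.invariant_comodule_axioms)
    note eq = pair.yd_tensor_action_eq[OF bij]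
    show "hom_comodule R H \<mu> \<Delta> \<alpha>\<^sub>H (M \<boxtimes>\<^bsub>R\<^esub> N) (tensor_map R M N \<alpha>\<^sub>M \<alpha>\<^sub>N)
        (tensor_coaction R H \<mu> M \<rho>\<^sub>M N \<rho>\<^sub>N)"
      by (rule pair.hom_comodule_tensor)
    show "yetter_drinfeld R H \<mu> \<Delta> \<alpha>\<^sub>H (M \<boxtimes>\<^bsub>R\<^esub> N) (tensor_map R M N \<alpha>\<^sub>M \<alpha>\<^sub>N)
        (induced_action R H \<alpha>\<^sub>H \<sigma> (M \<boxtimes>\<^bsub>R\<^esub> N) (tensor_coaction R H \<mu> M \<rho>\<^sub>M N \<rho>\<^sub>N))
        (tensor_coaction R H \<mu> M \<rho>\<^sub>M N \<rho>\<^sub>N)"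
      by (rule pair.MN.yetter_drinfeld_induced_action)
    \<comment> \<open>The axioms for the tensor product action are inherited from the induced one;
      bijectivity of \<alpha> enters through \<open>eq\<close>.\<close>
    then show "yetter_drinfeld R H \<mu> \<Delta> \<alpha>\<^sub>H (M \<boxtimes>\<^bsub>R\<^esub> N) (tensor_map R M N \<alpha>\<^sub>M \<alpha>\<^sub>N)
        (yd_tensor_action R H \<Delta> \<alpha>\<^sub>H M (induced_action R H \<alpha>\<^sub>H \<sigma> M \<rho>\<^sub>M)
          N (induced_action R H \<alpha>\<^sub>H \<sigma> N \<rho>\<^sub>N))
        (tensor_coaction R H \<mu> M \<rho>\<^sub>M N \<rho>\<^sub>N)"
      by (rule yetter_drinfeld_cong_action[OF _ eq])
    show "\<forall>t \<in> carrier (H \<boxtimes>\<^bsub>R\<^esub> M \<boxtimes>\<^bsub>R\<^esub> N).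
        induced_action R H \<alpha>\<^sub>H \<sigma> (M \<boxtimes>\<^bsub>R\<^esub> N) (tensor_coaction R H \<mu> M \<rho>\<^sub>M N \<rho>\<^sub>N) t =
        yd_tensor_action R H \<Delta> \<alpha>\<^sub>H M (induced_action R H \<alpha>\<^sub>H \<sigma> M \<rho>\<^sub>M)
          N (induced_action R H \<alpha>\<^sub>H \<sigma> N \<rho>\<^sub>N) t"
      by (intro ballI eq[symmetric])
  qed
qed

end
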